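(* Let $a,b,c,d\ge1$ and $e\ge0$ be integers with $a+b+c+d+e=n$, and let $w\in\mathfrak S_n$ be the permutation with one-line notation $$(b+1..b+a:\;1..b:\;b+a+1..b+a+e:\;n-c+1..n:\;n-c-d+1..n-c)$$ (i.e. $w$ has block structure $[2][1][3][5][4]$ with block lengths $a,b,e,c,d$). Let $u\in\mathfrak S_n$. Then the coefficient $f_w(u)$ of $x_u$ in the Temperley-Lieb immanant $\operatorname{Imm}_w$ is as follows. (i) $f_w(u)=0$ if there exists $i\in[1,a]$ with $u(i)\in[1,b]$, or there exists $i\in[n+1-d,n]$ with $u(i)\in[n+1-c,n]$. (ii) Otherwise, $f_w(u)=\operatorname{sgn}(w)\operatorname{sgn}(u)\binom{A+B}{A}$, where $A=|[1,a]\cap u^{-1}([n+1-c,n])|$ and $B=|[1,b]\cap u([n+1-d,n])|$.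
   Context: Notation. $[p,q]=\{p,p+1,\dots,q\}$ (empty if $p>q$); $(p..q)$ denotes the sequence $p,p+1,\dots,q$ (empty if $p>q$), and colons denote concatenation of sequences. $\mathfrak S_n$ is the symmetric group on $[n]=[1,n]$ with product $(v\cdot w)(i)=v(w(i))$; $s_i=(i,i+1)$ for $1\le i\le n-1$. $x_{i,j}$ ($1\le i,j\le n$) are commuting variables, and $x_u=\prod_{i=1}^n x_{i,u(i)}$ for $u\in\mathfrak S_n$. A permutation is $321$-avoiding if there are no $i<j<k$ with $w(i)>w(j)>w(k)$ (the $w$ in the claim is $321$-avoiding). Temperley-Lieb immanants. $TL_n(2)$ is the unital associative $\mathbb C$-algebra generated by $t_1,\dots,t_{n-1}$ with relations $t_i^2=2t_i$, $t_it_j=t_jt_i$ if $|i-j|\ge2$, and $t_it_jt_i=t_i$ if $|i-j|=1$. Let $\theta:\mathbb C[\mathfrak S_n]\to TL_n(2)$ be the $\mathbb C$-algebra homomorphism with $\theta(s_i)=t_i-1$. For a $321$-avoiding $w\in\mathfrak S_n$ with reduced word $s_{i_1}\cdots s_{i_k}$, put $\beta(w)=t_{i_1}\cdots t_{i_k}$; this does not depend on the reduced word, and the $\beta(w)$, over $321$-avoiding $w\in\mathfrak S_n$, form a basis of $TL_n(2)$. For $u\in\mathfrak S_n$ let $f_w(u)$ be the coefficient of $\beta(w)$ in the expansion of $\theta(u)$ in this basis, and $\operatorname{Imm}_w=\sum_{u\in\mathfrak S_n}f_w(u)x_u$. *)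

theory Defs
  imports
    Complex_Main
    "HOL-Library.Poly_Mapping"
    "HOL-Combinatorics.Transposition"
    "HOL-Algebra.Sym_Groups"
    "HOL-Algebra.QuotRing"
    "HOL-Algebra.Module"
begin

section \<open>Complex algebras\<close>

text \<open>A unital associative algebra over the complex numbers is represented by a record of
  type \<open>(complex, _) module\<close>. The locales \<open>module\<close> and \<open>algebra\<close> of HOL-Algebra are not used:
  the scalars are the type \<^typ>\<open>complex\<close>, and the algebras are not commutative.\<close>

text \<open>The monoid algebra of a monoid: finitely supported functions on its carrier, with
  convolution as product.\<close>

definition monoid_algebra :: "('m, 'x) monoid_scheme \<Rightarrow> (complex, 'm \<Rightarrow> complex) module" where
  "monoid_algebra M =
     \<lparr> carrier = {f. finite {x. f x \<noteq> 0} \<and> {x. f x \<noteq> 0} \<subseteq> carrier M},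
       mult = (\<lambda>f g z. \<Sum>(x, y) \<in> {(x, y). f x \<noteq> 0 \<and> g y \<noteq> 0 \<and> x \<otimes>\<^bsub>M\<^esub> y = z}. f x * g y),
       one = (\<lambda>x. if x = \<one>\<^bsub>M\<^esub> then 1 else 0),
       zero = (\<lambda>x. 0),
       add = (\<lambda>f g x. f x + g x),
       smult = (\<lambda>c f x. c * f x) \<rparr>"

definition of_elem :: "'m \<Rightarrow> 'm \<Rightarrow> complex" where
  "of_elem x = (\<lambda>y. if y = x then 1 else 0)"

text \<open>The quotient of an algebra by a two-sided ideal; a scalar \<open>c\<close> acts as multiplication by
  the class of \<open>c \<cdot> 1\<close>.\<close>

definition quot_algebra :: "(complex, 'b) module \<Rightarrow> 'b set \<Rightarrow> (complex, 'b set) module" where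
  "quot_algebra A I = ring.extend (A Quot I)
     \<lparr> smult = (\<lambda>c X. (I +>\<^bsub>A\<^esub> (c \<odot>\<^bsub>A\<^esub> \<one>\<^bsub>A\<^esub>)) \<otimes>\<^bsub>A Quot I\<^esub> X) \<rparr>"

definition algebra_hom :: "(complex, 'b) module \<Rightarrow> (complex, 'c) module \<Rightarrow> ('b \<Rightarrow> 'c) set" where
  "algebra_hom A B =
     {h \<in> ring_hom A B. \<forall>c. \<forall>x\<in>carrier A. h (c \<odot>\<^bsub>A\<^esub> x) = c \<odot>\<^bsub>B\<^esub> h x}"


section \<open>The Temperley-Lieb algebra with loop parameter 2\<close>

text \<open>The free algebra on \<open>t\<^sub>1, \<dots>, t\<^bsub>n-1\<^esub>\<close>, with basis the words in the letters
  \<open>1, \<dots>, n-1\<close>.\<close>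

definition word_monoid :: "nat \<Rightarrow> nat list monoid" where
  "word_monoid n = \<lparr> carrier = lists {1..<n}, mult = (@), one = [] \<rparr>"

definition free_alg :: "nat \<Rightarrow> (complex, nat list \<Rightarrow> complex) module" where
  "free_alg n = monoid_algebra (word_monoid n)"

abbreviation free_gen :: "nat \<Rightarrow> nat list \<Rightarrow> complex" where
  "free_gen i \<equiv> of_elem [i]"

definition TL_relators :: "nat \<Rightarrow> (nat list \<Rightarrow> complex) set" where
  "TL_relators n =
     {free_gen i \<otimes>\<^bsub>free_alg n\<^esub> free_gen i \<ominus>\<^bsub>free_alg n\<^esub> 2 \<odot>\<^bsub>free_alg n\<^esub> free_gen i
        | i. i \<in> {1..<n}} \<union>
     {free_gen i \<otimes>\<^bsub>free_alg n\<^esub> free_gen j \<ominus>\<^bsub>free_alg n\<^esub> free_gen j \<otimes>\<^bsub>free_alg n\<^esub> free_gen i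
        | i j. i \<in> {1..<n} \<and> j \<in> {1..<n} \<and> \<bar>int i - int j\<bar> \<ge> 2} \<union>
     {free_gen i \<otimes>\<^bsub>free_alg n\<^esub> free_gen j \<otimes>\<^bsub>free_alg n\<^esub> free_gen i \<ominus>\<^bsub>free_alg n\<^esub> free_gen i
        | i j. i \<in> {1..<n} \<and> j \<in> {1..<n} \<and> \<bar>int i - int j\<bar> = 1}"

definition TL_ideal :: "nat \<Rightarrow> (nat list \<Rightarrow> complex) set" where
  "TL_ideal n = genideal (free_alg n) (TL_relators n)"

definition TL :: "nat \<Rightarrow> (complex, (nat list \<Rightarrow> complex) set) module" where
  "TL n = quot_algebra (free_alg n) (TL_ideal n)"

definition TL_gen :: "nat \<Rightarrow> nat \<Rightarrow> (nat list \<Rightarrow> complex) set" where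
  "TL_gen n i = TL_ideal n +>\<^bsub>free_alg n\<^esub> free_gen i"


section \<open>Permutations\<close>

text \<open>The group \<^term>\<open>sym_group n\<close> consists of the functions permuting \<open>{1..n}\<close> (and fixing
  everything else), with product \<open>(v \<cdot> w) i = v (w i)\<close>.\<close>

abbreviation sym_set :: "nat \<Rightarrow> (nat \<Rightarrow> nat) set" where
  "sym_set n \<equiv> carrier (sym_group n)"

definition adj_swap :: "nat \<Rightarrow> nat \<Rightarrow> nat" where
  "adj_swap i = transpose i (i + 1)"

definition word_perm :: "nat list \<Rightarrow> nat \<Rightarrow> nat" where
  "word_perm js = foldr (\<circ>) (map adj_swap js) id"

definition reduced_word :: "nat \<Rightarrow> (nat \<Rightarrow> nat) \<Rightarrow> nat list \<Rightarrow> bool" where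
  "reduced_word n w js \<longleftrightarrow> js \<in> lists {1..<n} \<and> word_perm js = w \<and>
     (\<forall>ks \<in> lists {1..<n}. word_perm ks = w \<longrightarrow> length js \<le> length ks)"

definition avoids_321 :: "nat \<Rightarrow> (nat \<Rightarrow> nat) \<Rightarrow> bool" where
  "avoids_321 n w \<longleftrightarrow>
     \<not> (\<exists>i\<in>{1..n}. \<exists>j\<in>{1..n}. \<exists>k\<in>{1..n}. i < j \<and> j < k \<and> w i > w j \<and> w j > w k)"

definition avoiders_321 :: "nat \<Rightarrow> (nat \<Rightarrow> nat) set" where
  "avoiders_321 n = {w \<in> sym_set n. avoids_321 n w}"


section \<open>Temperley-Lieb immanants\<close>

text \<open>The three choices below are well determined: \<open>TL_theta\<close> is unique on
  \<open>carrier (monoid_algebra (sym_group n))\<close> because the \<open>s\<^sub>i\<close> generate the symmetric group,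
  \<open>TL_beta\<close> does not depend on the reduced word, and the elements \<open>TL_beta n v\<close> with
  \<open>v \<in> avoiders_321 n\<close> form a basis of \<open>TL n\<close>, so that the expansion is unique.\<close>

definition TL_theta :: "nat \<Rightarrow> ((nat \<Rightarrow> nat) \<Rightarrow> complex) \<Rightarrow> (nat list \<Rightarrow> complex) set" where
  "TL_theta n = (SOME h. h \<in> algebra_hom (monoid_algebra (sym_group n)) (TL n) \<and>
     (\<forall>i\<in>{1..<n}. h (of_elem (adj_swap i)) = TL_gen n i \<ominus>\<^bsub>TL n\<^esub> \<one>\<^bsub>TL n\<^esub>))"

definition TL_beta :: "nat \<Rightarrow> (nat \<Rightarrow> nat) \<Rightarrow> (nat list \<Rightarrow> complex) set" where
  "TL_beta n w =
     foldr (\<lambda>x y. x \<otimes>\<^bsub>TL n\<^esub> y) (map (TL_gen n) (SOME js. reduced_word n w js)) \<one>\<^bsub>TL n\<^esub>"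

definition TL_coords :: "nat \<Rightarrow> (nat list \<Rightarrow> complex) set \<Rightarrow> (nat \<Rightarrow> nat) \<Rightarrow> complex" where
  "TL_coords n x =
     (SOME f. x = (\<Oplus>\<^bsub>TL n\<^esub>v \<in> avoiders_321 n. f v \<odot>\<^bsub>TL n\<^esub> TL_beta n v))"

definition TL_coeff :: "nat \<Rightarrow> (nat \<Rightarrow> nat) \<Rightarrow> (nat \<Rightarrow> nat) \<Rightarrow> complex" where
  "TL_coeff n w u = TL_coords n (TL_theta n (of_elem u)) w"

text \<open>Polynomials in the commuting variables \<open>x\<^bsub>i,j\<^esub>\<close>: a monomial is a finitely supported
  exponent vector indexed by pairs \<open>(i, j)\<close>.\<close>

type_synonym mat_monom = "nat \<times> nat \<Rightarrow>\<^sub>0 nat"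
type_synonym mat_poly = "mat_monom \<Rightarrow>\<^sub>0 complex"

definition perm_monom :: "nat \<Rightarrow> (nat \<Rightarrow> nat) \<Rightarrow> mat_monom" where
  "perm_monom n u = (\<Sum>i\<in>{1..n}. Poly_Mapping.single (i, u i) 1)"

definition TL_imm :: "nat \<Rightarrow> (nat \<Rightarrow> nat) \<Rightarrow> mat_poly" where
  "TL_imm n w = (\<Sum>u \<in> sym_set n. Poly_Mapping.single (perm_monom n u) (TL_coeff n w u))"

end

theory Submission
  imports Defs
begin

text \<open>
  The algebra \<open>TL\<^sub>n(2)\<close> acts on the \<open>n\<close>-th tensor power of \<open>\<complex>\<^sup>2\<close>, with \<open>t\<^sub>i\<close> acting as the identity
  minus the swap of the factors \<open>i\<close> and \<open>i + 1\<close>, so that \<open>\<theta>(u)\<close> acts as \<open>sgn(u)\<close> times a permutation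
  of the factors. Pairing with suitable pure tensors and extracting a constant term yields a linear
  functional whose value at \<open>\<theta>(u)\<close> is \<open>sgn(u)\<close> times the claimed number, by Vandermonde's identity.
  It remains to see that this functional is \<open>sgn(w)\<close> at \<open>\<beta>(w)\<close> and \<open>0\<close> at every other \<open>\<beta>(v)\<close>.

  Expanding \<open>\<beta>(w)\<close> over the subwords of a reduced word, only \<open>\<theta>(w)\<close> contributes, because the
  functional vanishes at \<open>\<theta>(u)\<close> if \<open>u\<close> has fewer than \<open>ab + cd\<close> inversions. For \<open>v \<noteq> w\<close> it vanishes
  at \<open>\<beta>(v)\<close> by antisymmetry if \<open>v\<close> or its inverse has a descent inside a block, and by cancellation if
  \<open>v\<close> fixes \<open>1\<close> or \<open>n\<close>. In the remaining cases \<open>v\<close> (or, after transposition, its inverse) sends some of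
  the positions \<open>1, \<dots>, a\<close> to the last \<open>c\<close> values; a reduced word moving these positions first then
  pushes too few colours into the first \<open>b\<close> values for any term of the pairing to survive.

  Since \<open>\<theta>\<close> and the coordinates are given by choice, \<open>\<theta>\<close> is constructed from the Coxeter presentation,
  and the \<open>\<beta>(v)\<close> are shown to span by induction on the number of inversions.
\<close>

section \<open>Words in the adjacent transpositions\<close>

text \<open>The functional comes from reading the binomial coefficient as a constant term. Up to
  sign, a pairing with pure tensors sends \<theta>(u) to a product over the positions i of factors
  that depend only on the blocks of i and u(i). The weights are chosen so that the factor is 1 - z *
  (1/z) = 0 when i \<le> a and u(i) \<le> b, and 1 - 1 = 0 when i is among the last d positions and
  u(i) among the last c values; this is the vanishing in (i). From the first a positions to the last
  c values the factor is 1 - z, from the last d positions to the first b values it is 1 - 1/z, and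
  in all other cases it is 1. The constant term of (1 - z)^A (1 - 1/z)^B is the sum over k of (A
  choose k)(B choose k), that is, (A + B) choose A. No fixed value of z yields this for all A and B
  (take A = 1, B = 0), so the functional has to be a sum over colourings with a balance condition:
  as many coloured sources in the first block as coloured targets in the first block. The hard case,
  a v that sends early positions to late values, is settled by showing that no colouring with a
  nonzero entry is balanced.\<close>

lemma adj_swap_adj_swap [simp]: "adj_swap i (adj_swap i x) = x"
  by (simp add: adj_swap_def)

lemma adj_swap_comp_self [simp]: "adj_swap i \<circ> adj_swap i = id"
  by (simp add: fun_eq_iff)

lemma adj_swap_simps [simp]:
  "adj_swap i i = Suc i" "adj_swap i (Suc i) = i"
  "x \<noteq> i \<Longrightarrow> x \<noteq> Suc i \<Longrightarrow> adj_swap i x = x"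
  by (simp_all add: adj_swap_def transpose_def)

lemma adj_swap_eq: "adj_swap i x = (if x = i then Suc i else if x = Suc i then i else x)"
  by simp

lemma bij_adj_swap [simp]: "bij (adj_swap i)"
  by (simp add: adj_swap_def)

lemma inj_adj_swap [simp]: "inj_on (adj_swap i) A"
  by (metis adj_swap_adj_swap inj_onI)

lemma adj_swap_permutes: "i \<in> {1..<n} \<Longrightarrow> adj_swap i permutes {1..n}"
  unfolding adj_swap_def by (rule permutes_swap_id) simp_all

lemma sign_adj_swap [simp]: "sign (adj_swap i) = - 1"
  by (simp add: adj_swap_def sign_swap_id)

lemma word_perm_simps [simp]:
  "word_perm [] = id" "word_perm (i # js) = adj_swap i \<circ> word_perm js"
  by (simp_all add: word_perm_def)

lemma word_perm_append [simp]: "word_perm (js @ ks) = word_perm js \<circ> word_perm ks"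
  by (induction js) (auto simp: fun_eq_iff)

lemma bij_word_perm [simp]: "bij (word_perm js)"
proof (induction js)
  case (Cons i js)
  then show ?case by (simp only: word_perm_simps bij_comp bij_adj_swap)
qed (simp only: word_perm_simps bij_id)

lemma word_perm_permutes: "js \<in> lists {1..<n} \<Longrightarrow> word_perm js permutes {1..n}"
proof (induction js)
  case (Cons i js)
  then show ?case
    unfolding word_perm_simps by (intro permutes_compose adj_swap_permutes) simp_all
qed (simp only: word_perm_simps permutes_id)

lemma inv_word_perm: "inv' (word_perm js) = word_perm (rev js)"
proof -
  have "word_perm (rev js) \<circ> word_perm js = id"
  proof (induction js)
    case (Cons i js)
    have "word_perm (rev (i # js)) \<circ> word_perm (i # js) =
        word_perm (rev js) \<circ> (adj_swap i \<circ> adj_swap i) \<circ> word_perm js"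
      by (simp add: o_assoc del: adj_swap_comp_self)
    then show ?case using Cons by simp
  qed simp
  then show ?thesis
    by (metis bij_betw_def bij_word_perm inv_unique_comp surj_iff inj_iff comp_assoc comp_id id_comp)
qed

lemma sign_word_perm: "js \<in> lists {1..<n} \<Longrightarrow> sign (word_perm js) = (- 1) ^ length js"
proof (induction js)
  case (Cons i js)
  then have "permutation (word_perm js)" "permutation (adj_swap i)"
    using word_perm_permutes[of js n] adj_swap_permutes[of i n]
    by (auto simp: permutation_permutes)
  then have "sign (word_perm (i # js)) = sign (adj_swap i) * sign (word_perm js)"
    unfolding word_perm_simps by (intro sign_compose)
  then show ?case using Cons by (simp del: word_perm_simps)
qed (simp add: id_def)


section \<open>Inversions\<close>

definition inversions :: "nat \<Rightarrow> (nat \<Rightarrow> nat) \<Rightarrow> (nat \<times> nat) set" where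
  "inversions n u = {(i, j). i \<in> {1..n} \<and> j \<in> {1..n} \<and> i < j \<and> u j < u i}"

definition ninv :: "nat \<Rightarrow> (nat \<Rightarrow> nat) \<Rightarrow> nat" where
  "ninv n u = card (inversions n u)"

lemma finite_inversions [simp]: "finite (inversions n u)"
  by (rule finite_subset[of _ "{1..n} \<times> {1..n}"]) (auto simp: inversions_def)

lemma permutes_inj_iff: "u permutes S \<Longrightarrow> u x = u y \<longleftrightarrow> x = y"
  by (metis permutes_inj injD)

text \<open>Swapping two neighbouring positions keeps the order of every pair of positions except
  \<open>(i, Suc i)\<close>. The old inversions therefore inject into the new ones, and only that
  pair is added.\<close>

lemma ninv_ascent:
  assumes u: "u permutes {1..n}" and i: "i \<in> {1..<n}" and lt: "u i < u (Suc i)"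
  shows "ninv n (u \<circ> adj_swap i) = Suc (ninv n u)"
proof -
  let ?f = "\<lambda>(x, y). (adj_swap i x, adj_swap i y)"
  have eq: "inversions n (u \<circ> adj_swap i) = insert (i, Suc i) (?f ` inversions n u)" (is "?A = ?B")
  proof (intro Set.set_eqI iffI)
    fix p assume "p \<in> ?A"
    then obtain x y where p: "p = (x, y)" and xy: "x \<in> {1..n}" "y \<in> {1..n}" "x < y"
        "u (adj_swap i y) < u (adj_swap i x)"
      by (auto simp: inversions_def)
    show "p \<in> ?B"
    proof (cases "p = (i, Suc i)")
      case False
      then have "adj_swap i x < adj_swap i y"
        using xy p by (auto simp: adj_swap_eq)
      moreover have "adj_swap i x \<in> {1..n}" "adj_swap i y \<in> {1..n}"
        using xy i by (auto simp: adj_swap_eq)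
      ultimately have "(adj_swap i x, adj_swap i y) \<in> inversions n u"
        using xy by (simp add: inversions_def)
      then have "?f (adj_swap i x, adj_swap i y) \<in> ?f ` inversions n u" by blast
      then show ?thesis by (simp add: p)
    qed simp
  next
    fix p assume "p \<in> ?B"
    then consider "p = (i, Suc i)" | x y where "p = ?f (x, y)" "(x, y) \<in> inversions n u"
      by auto
    then show "p \<in> ?A"
    proof cases
      case 1
      then show ?thesis using i lt by (auto simp: inversions_def)
    next
      case 2
      then have xy: "x \<in> {1..n}" "y \<in> {1..n}" "x < y" "u y < u x"
        by (auto simp: inversions_def)
      then have "(x, y) \<noteq> (i, Suc i)" using lt by auto
      then have "adj_swap i x < adj_swap i y"
        using xy by (auto simp: adj_swap_eq)
      moreover have "adj_swap i x \<in> {1..n}" "adj_swap i y \<in> {1..n}"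
        using xy i by (auto simp: adj_swap_eq)
      ultimately show ?thesis using xy 2 by (simp add: inversions_def)
    qed
  qed
  have "(i, Suc i) \<notin> ?f ` inversions n u"
  proof
    assume "(i, Suc i) \<in> ?f ` inversions n u"
    then obtain x y where "(x, y) \<in> inversions n u" "adj_swap i x = i" "adj_swap i y = Suc i"
      by auto
    moreover then have "x = Suc i" "y = i"
      by (metis adj_swap_adj_swap adj_swap_simps)+
    ultimately show False by (auto simp: inversions_def)
  qed
  moreover have "inj_on ?f (inversions n u)"
    by (rule inj_onI) (clarsimp, metis adj_swap_adj_swap)
  ultimately show ?thesis
    by (simp add: ninv_def eq card_image)
qed

lemma comp_adj_swap_twice [simp]: "(u \<circ> adj_swap i) \<circ> adj_swap i = u"
  by (simp add: fun_eq_iff)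

lemma permutes_adj_swap: "u permutes {1..n} \<Longrightarrow> i \<in> {1..<n} \<Longrightarrow> u \<circ> adj_swap i permutes {1..n}"
  by (rule permutes_compose[OF adj_swap_permutes])

lemma ninv_descent:
  assumes u: "u permutes {1..n}" and i: "i \<in> {1..<n}" and gt: "u i > u (Suc i)"
  shows "ninv n u = Suc (ninv n (u \<circ> adj_swap i))"
  using ninv_ascent[OF permutes_adj_swap[OF u i] i] gt by simp

lemma ascent_or_descent: "u permutes {1..n} \<Longrightarrow> u i < u (Suc i) \<or> u i > u (Suc i)"
  using permutes_inj_iff[of u _ i "Suc i"] by fastforce

lemma ninv_step_le:
  assumes "u permutes {1..n}" "i \<in> {1..<n}"
  shows "ninv n (u \<circ> adj_swap i) \<le> Suc (ninv n u)"
  using ascent_or_descent[OF assms(1), of i] ninv_ascent[OF assms] ninv_descent[OF assms]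
  by auto

lemma ninv_id [simp]: "ninv n id = 0"
proof -
  have "inversions n id = {}" by (auto simp: inversions_def)
  then show ?thesis by (simp add: ninv_def)
qed

lemma ninv_word_perm_le: "js \<in> lists {1..<n} \<Longrightarrow> ninv n (word_perm js) \<le> length js"
proof (induction js rule: rev_induct)
  case (snoc i js)
  then have "ninv n (word_perm js \<circ> adj_swap i) \<le> Suc (ninv n (word_perm js))"
    by (intro ninv_step_le word_perm_permutes) auto
  moreover have "word_perm (js @ [i]) = word_perm js \<circ> adj_swap i" by simp
  ultimately have "ninv n (word_perm (js @ [i])) \<le> Suc (ninv n (word_perm js))"
    by (simp only:)
  then show ?case using snoc by (simp del: word_perm_append)
qed (simp only: word_perm_simps ninv_id le0)

lemma increasing_permutes_id:
  assumes u: "u permutes {1..n}" and inc: "\<And>i. i \<in> {1..<n} \<Longrightarrow> u i < u (Suc i)"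
  shows "u = id"
proof -
  have ge: "i \<le> u i" if "i \<in> {1..n}" for i
    using that
  proof (induction i)
    case (Suc i)
    show ?case
    proof (cases "i = 0")
      case True
      then show ?thesis using permutes_in_image[OF u, of 1] Suc by auto
    next
      case False
      then show ?thesis using inc[of i] Suc by auto
    qed
  qed simp
  have le: "u i \<le> i" if "i \<in> {1..n}" for i
  proof -
    \<comment> \<open>The values climb by at least one per step and end at most at \<open>n\<close>,
      which bounds the starting value from above.\<close>
    have "k \<le> n - i \<longrightarrow> u i + k \<le> u (i + k)" for k
    proof (induction k)
      case (Suc k)
      then show ?case using inc[of "i + k"] that by (auto simp: less_diff_conv Suc_le_eq)
    qed simp
    from this[of "n - i"] have "u i + (n - i) \<le> u n" using that by simp
    moreover have "u n \<le> n" using permutes_in_image[OF u, of n] that by auto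
    ultimately show ?thesis using that by auto
  qed
  show ?thesis
  proof
    fix i show "u i = id i"
      using ge le permutes_not_in[OF u] by (cases "i \<in> {1..n}") (auto intro: antisym)
  qed
qed

lemma non_id_has_descent:
  assumes "u permutes {1..n}" "u \<noteq> id"
  obtains i where "i \<in> {1..<n}" "u i > u (Suc i)"
  using increasing_permutes_id[OF assms(1)] ascent_or_descent[OF assms(1)] assms(2) by blast

text \<open>The letters of the word can be confined to a set \<open>D\<close> that contains every descent met
  during sorting; \<open>P\<close> is the invariant guaranteeing this.\<close>

lemma reduced_word_exists_invariant:
  assumes "u permutes {1..n}" "P u"
    and step: "\<And>v i. \<lbrakk>v permutes {1..n}; P v; i \<in> {1..<n}; v i > v (Suc i)\<rbrakk>
                 \<Longrightarrow> i \<in> D \<and> P (v \<circ> adj_swap i)"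
  shows "\<exists>js \<in> lists ({1..<n} \<inter> D). word_perm js = u \<and> length js = ninv n u"
  using assms(1,2)
proof (induction "ninv n u" arbitrary: u)
  case 0
  have "u = id"
    by (metis non_id_has_descent ninv_descent 0 Zero_not_Suc)
  then show ?case by (intro bexI[of _ "[]"]) (auto simp only: word_perm_simps list.size ninv_id lists.Nil)
next
  case (Suc k)
  then have "u \<noteq> id" by auto
  then obtain i where i: "i \<in> {1..<n}" "u i > u (Suc i)"
    using non_id_has_descent Suc.prems by metis
  have k: "k = ninv n (u \<circ> adj_swap i)"
    using ninv_descent[OF Suc.prems(1) i] Suc.hyps by simp
  have D: "i \<in> D" "P (u \<circ> adj_swap i)" using step[OF Suc.prems i] by auto
  obtain js where "js \<in> lists ({1..<n} \<inter> D)" "word_perm js = u \<circ> adj_swap i" "length js = k"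
    using Suc.hyps(1)[OF k permutes_adj_swap[OF Suc.prems(1) i(1)] D(2)] k by auto
  then show ?case using i D Suc.hyps(2) by (intro bexI[of _ "js @ [i]"]) auto
qed

lemma reduced_word_exists:
  assumes "u permutes {1..n}"
  shows "\<exists>js \<in> lists {1..<n}. word_perm js = u \<and> length js = ninv n u"
  using reduced_word_exists_invariant[OF assms, of "\<lambda>_. True" UNIV] by simp

text \<open>Sorting attains the lower bound of \<open>ninv_word_perm_le\<close>, so minimality of a
  word becomes an equation for its length.\<close>

lemma reduced_word_iff:
  assumes "u permutes {1..n}"
  shows "reduced_word n u js \<longleftrightarrow> js \<in> lists {1..<n} \<and> word_perm js = u \<and> length js = ninv n u"
  using reduced_word_exists[OF assms] ninv_word_perm_le[of _ n]
  unfolding reduced_word_def by (metis le_antisym)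

text \<open>A reversed shortest word bounds one side by the other; applying this to \<open>u\<close>
  and to its inverse gives equality.\<close>

lemma ninv_inv:
  assumes u: "u permutes {1..n}"
  shows "ninv n (inv' u) = ninv n u"
proof -
  have "ninv n (inv' u) \<le> ninv n u" if u: "u permutes {1..n}" for u
  proof -
    obtain js where "js \<in> lists {1..<n}" "word_perm js = u" "length js = ninv n u"
      using reduced_word_exists[OF u] by blast
    then show ?thesis
      using ninv_word_perm_le[of "rev js" n] by (auto simp: inv_word_perm in_lists_conv_set)
  qed
  from this[OF u] this[OF permutes_inv[OF u]] show ?thesis
    using permutes_inv_inv[OF u] by simp
qed

text \<open>A decreasing triple of the new permutation cannot use \<open>i\<close> and
  \<open>Suc i\<close> as neighbouring entries of the pattern, since they have become an ascent. Its
  positions thus keep their order under \<open>adj_swap i\<close> and give a triple of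
  \<open>u\<close>.\<close>

lemma avoids_321_remove_descent:
  assumes "avoids_321 n u" "i \<in> {1..<n}" "u i > u (Suc i)"
  shows "avoids_321 n (u \<circ> adj_swap i)"
  unfolding avoids_321_def
proof (rule notI, elim bexE conjE, unfold comp_apply)
  fix x y z
  assume a: "x \<in> {1..n}" "y \<in> {1..n}" "z \<in> {1..n}" "x < y" "y < z"
    "u (adj_swap i y) < u (adj_swap i x)" "u (adj_swap i z) < u (adj_swap i y)"
  have "adj_swap i x < adj_swap i y" "adj_swap i y < adj_swap i z"
    using a assms by (auto simp: adj_swap_eq split: if_splits)
  moreover have "adj_swap i x \<in> {1..n}" "adj_swap i y \<in> {1..n}" "adj_swap i z \<in> {1..n}"
    using a assms by (auto simp: adj_swap_eq)
  ultimately show False using assms(1) a unfolding avoids_321_def by blast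
qed

lemma avoids_321_inv:
  assumes u: "u permutes {1..n}" and av: "avoids_321 n u"
  shows "avoids_321 n (inv' u)"
  unfolding avoids_321_def
proof (rule notI, elim bexE conjE)
  fix i j k
  assume a: "i \<in> {1..n}" "j \<in> {1..n}" "k \<in> {1..n}" "i < j" "j < k"
    "inv' u j < inv' u i" "inv' u k < inv' u j"
  have "u (inv' u x) = x" for x using permutes_inverses(1)[OF u] .
  moreover have "inv' u x \<in> {1..n}" if "x \<in> {1..n}" for x
    using permutes_in_image[OF permutes_inv[OF u], of x] that by simp
  ultimately show False using av a unfolding avoids_321_def by metis
qed

section \<open>Monoid algebras\<close>

abbreviation supp :: "('m \<Rightarrow> complex) \<Rightarrow> 'm set" where
  "supp f \<equiv> {x. f x \<noteq> 0}"

definition lin_ext :: "('m \<Rightarrow> complex) \<Rightarrow> ('m \<Rightarrow> complex) \<Rightarrow> complex" where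
  "lin_ext h f = (\<Sum>x\<in>supp f. f x * h x)"

lemma lin_ext_superset:
  assumes "finite A" "supp f \<subseteq> A"
  shows "lin_ext h f = (\<Sum>x\<in>A. f x * h x)"
  unfolding lin_ext_def by (rule sum.mono_neutral_left) (use assms in auto)

lemma lin_ext_cong:
  assumes "\<And>x. f x \<noteq> 0 \<Longrightarrow> h x = k x"
  shows "lin_ext h f = lin_ext k f"
  unfolding lin_ext_def by (rule sum.cong) (use assms in auto)

lemma lin_ext_of_elem [simp]: "lin_ext h (of_elem x) = h x"
  using lin_ext_superset[of "{x}" "of_elem x" h] by (auto simp: of_elem_def split: if_splits)

lemma lin_ext_zero [simp]: "lin_ext h (\<lambda>x. 0) = 0"
  by (simp add: lin_ext_def)

lemma supp_add_subset:
  assumes "supp f \<subseteq> A" "supp g \<subseteq> A"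
  shows "supp (\<lambda>x. f x + g x) \<subseteq> A"
proof
  fix x assume "x \<in> supp (\<lambda>x. f x + g x)"
  then have "f x \<noteq> 0 \<or> g x \<noteq> 0" by auto
  then show "x \<in> A" using assms by auto
qed

lemma finite_supp_add: "finite (supp f) \<Longrightarrow> finite (supp g) \<Longrightarrow> finite (supp (\<lambda>x. f x + g x))"
  by (rule finite_subset[of _ "supp f \<union> supp g"]) auto

lemma lin_ext_add:
  assumes "finite (supp f)" "finite (supp g)"
  shows "lin_ext h (\<lambda>x. f x + g x) = lin_ext h f + lin_ext h g"
proof -
  have "supp (\<lambda>x. f x + g x) \<subseteq> supp f \<union> supp g" by auto
  then show ?thesis
    using assms by (simp add: lin_ext_superset[of "supp f \<union> supp g"] sum.distrib distrib_right)
qed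

lemma lin_ext_scale:
  assumes "finite (supp f)"
  shows "lin_ext h (\<lambda>x. c * f x) = c * lin_ext h f"
proof -
  have "supp (\<lambda>x. c * f x) \<subseteq> supp f" by auto
  then show ?thesis
    using assms by (simp add: lin_ext_superset[of "supp f"] sum_distrib_left mult.assoc)
qed

lemma lin_ext_fun_add: "lin_ext (\<lambda>x. h x + k x) f = lin_ext h f + lin_ext k f"
  by (simp add: lin_ext_def sum.distrib distrib_left)

lemma lin_ext_fun_diff: "lin_ext (\<lambda>x. h x - k x) f = lin_ext h f - lin_ext k f"
  by (simp add: lin_ext_def sum_subtractf right_diff_distrib)

lemma lin_ext_fun_scale: "lin_ext (\<lambda>x. c * h x) f = c * lin_ext h f"
  by (simp add: lin_ext_def sum_distrib_left mult_ac)

lemma lin_ext_delta: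
  assumes "finite (supp f)"
  shows "lin_ext (\<lambda>x. if x = z then 1 else 0) f = f z"
proof -
  have "lin_ext (\<lambda>x. if x = z then 1 else 0) f
      = (\<Sum>x\<in>insert z (supp f). f x * (if x = z then 1 else 0))"
    using assms by (intro lin_ext_superset) auto
  also have "\<dots> = (\<Sum>x\<in>insert z (supp f). if x = z then f x else 0)"
    by (rule sum.cong) auto
  finally show ?thesis using assms by (simp del: sum.insert)
qed

lemma finite_supp_of_elem [simp]: "finite (supp (of_elem x))"
  by (rule finite_subset[of _ "{x}"]) (auto simp: of_elem_def)

lemma monoid_algebra_simps:
  "carrier (monoid_algebra M) = {f. finite (supp f) \<and> supp f \<subseteq> carrier M}"
  "\<zero>\<^bsub>monoid_algebra M\<^esub> = (\<lambda>x. 0)"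
  "f \<oplus>\<^bsub>monoid_algebra M\<^esub> g = (\<lambda>x. f x + g x)"
  "c \<odot>\<^bsub>monoid_algebra M\<^esub> f = (\<lambda>x. c * f x)"
  "\<one>\<^bsub>monoid_algebra M\<^esub> = of_elem \<one>\<^bsub>M\<^esub>"
  by (simp_all add: monoid_algebra_def of_elem_def)

lemma supp_mult_subset:
  "supp (f \<otimes>\<^bsub>monoid_algebra M\<^esub> g) \<subseteq> (\<lambda>(x, y). x \<otimes>\<^bsub>M\<^esub> y) ` (supp f \<times> supp g)"
proof
  fix z assume "z \<in> supp (f \<otimes>\<^bsub>monoid_algebra M\<^esub> g)"
  then have "{(x, y). f x \<noteq> 0 \<and> g y \<noteq> 0 \<and> x \<otimes>\<^bsub>M\<^esub> y = z} \<noteq> {}"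
    by (auto simp: monoid_algebra_def simp del: Collect_empty_eq)
  then show "z \<in> (\<lambda>(x, y). x \<otimes>\<^bsub>M\<^esub> y) ` (supp f \<times> supp g)" by force
qed

text \<open>Convolution groups the pairs \<open>(x, y)\<close> by their product, and
  \<open>sum.group\<close> undoes the grouping. Associativity, the unit laws and distributivity are
  all read off from this identity.\<close>

lemma lin_ext_mult:
  assumes f: "finite (supp f)" and g: "finite (supp g)"
  shows "lin_ext h (f \<otimes>\<^bsub>monoid_algebra M\<^esub> g) = lin_ext (\<lambda>x. lin_ext (\<lambda>y. h (x \<otimes>\<^bsub>M\<^esub> y)) g) f"
proof -
  let ?m = "\<lambda>(x, y). x \<otimes>\<^bsub>M\<^esub> y"
  let ?P = "supp f \<times> supp g"
  have fin: "finite ?P" using f g by simp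
  have mult: "(f \<otimes>\<^bsub>monoid_algebra M\<^esub> g) z = (\<Sum>p\<in>{p\<in>?P. ?m p = z}. f (fst p) * g (snd p))" for z
    by (auto simp: monoid_algebra_def case_prod_beta intro!: sum.cong)
  have "lin_ext h (f \<otimes>\<^bsub>monoid_algebra M\<^esub> g)
      = (\<Sum>z\<in>?m ` ?P. (f \<otimes>\<^bsub>monoid_algebra M\<^esub> g) z * h z)"
    by (rule lin_ext_superset[OF _ supp_mult_subset]) (use fin in blast)
  also have "\<dots> = (\<Sum>z\<in>?m ` ?P. \<Sum>p\<in>{p\<in>?P. ?m p = z}. f (fst p) * g (snd p) * h (?m p))"
    unfolding mult sum_distrib_right by (intro sum.cong refl) auto
  also have "\<dots> = (\<Sum>p\<in>?P. f (fst p) * g (snd p) * h (?m p))"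
    by (rule sum.group) (use fin in auto)
  also have "\<dots> = (\<Sum>x\<in>supp f. \<Sum>y\<in>supp g. f x * g y * h (x \<otimes>\<^bsub>M\<^esub> y))"
    by (simp add: sum.cartesian_product case_prod_beta)
  also have "\<dots> = lin_ext (\<lambda>x. lin_ext (\<lambda>y. h (x \<otimes>\<^bsub>M\<^esub> y)) g) f"
    by (simp add: lin_ext_def sum_distrib_left mult.assoc)
  finally show ?thesis .
qed

lemma finite_supp_mult:
  "finite (supp f) \<Longrightarrow> finite (supp g) \<Longrightarrow> finite (supp (f \<otimes>\<^bsub>monoid_algebra M\<^esub> g))"
  by (rule finite_subset[OF supp_mult_subset]) auto

text \<open>A finitely supported function is determined by the linear functionals evaluating it, which
  turns the ring axioms into identities between iterated linear extensions.\<close>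

lemma fun_eq_via_lin_ext:
  assumes "finite (supp f)" "finite (supp g)" "\<And>h. lin_ext h f = lin_ext h g"
  shows "f = g"
  using assms lin_ext_delta by (metis (no_types, lifting) ext)

lemma (in monoid) ring_monoid_algebra: "ring (monoid_algebra G)" (is "ring ?A")
proof (rule ringI)
  show "abelian_group ?A"
  proof (rule abelian_groupI)
    fix f assume "f \<in> carrier ?A"
    then show "\<exists>g\<in>carrier ?A. g \<oplus>\<^bsub>?A\<^esub> f = \<zero>\<^bsub>?A\<^esub>"
      by (intro bexI[of _ "\<lambda>x. - f x"]) (auto simp: monoid_algebra_simps)
  qed (simp_all add: monoid_algebra_simps finite_supp_add supp_add_subset add_ac)
next
  show "monoid ?A"
  proof (rule monoidI)
    fix f g k
    assume fgk: "f \<in> carrier ?A" "g \<in> carrier ?A"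
      "k \<in> carrier ?A"
    then have fin: "finite (supp f)" "finite (supp g)" "finite (supp k)"
      and sub: "supp f \<subseteq> carrier G" "supp g \<subseteq> carrier G" "supp k \<subseteq> carrier G"
      by (auto simp: monoid_algebra_simps)
    show "f \<otimes>\<^bsub>?A\<^esub> g \<in> carrier ?A"
    proof -
      have "(\<lambda>(x, y). x \<otimes> y) ` (supp f \<times> supp g) \<subseteq> carrier G"
        using sub by auto
      then show ?thesis
        using fin supp_mult_subset[of G f g] by (simp add: monoid_algebra_simps finite_supp_mult)
    qed
    show "f \<otimes>\<^bsub>?A\<^esub> g \<otimes>\<^bsub>?A\<^esub> k
        = f \<otimes>\<^bsub>?A\<^esub> (g \<otimes>\<^bsub>?A\<^esub> k)"
    proof (rule fun_eq_via_lin_ext)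
      fix h
      show "lin_ext h (f \<otimes>\<^bsub>?A\<^esub> g \<otimes>\<^bsub>?A\<^esub> k)
          = lin_ext h (f \<otimes>\<^bsub>?A\<^esub> (g \<otimes>\<^bsub>?A\<^esub> k))"
        unfolding lin_ext_mult[OF finite_supp_mult[OF fin(1,2)] fin(3)]
          lin_ext_mult[OF fin(1) finite_supp_mult[OF fin(2,3)]]
          lin_ext_mult[OF fin(1,2)] lin_ext_mult[OF fin(2,3)]
        by (intro lin_ext_cong)
          (simp add: m_assoc subsetD[OF sub(1)] subsetD[OF sub(2)] subsetD[OF sub(3)])
    qed (use fin in \<open>simp_all add: finite_supp_mult\<close>)
  next
    show "\<one>\<^bsub>?A\<^esub> \<in> carrier ?A"
      by (simp add: monoid_algebra_simps) (auto simp: of_elem_def)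
  next
    fix f assume "f \<in> carrier ?A"
    then have fin: "finite (supp f)" and sub: "supp f \<subseteq> carrier G"
      by (auto simp: monoid_algebra_simps)
    show "\<one>\<^bsub>?A\<^esub> \<otimes>\<^bsub>?A\<^esub> f = f"
      unfolding monoid_algebra_simps
      by (rule fun_eq_via_lin_ext)
        (use fin sub in \<open>auto simp: finite_supp_mult lin_ext_mult intro!: lin_ext_cong\<close>)
    show "f \<otimes>\<^bsub>?A\<^esub> \<one>\<^bsub>?A\<^esub> = f"
      unfolding monoid_algebra_simps
      by (rule fun_eq_via_lin_ext)
        (use fin sub in \<open>auto simp: finite_supp_mult lin_ext_mult intro!: lin_ext_cong\<close>)
  qed
next
  fix f g k
  assume "f \<in> carrier ?A" "g \<in> carrier ?A"
    "k \<in> carrier ?A"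
  then have fin: "finite (supp f)" "finite (supp g)" "finite (supp k)"
    by (auto simp: monoid_algebra_simps)
  show "(f \<oplus>\<^bsub>?A\<^esub> g) \<otimes>\<^bsub>?A\<^esub> k
      = f \<otimes>\<^bsub>?A\<^esub> k \<oplus>\<^bsub>?A\<^esub> g \<otimes>\<^bsub>?A\<^esub> k"
    unfolding monoid_algebra_simps
    by (rule fun_eq_via_lin_ext)
      (use fin in \<open>auto simp: finite_supp_mult finite_supp_add lin_ext_mult lin_ext_add\<close>)
  show "k \<otimes>\<^bsub>?A\<^esub> (f \<oplus>\<^bsub>?A\<^esub> g)
      = k \<otimes>\<^bsub>?A\<^esub> f \<oplus>\<^bsub>?A\<^esub> k \<otimes>\<^bsub>?A\<^esub> g"
    unfolding monoid_algebra_simps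
    by (rule fun_eq_via_lin_ext)
      (use fin in \<open>auto simp: finite_supp_mult finite_supp_add lin_ext_mult lin_ext_add
         lin_ext_fun_add\<close>)
qed

lemma monoid_algebra_smult_closed:
  "f \<in> carrier (monoid_algebra M) \<Longrightarrow> c \<odot>\<^bsub>monoid_algebra M\<^esub> f \<in> carrier (monoid_algebra M)"
  by (auto simp: monoid_algebra_simps elim: rev_finite_subset)

lemma monoid_algebra_smult_mult:
  assumes "f \<in> carrier (monoid_algebra M)" "g \<in> carrier (monoid_algebra M)"
  shows "(c \<odot>\<^bsub>monoid_algebra M\<^esub> f) \<otimes>\<^bsub>monoid_algebra M\<^esub> g
      = c \<odot>\<^bsub>monoid_algebra M\<^esub> (f \<otimes>\<^bsub>monoid_algebra M\<^esub> g)"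
    and "f \<otimes>\<^bsub>monoid_algebra M\<^esub> (c \<odot>\<^bsub>monoid_algebra M\<^esub> g)
      = c \<odot>\<^bsub>monoid_algebra M\<^esub> (f \<otimes>\<^bsub>monoid_algebra M\<^esub> g)"
proof -
  let ?A = "monoid_algebra M"
  have fin: "finite (supp f)" "finite (supp g)" using assms by (auto simp: monoid_algebra_simps)
  have fin': "finite (supp (\<lambda>x. c * k x))" if "finite (supp k)" for k :: "'a \<Rightarrow> complex"
    using that by (auto elim: rev_finite_subset)
  show "(c \<odot>\<^bsub>?A\<^esub> f) \<otimes>\<^bsub>?A\<^esub> g
      = c \<odot>\<^bsub>?A\<^esub> (f \<otimes>\<^bsub>?A\<^esub> g)"
    unfolding monoid_algebra_simps
    by (rule fun_eq_via_lin_ext)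
      (use fin in \<open>auto simp: finite_supp_mult fin' lin_ext_mult lin_ext_scale\<close>)
  show "f \<otimes>\<^bsub>?A\<^esub> (c \<odot>\<^bsub>?A\<^esub> g)
      = c \<odot>\<^bsub>?A\<^esub> (f \<otimes>\<^bsub>?A\<^esub> g)"
    unfolding monoid_algebra_simps
    by (rule fun_eq_via_lin_ext)
      (use fin in \<open>auto simp: finite_supp_mult fin' lin_ext_mult lin_ext_scale lin_ext_fun_scale\<close>)
qed

lemma of_elem_mult:
  "of_elem x \<otimes>\<^bsub>monoid_algebra M\<^esub> of_elem y = of_elem (x \<otimes>\<^bsub>M\<^esub> y)"
  by (rule fun_eq_via_lin_ext) (simp_all add: finite_supp_mult lin_ext_mult)

lemma of_elem_carrier: "x \<in> carrier M \<Longrightarrow> of_elem x \<in> carrier (monoid_algebra M)"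
  by (simp add: monoid_algebra_simps) (auto simp: of_elem_def)


section \<open>The Temperley-Lieb algebra as a ring\<close>

lemma monoid_word_monoid: "monoid (word_monoid n)"
  by (rule monoidI) (auto simp: word_monoid_def)

lemma ring_free_alg: "ring (free_alg n)"
  unfolding free_alg_def by (rule monoid.ring_monoid_algebra[OF monoid_word_monoid])

lemma free_alg_minus:
  assumes "f \<in> carrier (free_alg n)" "g \<in> carrier (free_alg n)"
  shows "f \<ominus>\<^bsub>free_alg n\<^esub> g = (\<lambda>x. f x - g x)"
proof -
  interpret ring "free_alg n" by (rule ring_free_alg)
  have "\<ominus>\<^bsub>free_alg n\<^esub> g = (\<lambda>x. - g x)"
  proof (rule minus_equality)
    show "(\<lambda>x. - g x) \<oplus>\<^bsub>free_alg n\<^esub> g = \<zero>\<^bsub>free_alg n\<^esub>"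
      by (simp add: free_alg_def monoid_algebra_simps)
  qed (use assms in \<open>auto simp: free_alg_def monoid_algebra_simps\<close>)
  then show ?thesis by (simp add: a_minus_def free_alg_def monoid_algebra_simps)
qed

lemma of_elem_word_carrier: "js \<in> lists {1..<n} \<Longrightarrow> of_elem js \<in> carrier (free_alg n)"
  unfolding free_alg_def by (rule of_elem_carrier) (simp add: word_monoid_def)

lemma of_elem_word_mult: "of_elem js \<otimes>\<^bsub>free_alg n\<^esub> of_elem ks = of_elem (js @ ks)"
  by (simp add: free_alg_def of_elem_mult word_monoid_def)

lemma free_alg_smult_closed:
  "f \<in> carrier (free_alg n) \<Longrightarrow> c \<odot>\<^bsub>free_alg n\<^esub> f \<in> carrier (free_alg n)"
  unfolding free_alg_def by (rule monoid_algebra_smult_closed)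

lemma TL_relators_subset: "TL_relators n \<subseteq> carrier (free_alg n)"
proof -
  interpret ring "free_alg n" by (rule ring_free_alg)
  have "free_gen i \<in> carrier (free_alg n)" if "i \<in> {1..<n}" for i
    using that by (intro of_elem_word_carrier) auto
  then show ?thesis
    unfolding TL_relators_def by (auto intro!: minus_closed free_alg_smult_closed)
qed

lemma ideal_TL_ideal: "ideal (TL_ideal n) (free_alg n)"
  unfolding TL_ideal_def by (rule ring.genideal_ideal[OF ring_free_alg TL_relators_subset])

abbreviation TL_class :: "nat \<Rightarrow> (nat list \<Rightarrow> complex) \<Rightarrow> (nat list \<Rightarrow> complex) set" where
  "TL_class n f \<equiv> TL_ideal n +>\<^bsub>free_alg n\<^esub> f"

lemma TL_simps:
  "carrier (TL n) = carrier (free_alg n Quot TL_ideal n)"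
  "mult (TL n) = mult (free_alg n Quot TL_ideal n)"
  "add (TL n) = add (free_alg n Quot TL_ideal n)"
  "one (TL n) = one (free_alg n Quot TL_ideal n)"
  "zero (TL n) = zero (free_alg n Quot TL_ideal n)"
  by (simp_all add: TL_def quot_algebra_def ring.defs)

lemma ring_TL: "ring (TL n)"
proof -
  interpret Q: ring "free_alg n Quot TL_ideal n"
    by (rule ideal.quotient_is_ring[OF ideal_TL_ideal])
  show ?thesis
  proof (rule ringI)
    show "abelian_group (TL n)"
      by (rule abelian_groupI)
        (auto simp: TL_simps Q.a_ac intro: Q.add.l_inv_ex)
    show "monoid (TL n)"
      by (rule monoidI) (auto simp: TL_simps Q.m_assoc)
  qed (simp_all add: TL_simps Q.l_distr Q.r_distr)
qed

lemma TL_class_hom: "TL_class n \<in> ring_hom (free_alg n) (TL n)"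
  using ideal.rcos_ring_hom[OF ideal_TL_ideal[of n]] by (simp add: ring_hom_def TL_simps)

lemma TL_class_carrier: "f \<in> carrier (free_alg n) \<Longrightarrow> TL_class n f \<in> carrier (TL n)"
  by (rule ring_hom_closed[OF TL_class_hom])

lemma TL_class_surj:
  assumes "X \<in> carrier (TL n)"
  obtains f where "f \<in> carrier (free_alg n)" "X = TL_class n f"
  using assms by (auto simp: TL_simps FactRing_simps)

lemma TL_class_mult:
  "\<lbrakk>f \<in> carrier (free_alg n); g \<in> carrier (free_alg n)\<rbrakk>
    \<Longrightarrow> TL_class n (f \<otimes>\<^bsub>free_alg n\<^esub> g) = TL_class n f \<otimes>\<^bsub>TL n\<^esub> TL_class n g"
  by (rule ring_hom_mult[OF TL_class_hom])

lemma TL_class_add: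
  "\<lbrakk>f \<in> carrier (free_alg n); g \<in> carrier (free_alg n)\<rbrakk>
    \<Longrightarrow> TL_class n (f \<oplus>\<^bsub>free_alg n\<^esub> g) = TL_class n f \<oplus>\<^bsub>TL n\<^esub> TL_class n g"
  by (rule ring_hom_add[OF TL_class_hom])

lemma TL_class_one: "TL_class n \<one>\<^bsub>free_alg n\<^esub> = \<one>\<^bsub>TL n\<^esub>"
  by (rule ring_hom_one[OF TL_class_hom])

lemma TL_class_eq_iff:
  assumes "f \<in> carrier (free_alg n)" "g \<in> carrier (free_alg n)"
  shows "TL_class n f = TL_class n g \<longleftrightarrow> (\<lambda>x. f x - g x) \<in> TL_ideal n"
  using ring.quotient_eq_iff_same_a_r_cos[OF ring_free_alg ideal_TL_ideal assms]
  by (simp add: free_alg_minus[OF assms])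

text \<open>Scalars act on the quotient through the class of \<open>c\<close> times the unit, so
  agreement with pointwise scaling of representatives has to be derived.\<close>

lemma TL_class_smult:
  assumes "f \<in> carrier (free_alg n)"
  shows "TL_class n (c \<odot>\<^bsub>free_alg n\<^esub> f) = c \<odot>\<^bsub>TL n\<^esub> TL_class n f"
proof -
  interpret ring "free_alg n" by (rule ring_free_alg)
  have "c \<odot>\<^bsub>TL n\<^esub> TL_class n f = TL_class n (c \<odot>\<^bsub>free_alg n\<^esub> \<one>\<^bsub>free_alg n\<^esub>) \<otimes>\<^bsub>TL n\<^esub> TL_class n f"
    unfolding TL_simps by (simp add: TL_def quot_algebra_def ring.defs)
  also have "\<dots> = TL_class n ((c \<odot>\<^bsub>free_alg n\<^esub> \<one>\<^bsub>free_alg n\<^esub>) \<otimes>\<^bsub>free_alg n\<^esub> f)"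
    by (rule TL_class_mult[symmetric]) (use assms in \<open>auto intro: free_alg_smult_closed\<close>)
  also have "(c \<odot>\<^bsub>free_alg n\<^esub> \<one>\<^bsub>free_alg n\<^esub>) \<otimes>\<^bsub>free_alg n\<^esub> f = c \<odot>\<^bsub>free_alg n\<^esub> f"
    using monoid_algebra_smult_mult(1)[of "\<one>\<^bsub>free_alg n\<^esub>" "word_monoid n" f c] assms
      l_one[OF assms] one_closed
    unfolding free_alg_def by simp
  finally show ?thesis ..
qed

lemma TL_smult_closed: "X \<in> carrier (TL n) \<Longrightarrow> c \<odot>\<^bsub>TL n\<^esub> X \<in> carrier (TL n)"
  by (metis TL_class_surj TL_class_smult TL_class_carrier free_alg_smult_closed)

lemma TL_smult_mult:
  assumes "X \<in> carrier (TL n)" "Y \<in> carrier (TL n)"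
  shows "(c \<odot>\<^bsub>TL n\<^esub> X) \<otimes>\<^bsub>TL n\<^esub> Y = c \<odot>\<^bsub>TL n\<^esub> (X \<otimes>\<^bsub>TL n\<^esub> Y)"
    and "X \<otimes>\<^bsub>TL n\<^esub> (c \<odot>\<^bsub>TL n\<^esub> Y) = c \<odot>\<^bsub>TL n\<^esub> (X \<otimes>\<^bsub>TL n\<^esub> Y)"
proof -
  interpret ring "free_alg n" by (rule ring_free_alg)
  obtain f g where fg: "f \<in> carrier (free_alg n)" "X = TL_class n f"
      "g \<in> carrier (free_alg n)" "Y = TL_class n g"
    using TL_class_surj assms by metis
  note [simp] = TL_class_smult[symmetric] TL_class_mult[symmetric] free_alg_smult_closed
  show "(c \<odot>\<^bsub>TL n\<^esub> X) \<otimes>\<^bsub>TL n\<^esub> Y = c \<odot>\<^bsub>TL n\<^esub> (X \<otimes>\<^bsub>TL n\<^esub> Y)"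
    using fg monoid_algebra_smult_mult(1)[of f "word_monoid n" g c] by (simp add: free_alg_def[symmetric])
  show "X \<otimes>\<^bsub>TL n\<^esub> (c \<odot>\<^bsub>TL n\<^esub> Y) = c \<odot>\<^bsub>TL n\<^esub> (X \<otimes>\<^bsub>TL n\<^esub> Y)"
    using fg monoid_algebra_smult_mult(2)[of f "word_monoid n" g c] by (simp add: free_alg_def[symmetric])
qed

lemma
  assumes "X \<in> carrier (TL n)"
  shows TL_smult_r_distr: "Y \<in> carrier (TL n) \<Longrightarrow>
        c \<odot>\<^bsub>TL n\<^esub> (X \<oplus>\<^bsub>TL n\<^esub> Y) = c \<odot>\<^bsub>TL n\<^esub> X \<oplus>\<^bsub>TL n\<^esub> c \<odot>\<^bsub>TL n\<^esub> Y"
    and TL_smult_l_distr: "(c + d) \<odot>\<^bsub>TL n\<^esub> X = c \<odot>\<^bsub>TL n\<^esub> X \<oplus>\<^bsub>TL n\<^esub> d \<odot>\<^bsub>TL n\<^esub> X"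
    and TL_smult_assoc: "(c * d) \<odot>\<^bsub>TL n\<^esub> X = c \<odot>\<^bsub>TL n\<^esub> (d \<odot>\<^bsub>TL n\<^esub> X)"
    and TL_smult_one: "1 \<odot>\<^bsub>TL n\<^esub> X = X"
    and TL_smult_zero: "0 \<odot>\<^bsub>TL n\<^esub> X = \<zero>\<^bsub>TL n\<^esub>"
proof -
  interpret ring "free_alg n" by (rule ring_free_alg)
  obtain f where f: "f \<in> carrier (free_alg n)" "X = TL_class n f"
    using TL_class_surj assms by metis
  have zero: "TL_class n \<zero>\<^bsub>free_alg n\<^esub> = \<zero>\<^bsub>TL n\<^esub>"
    using ring_hom_zero[OF TL_class_hom ring_free_alg ring_TL] .
  note [simp] = TL_class_smult[symmetric] TL_class_add[symmetric] free_alg_smult_closed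
    zero[symmetric]
  have add: "f \<oplus>\<^bsub>free_alg n\<^esub> g = (\<lambda>x. f x + g x)" for f g
    by (simp add: free_alg_def monoid_algebra_simps)
  have smult: "c \<odot>\<^bsub>free_alg n\<^esub> f = (\<lambda>x. c * f x)" for c f
    by (simp add: free_alg_def monoid_algebra_simps)
  have zero': "\<zero>\<^bsub>free_alg n\<^esub> = (\<lambda>x. 0)" by (simp add: free_alg_def monoid_algebra_simps)
  show "c \<odot>\<^bsub>TL n\<^esub> (X \<oplus>\<^bsub>TL n\<^esub> Y) = c \<odot>\<^bsub>TL n\<^esub> X \<oplus>\<^bsub>TL n\<^esub> c \<odot>\<^bsub>TL n\<^esub> Y" if "Y \<in> carrier (TL n)"
  proof -
    obtain g where "g \<in> carrier (free_alg n)" "Y = TL_class n g"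
      using TL_class_surj \<open>Y \<in> carrier (TL n)\<close> by metis
    then show ?thesis using f by simp (simp add: add smult distrib_left)
  qed
  show "(c + d) \<odot>\<^bsub>TL n\<^esub> X = c \<odot>\<^bsub>TL n\<^esub> X \<oplus>\<^bsub>TL n\<^esub> d \<odot>\<^bsub>TL n\<^esub> X"
    using f by simp (simp add: add smult distrib_right)
  show "(c * d) \<odot>\<^bsub>TL n\<^esub> X = c \<odot>\<^bsub>TL n\<^esub> (d \<odot>\<^bsub>TL n\<^esub> X)"
    using f by simp (simp add: smult mult.assoc)
  show "1 \<odot>\<^bsub>TL n\<^esub> X = X" using f by simp (simp add: smult)
  show "0 \<odot>\<^bsub>TL n\<^esub> X = \<zero>\<^bsub>TL n\<^esub>" using f by simp (simp add: smult zero')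
qed

lemmas TL_smult_simps = TL_smult_r_distr TL_smult_l_distr TL_smult_assoc TL_smult_one TL_smult_zero

section \<open>The action on two-coloured positions\<close>

text \<open>A basis vector of the \<open>n\<close>-th tensor power of \<open>\<complex>\<^sup>2\<close> is encoded by the set \<open>T\<close> of
  positions carrying the second basis vector of \<open>\<complex>\<^sup>2\<close>, and a tensor by its coefficient
  function; \<open>t\<^sub>i\<close> acts as identity minus the swap of the tensor factors \<open>i\<close> and \<open>i + 1\<close>.\<close>

fun word_act :: "nat list \<Rightarrow> (nat set \<Rightarrow> complex) \<Rightarrow> nat set \<Rightarrow> complex" where
  "word_act [] G = G"
| "word_act (i # js) G = (\<lambda>T. word_act js G T - word_act js G (adj_swap i ` T))"

lemma word_act_append: "word_act (js @ ks) G = word_act js (word_act ks G)"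
  by (induction js) auto

lemma mem_adj_swap_image: "x \<in> adj_swap i ` T \<longleftrightarrow> adj_swap i x \<in> T"
  by (metis adj_swap_adj_swap image_iff)

lemma adj_swap_image_twice [simp]: "adj_swap i ` adj_swap i ` T = T"
  by (auto simp: image_image)

lemma adj_swap_image_fixed: "(i \<in> T \<longleftrightarrow> Suc i \<in> T) \<Longrightarrow> adj_swap i ` T = T"
  by (auto simp: mem_adj_swap_image adj_swap_eq split: if_splits)

lemma adj_swap_image_commute:
  assumes "\<bar>int i - int j\<bar> \<ge> 2"
  shows "adj_swap i ` adj_swap j ` T = adj_swap j ` adj_swap i ` T"
proof -
  have "adj_swap i (adj_swap j x) = adj_swap j (adj_swap i x)" for x
    using assms by (auto simp: adj_swap_eq)
  then show ?thesis by (simp add: image_image)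
qed

lemma word_act_square: "word_act [i, i] G T = 2 * word_act [i] G T"
  by simp

lemma word_act_commute:
  "\<bar>int i - int j\<bar> \<ge> 2 \<Longrightarrow> word_act [i, j] G T = word_act [j, i] G T"
  by (simp add: adj_swap_image_commute)

text \<open>This is where having only two colours matters: among three neighbouring positions two
  agree. If \<open>i\<close> and \<open>Suc i\<close> agree, both sides vanish. If \<open>j\<close>
  and \<open>Suc j\<close> agree, the identity is computed directly. Otherwise
  \<open>adj_swap i\<close> makes them agree, and both sides only change sign under it.\<close>

lemma word_act_braid:
  assumes ij: "\<bar>int i - int j\<bar> = 1"
  shows "word_act [i, j, i] G T = word_act [i] G T"
proof (cases "i \<in> T \<longleftrightarrow> Suc i \<in> T")
  case True
  then show ?thesis by (simp add: adj_swap_image_fixed)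
next
  case False
  have ij': "j = Suc i \<or> i = Suc j" using ij by auto
  have key: "word_act [i, j, i] G U = word_act [i] G U"
    if U: "(i \<in> U) \<noteq> (Suc i \<in> U)" "j \<in> U \<longleftrightarrow> Suc j \<in> U" for U
  proof -
    let ?s = "adj_swap i" and ?t = "adj_swap j"
    have 1: "?t ` U = U" using U(2) by (rule adj_swap_image_fixed)
    have "i \<in> ?t ` ?s ` U \<longleftrightarrow> Suc i \<in> ?t ` ?s ` U"
      using U ij' by (auto simp: mem_adj_swap_image adj_swap_eq split: if_splits)
    then have 2: "?s ` ?t ` ?s ` U = ?t ` ?s ` U" by (rule adj_swap_image_fixed)
    show ?thesis by (simp add: 1 2)
  qed
  show ?thesis
  proof (cases "j \<in> T \<longleftrightarrow> Suc j \<in> T")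
    case True
    then show ?thesis using key False by blast
  next
    case j: False
    have "word_act [i, j, i] G (adj_swap i ` T) = word_act [i] G (adj_swap i ` T)"
    proof (rule key)
      show "(i \<in> adj_swap i ` T) \<noteq> (Suc i \<in> adj_swap i ` T)"
        using False by (simp add: mem_adj_swap_image)
      show "j \<in> adj_swap i ` T \<longleftrightarrow> Suc j \<in> adj_swap i ` T"
        using False j ij' by (auto simp: mem_adj_swap_image adj_swap_eq split: if_splits)
    qed
    moreover have "word_act (i # js) G (adj_swap i ` T) = - word_act (i # js) G T" for js
      by simp
    ultimately show ?thesis by (simp del: word_act.simps)
  qed
qed

lemma word_act_lin_ext:
  "word_act js (\<lambda>T. lin_ext (\<lambda>y. H y T) g) T = lin_ext (\<lambda>y. word_act js (H y) T) g"
  by (induction js arbitrary: T) (simp_all add: lin_ext_fun_diff)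

section \<open>The relations act by zero\<close>

abbreviation free_act :: "(nat list \<Rightarrow> complex) \<Rightarrow> (nat set \<Rightarrow> complex) \<Rightarrow> nat set \<Rightarrow> complex" where
  "free_act f G \<equiv> (\<lambda>T. lin_ext (\<lambda>js. word_act js G T) f)"

lemma free_alg_finite_supp: "f \<in> carrier (free_alg n) \<Longrightarrow> finite (supp f)"
  by (simp add: free_alg_def monoid_algebra_simps)

lemma free_act_mult:
  assumes "f \<in> carrier (free_alg n)" "g \<in> carrier (free_alg n)"
  shows "free_act (f \<otimes>\<^bsub>free_alg n\<^esub> g) G = free_act f (free_act g G)"
proof
  fix T
  note fin = assms[THEN free_alg_finite_supp]
  have "free_act (f \<otimes>\<^bsub>free_alg n\<^esub> g) G T
      = lin_ext (\<lambda>x. lin_ext (\<lambda>y. word_act (x @ y) G T) g) f"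
    unfolding free_alg_def lin_ext_mult[OF fin] by (simp add: word_monoid_def)
  then show "free_act (f \<otimes>\<^bsub>free_alg n\<^esub> g) G T = free_act f (free_act g G) T"
    by (simp add: word_act_append word_act_lin_ext)
qed

lemma free_act_zero: "free_act f (\<lambda>T. 0) T = 0"
proof -
  have "word_act js (\<lambda>T. 0) T = 0" for js T by (induction js arbitrary: T) auto
  then show ?thesis by (simp add: lin_ext_def)
qed

lemma free_act_diff:
  assumes "f \<in> carrier (free_alg n)" "g \<in> carrier (free_alg n)"
  shows "free_act (f \<ominus>\<^bsub>free_alg n\<^esub> g) G T = free_act f G T - free_act g G T"
proof -
  note fin = assms[THEN free_alg_finite_supp]
  have "finite (supp (\<lambda>x. - 1 * g x))" using fin by auto
  then have "lin_ext h (\<lambda>x. f x + - 1 * g x) = lin_ext h f + - 1 * lin_ext h g" for h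
    using lin_ext_add[OF fin(1), of "\<lambda>x. - 1 * g x"] lin_ext_scale[OF fin(2), of h "- 1"] by simp
  then show ?thesis by (simp add: free_alg_minus[OF assms])
qed

text \<open>Asking for annihilation of every \<open>G\<close> makes the kernel a two-sided ideal. As
  the Temperley-Lieb ideal is the smallest one containing the relators, checking the relators then
  suffices.\<close>

lemma ideal_annihilator:
  "ideal {f \<in> carrier (free_alg n). \<forall>G T. free_act f G T = 0} (free_alg n)"
  (is "ideal ?K ?A")
proof -
  interpret ring ?A by (rule ring_free_alg)
  show ?thesis
  proof (rule idealI)
    show "subgroup ?K (add_monoid ?A)"
    proof (rule add.subgroupI)
      fix f assume f: "f \<in> ?K"
      have "\<zero>\<^bsub>?A\<^esub> = (\<lambda>x. 0)" by (simp add: free_alg_def monoid_algebra_simps)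
      moreover have "free_act (\<zero>\<^bsub>?A\<^esub> \<ominus>\<^bsub>?A\<^esub> f) G T
          = free_act \<zero>\<^bsub>?A\<^esub> G T - free_act f G T" for G T
        by (rule free_act_diff) (use f in auto)
      ultimately have "free_act (\<zero>\<^bsub>?A\<^esub> \<ominus>\<^bsub>?A\<^esub> f) G T = 0" for G T
        using f by simp
      then show "\<ominus>\<^bsub>?A\<^esub> f \<in> ?K"
        using f by (auto simp: a_minus_def)
    next
      fix f g
      assume "f \<in> ?K"
        "g \<in> ?K"
      moreover have "f \<oplus>\<^bsub>?A\<^esub> g = (\<lambda>x. f x + g x)"
        by (simp add: free_alg_def monoid_algebra_simps)
      ultimately show "f \<oplus>\<^bsub>?A\<^esub> g
          \<in> ?K"
        using a_closed[of f g] by (auto simp: lin_ext_add free_alg_finite_supp)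
    next
      have "\<zero>\<^bsub>?A\<^esub> = (\<lambda>x. 0)" by (simp add: free_alg_def monoid_algebra_simps)
      then have "\<zero>\<^bsub>?A\<^esub> \<in> ?K"
        using zero_closed by auto
      then show "?K \<noteq> {}" by blast
    qed auto
  next
    fix f g
    assume f: "f \<in> ?K"
      and g: "g \<in> carrier ?A"
    have "free_act f G = (\<lambda>T. 0)" for G using f by auto
    then have "free_act (g \<otimes>\<^bsub>?A\<^esub> f) G = free_act g (\<lambda>T. 0)" for G
      using free_act_mult[OF g, of f G] f by (simp only: mem_Collect_eq)
    from fun_cong[OF this] have "free_act (g \<otimes>\<^bsub>?A\<^esub> f) G T = 0" for G T
      by (simp only: free_act_zero)
    with f g show "g \<otimes>\<^bsub>?A\<^esub> f \<in> ?K"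
      by simp
    have "free_act (f \<otimes>\<^bsub>?A\<^esub> g) G T = 0" for G T
      using fun_cong[OF free_act_mult[OF _ g, of f G], of T] f by simp
    with f g show "f \<otimes>\<^bsub>?A\<^esub> g \<in> ?K"
      by simp
  qed (rule ring_free_alg)
qed

lemma TL_relators_act: "f \<in> TL_relators n \<Longrightarrow> free_act f G T = 0"
proof -
  interpret ring "free_alg n" by (rule ring_free_alg)
  have car: "of_elem js \<in> carrier (free_alg n)" if "set js \<subseteq> {1..<n}" for js
    using that by (intro of_elem_word_carrier) auto
  have smult: "c \<odot>\<^bsub>free_alg n\<^esub> f = (\<lambda>x. c * f x)" for c f
    by (simp add: free_alg_def monoid_algebra_simps)
  assume "f \<in> TL_relators n"
  then consider
      i where "i \<in> {1..<n}" "f = of_elem [i, i] \<ominus>\<^bsub>free_alg n\<^esub> 2 \<odot>\<^bsub>free_alg n\<^esub> of_elem [i]"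
    | i j where "i \<in> {1..<n}" "j \<in> {1..<n}" "\<bar>int i - int j\<bar> \<ge> 2"
        "f = of_elem [i, j] \<ominus>\<^bsub>free_alg n\<^esub> of_elem [j, i]"
    | i j where "i \<in> {1..<n}" "j \<in> {1..<n}" "\<bar>int i - int j\<bar> = 1"
        "f = of_elem [i, j, i] \<ominus>\<^bsub>free_alg n\<^esub> of_elem [i]"
    unfolding TL_relators_def of_elem_word_mult append.simps by blast
  then show ?thesis
  proof cases
    case 1
    have "2 \<odot>\<^bsub>free_alg n\<^esub> of_elem [i] \<in> carrier (free_alg n)"
      using 1 by (intro free_alg_smult_closed car) auto
    moreover have "lin_ext h (\<lambda>x. 2 * of_elem [i] x) = 2 * h [i]" for h
      by (subst lin_ext_scale) auto
    ultimately show ?thesis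
      using 1 word_act_square[of i G T]
      by (simp add: free_act_diff car smult del: word_act.simps)
  next
    case 2
    then show ?thesis
      using word_act_commute[of i j G T] by (simp add: free_act_diff car del: word_act.simps)
  next
    case 3
    then show ?thesis
      using word_act_braid[of i j G T] by (simp add: free_act_diff car del: word_act.simps)
  qed
qed

lemma TL_ideal_act: "f \<in> TL_ideal n \<Longrightarrow> free_act f G T = 0"
proof -
  have "TL_ideal n \<subseteq> {f \<in> carrier (free_alg n). \<forall>G T. free_act f G T = 0}"
    unfolding TL_ideal_def
    by (rule ring.genideal_minimal[OF ring_free_alg ideal_annihilator])
      (use TL_relators_subset TL_relators_act in blast)
  then show "f \<in> TL_ideal n \<Longrightarrow> free_act f G T = 0" by blast
qed

text \<open>The action of the quotient. The chosen representative is immaterial, because two of them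
  differ by an element of \<open>TL_ideal n\<close>, which acts by zero.\<close>

definition TL_act ::
  "nat \<Rightarrow> (nat list \<Rightarrow> complex) set \<Rightarrow> (nat set \<Rightarrow> complex) \<Rightarrow> nat set \<Rightarrow> complex" where
  "TL_act n X G = free_act (SOME f. f \<in> carrier (free_alg n) \<and> X = TL_class n f) G"

lemma TL_act_class:
  assumes f: "f \<in> carrier (free_alg n)"
  shows "TL_act n (TL_class n f) G = free_act f G"
proof
  fix T
  let ?g = "SOME g. g \<in> carrier (free_alg n) \<and> TL_class n f = TL_class n g"
  have g: "?g \<in> carrier (free_alg n) \<and> TL_class n f = TL_class n ?g"
    by (rule someI[where x = f]) (use f in simp)
  then have "(\<lambda>x. f x - ?g x) \<in> TL_ideal n" using f TL_class_eq_iff by blast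
  from TL_ideal_act[OF this, of G T] show "TL_act n (TL_class n f) G T = free_act f G T"
    using free_act_diff[OF f, of ?g G T] g free_alg_minus[OF f, of ?g] by (simp add: TL_act_def)
qed

lemma TL_act_mult:
  assumes "X \<in> carrier (TL n)" "Y \<in> carrier (TL n)"
  shows "TL_act n (X \<otimes>\<^bsub>TL n\<^esub> Y) G = TL_act n X (TL_act n Y G)"
proof -
  interpret ring "free_alg n" by (rule ring_free_alg)
  obtain f g where "f \<in> carrier (free_alg n)" "X = TL_class n f"
      "g \<in> carrier (free_alg n)" "Y = TL_class n g"
    using TL_class_surj assms by metis
  then show ?thesis
    by (simp add: TL_class_mult[symmetric] TL_act_class free_act_mult)
qed

lemma TL_act_add:
  assumes "X \<in> carrier (TL n)" "Y \<in> carrier (TL n)"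
  shows "TL_act n (X \<oplus>\<^bsub>TL n\<^esub> Y) G T = TL_act n X G T + TL_act n Y G T"
proof -
  interpret ring "free_alg n" by (rule ring_free_alg)
  obtain f g where fg: "f \<in> carrier (free_alg n)" "X = TL_class n f"
      "g \<in> carrier (free_alg n)" "Y = TL_class n g"
    using TL_class_surj assms by metis
  have "f \<oplus>\<^bsub>free_alg n\<^esub> g = (\<lambda>x. f x + g x)" by (simp add: free_alg_def monoid_algebra_simps)
  then show ?thesis
    using fg a_closed[of f g]
    by (simp add: TL_class_add[symmetric] TL_act_class lin_ext_add free_alg_finite_supp)
qed

lemma TL_act_smult:
  assumes "X \<in> carrier (TL n)"
  shows "TL_act n (c \<odot>\<^bsub>TL n\<^esub> X) G T = c * TL_act n X G T"
proof -
  obtain f where f: "f \<in> carrier (free_alg n)" "X = TL_class n f"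
    using TL_class_surj assms by metis
  have "c \<odot>\<^bsub>free_alg n\<^esub> f = (\<lambda>x. c * f x)" by (simp add: free_alg_def monoid_algebra_simps)
  then show ?thesis
    using f free_alg_smult_closed[OF f(1), of c]
    by (simp add: TL_class_smult[symmetric] TL_act_class lin_ext_scale free_alg_finite_supp)
qed

lemma TL_act_zero: "TL_act n \<zero>\<^bsub>TL n\<^esub> G T = 0"
  using TL_act_smult[of "\<zero>\<^bsub>TL n\<^esub>" n 0] TL_smult_zero[of "\<zero>\<^bsub>TL n\<^esub>" n]
    ring.ring_simprules(2)[OF ring_TL[of n]] by simp

lemma TL_act_one: "TL_act n \<one>\<^bsub>TL n\<^esub> G = G"
proof -
  interpret ring "free_alg n" by (rule ring_free_alg)
  have "\<one>\<^bsub>free_alg n\<^esub> = of_elem []"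
    by (simp add: free_alg_def monoid_algebra_simps word_monoid_def)
  then show ?thesis
    using TL_act_class[OF one_closed, of G] TL_class_one[of n] by simp
qed

section \<open>Generators and their products\<close>

lemma TL_act_gen: "i \<in> {1..<n} \<Longrightarrow> TL_act n (TL_gen n i) G = word_act [i] G"
  unfolding TL_gen_def by (subst TL_act_class) (simp_all add: of_elem_word_carrier)

lemma TL_gen_closed: "i \<in> {1..<n} \<Longrightarrow> TL_gen n i \<in> carrier (TL n)"
  unfolding TL_gen_def by (intro TL_class_carrier of_elem_word_carrier) simp

text \<open>The fold inside \<open>TL_beta\<close>, with the word as a parameter instead of a
  choice.\<close>

definition TL_word :: "nat \<Rightarrow> nat list \<Rightarrow> (nat list \<Rightarrow> complex) set" where
  "TL_word n js = foldr (\<lambda>x y. x \<otimes>\<^bsub>TL n\<^esub> y) (map (TL_gen n) js) \<one>\<^bsub>TL n\<^esub>"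

lemma TL_word_simps [simp]:
  "TL_word n [] = \<one>\<^bsub>TL n\<^esub>" "TL_word n (i # js) = TL_gen n i \<otimes>\<^bsub>TL n\<^esub> TL_word n js"
  by (simp_all add: TL_word_def)

lemma TL_word_eq_class: "js \<in> lists {1..<n} \<Longrightarrow> TL_word n js = TL_class n (of_elem js)"
proof (induction js)
  case Nil
  have "\<one>\<^bsub>free_alg n\<^esub> = of_elem []"
    by (simp add: free_alg_def monoid_algebra_simps word_monoid_def)
  then show ?case by (simp add: TL_class_one[symmetric])
next
  case (Cons i js)
  then have "TL_word n (i # js) = TL_class n (free_gen i) \<otimes>\<^bsub>TL n\<^esub> TL_class n (of_elem js)"
    by (simp add: TL_gen_def)
  also have "\<dots> = TL_class n (of_elem ([i] @ js))"
    using Cons by (simp only: of_elem_word_mult[symmetric, where n = n])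
      (intro TL_class_mult[symmetric] of_elem_word_carrier, auto)
  finally show ?case by simp
qed

lemma TL_word_closed: "js \<in> lists {1..<n} \<Longrightarrow> TL_word n js \<in> carrier (TL n)"
  by (simp add: TL_word_eq_class TL_class_carrier of_elem_word_carrier)

lemma TL_word_append:
  "\<lbrakk>js \<in> lists {1..<n}; ks \<in> lists {1..<n}\<rbrakk>
    \<Longrightarrow> TL_word n (js @ ks) = TL_word n js \<otimes>\<^bsub>TL n\<^esub> TL_word n ks"
  by (simp add: TL_word_eq_class TL_class_mult[symmetric] of_elem_word_carrier of_elem_word_mult)

lemma TL_act_word: "js \<in> lists {1..<n} \<Longrightarrow> TL_act n (TL_word n js) G = word_act js G"
  by (simp add: TL_word_eq_class TL_act_class of_elem_word_carrier)

lemma TL_class_relator: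
  assumes "f \<in> carrier (free_alg n)" "g \<in> carrier (free_alg n)"
    and "f \<ominus>\<^bsub>free_alg n\<^esub> g \<in> TL_relators n"
  shows "TL_class n f = TL_class n g"
proof -
  have "f \<ominus>\<^bsub>free_alg n\<^esub> g \<in> TL_ideal n"
    unfolding TL_ideal_def using ring.genideal_self[OF ring_free_alg TL_relators_subset] assms(3)
    by blast
  then show ?thesis
    by (simp only: TL_class_eq_iff[OF assms(1,2)] free_alg_minus[OF assms(1,2)])
qed

lemma TL_word_commute:
  assumes "i \<in> {1..<n}" "j \<in> {1..<n}" "\<bar>int i - int j\<bar> \<ge> 2"
  shows "TL_word n [i, j] = TL_word n [j, i]"
proof -
  have "of_elem [i, j] \<ominus>\<^bsub>free_alg n\<^esub> of_elem [j, i] \<in> TL_relators n"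
    unfolding TL_relators_def of_elem_word_mult append.simps using assms by blast
  then have "TL_class n (of_elem [i, j]) = TL_class n (of_elem [j, i])"
    using assms by (intro TL_class_relator) (auto simp: of_elem_word_carrier)
  then show ?thesis
    using assms by (simp add: TL_word_eq_class del: TL_word_simps)
qed

lemma TL_word_square:
  assumes "i \<in> {1..<n}"
  shows "TL_word n [i, i] = 2 \<odot>\<^bsub>TL n\<^esub> TL_gen n i"
proof -
  have "TL_class n (of_elem [i, i]) = TL_class n (2 \<odot>\<^bsub>free_alg n\<^esub> free_gen i)"
    using assms
    by (intro TL_class_relator)
      (auto intro!: free_alg_smult_closed simp: of_elem_word_carrier TL_relators_def
        of_elem_word_mult)
  then show ?thesis
    using assms by (simp add: TL_word_eq_class TL_class_smult of_elem_word_carrier TL_gen_def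
        del: TL_word_simps)
qed

lemma TL_word_braid:
  assumes "i \<in> {1..<n}" "j \<in> {1..<n}" "\<bar>int i - int j\<bar> = 1"
  shows "TL_word n [i, j, i] = TL_gen n i"
proof -
  have "of_elem [i, j, i] \<ominus>\<^bsub>free_alg n\<^esub> of_elem [i] \<in> TL_relators n"
    unfolding TL_relators_def of_elem_word_mult append.simps using assms by blast
  then have "TL_class n (of_elem [i, j, i]) = TL_class n (free_gen i)"
    using assms by (intro TL_class_relator) (auto simp: of_elem_word_carrier)
  then show ?thesis
    using assms by (simp add: TL_word_eq_class TL_gen_def del: TL_word_simps)
qed

section \<open>The Coxeter presentation of the symmetric group\<close>

text \<open>The relations are stated inside a context \<open>xs\<close>, \<open>ys\<close>, so that
  compatibility with concatenation is a consequence and not a further rule.\<close>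

inductive cox_eq :: "nat \<Rightarrow> nat list \<Rightarrow> nat list \<Rightarrow> bool" for n where
  cox_refl: "cox_eq n js js"
| cox_sym: "cox_eq n js ks \<Longrightarrow> cox_eq n ks js"
| cox_trans [trans]: "cox_eq n js ks \<Longrightarrow> cox_eq n ks ls \<Longrightarrow> cox_eq n js ls"
| cox_square: "\<lbrakk>xs \<in> lists {1..<n}; ys \<in> lists {1..<n}; i \<in> {1..<n}\<rbrakk>
    \<Longrightarrow> cox_eq n (xs @ [i, i] @ ys) (xs @ ys)"
| cox_commute: "\<lbrakk>xs \<in> lists {1..<n}; ys \<in> lists {1..<n}; i \<in> {1..<n}; j \<in> {1..<n};
      \<bar>int i - int j\<bar> \<ge> 2\<rbrakk>
    \<Longrightarrow> cox_eq n (xs @ [i, j] @ ys) (xs @ [j, i] @ ys)"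
| cox_braid: "\<lbrakk>xs \<in> lists {1..<n}; ys \<in> lists {1..<n}; i \<in> {1..<n}; j \<in> {1..<n};
      \<bar>int i - int j\<bar> = 1\<rbrakk>
    \<Longrightarrow> cox_eq n (xs @ [i, j, i] @ ys) (xs @ [j, i, j] @ ys)"

lemma cox_eq_append_left:
  assumes zs: "zs \<in> lists {1..<n}" shows "cox_eq n js ks \<Longrightarrow> cox_eq n (zs @ js) (zs @ ks)"
proof (induction rule: cox_eq.induct)
  case (cox_square xs ys i)
  then show ?case using cox_eq.cox_square[of "zs @ xs" n ys i] zs by simp
next
  case (cox_commute xs ys i j)
  then show ?case using cox_eq.cox_commute[of "zs @ xs" n ys i j] zs by simp
next
  case (cox_braid xs ys i j)
  then show ?case using cox_eq.cox_braid[of "zs @ xs" n ys i j] zs by simp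
qed (blast intro: cox_eq.intros)+

lemma cox_eq_append_right:
  assumes zs: "zs \<in> lists {1..<n}" shows "cox_eq n js ks \<Longrightarrow> cox_eq n (js @ zs) (ks @ zs)"
proof (induction rule: cox_eq.induct)
  case (cox_square xs ys i)
  then show ?case using cox_eq.cox_square[of xs n "ys @ zs" i] zs by simp
next
  case (cox_commute xs ys i j)
  then show ?case using cox_eq.cox_commute[of xs n "ys @ zs" i j] zs by simp
next
  case (cox_braid xs ys i j)
  then show ?case using cox_eq.cox_braid[of xs n "ys @ zs" i j] zs by simp
qed (blast intro: cox_eq.intros)+

lemma cox_eq_mono:
  assumes "m \<le> n" shows "cox_eq m js ks \<Longrightarrow> cox_eq n js ks"
proof (induction rule: cox_eq.induct)
  case (cox_square xs ys i)
  then show ?case using assms by (intro cox_eq.cox_square) (auto simp: in_lists_conv_set)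
next
  case (cox_commute xs ys i j)
  then show ?case using assms by (intro cox_eq.cox_commute) (auto simp: in_lists_conv_set)
next
  case (cox_braid xs ys i j)
  then show ?case using assms by (intro cox_eq.cox_braid) (auto simp: in_lists_conv_set)
qed (blast intro: cox_eq.intros)+

lemma cox_eq_word_perm: "cox_eq n js ks \<Longrightarrow> word_perm js = word_perm ks"
proof (induction rule: cox_eq.induct)
  case (cox_square xs ys i)
  show ?case by (simp add: fun_eq_iff)
next
  case (cox_commute xs ys i j)
  have "adj_swap i (adj_swap j x) = adj_swap j (adj_swap i x)" for x
    using cox_commute by (auto simp: adj_swap_eq)
  then show ?case by (simp add: fun_eq_iff)
next
  case (cox_braid xs ys i j)
  then have "j = Suc i \<or> i = Suc j" by auto
  then have "adj_swap i (adj_swap j (adj_swap i x)) = adj_swap j (adj_swap i (adj_swap j x))" for x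
    by (auto simp: adj_swap_eq)
  then show ?case by (simp add: fun_eq_iff)
qed simp_all

lemma cox_eq_move_left:
  assumes "i \<in> {1..<n}" "zs \<in> lists {1..<n}" "\<And>z. z \<in> set zs \<Longrightarrow> \<bar>int z - int i\<bar> \<ge> 2"
  shows "cox_eq n (zs @ [i]) (i # zs)"
  using assms(2,3)
proof (induction zs)
  case (Cons z zs)
  then have z: "[z] \<in> lists {1..<n}" "z \<in> {1..<n}" "zs \<in> lists {1..<n}"
      "\<bar>int z - int i\<bar> \<ge> 2" by auto
  have "cox_eq n ([z] @ (zs @ [i])) ([z] @ (i # zs))"
    by (rule cox_eq_append_left[OF z(1) Cons.IH]) (use Cons.prems in auto)
  moreover have "cox_eq n ([] @ [z, i] @ zs) ([] @ [i, z] @ zs)"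
    using z assms(1) by (intro cox_commute) simp_all
  ultimately show ?case by (auto intro: cox_trans)
qed (auto intro: cox_refl)

lemma rev_upt_Suc: "j \<le> m \<Longrightarrow> rev [j..<Suc m] = rev [Suc j..<Suc m] @ [j]"
  by (simp add: upt_conv_Cons del: upt_Suc)

text \<open>Normal form: modulo the Coxeter relations the largest letter can be confined to one
  descending run at the end of the word.\<close>

lemma cox_normal_form:
  assumes "js \<in> lists {1..<Suc m}"
  shows "\<exists>ks \<in> lists {1..<m}. \<exists>j \<in> {1..Suc m}. cox_eq (Suc m) js (ks @ rev [j..<Suc m])"
  using assms
proof (induction js rule: rev_induct)
  case Nil
  show ?case
    by (intro bexI[of _ "[]"] bexI[of _ "Suc m"]) (auto intro: cox_refl)
next
  case (snoc i js)
  then obtain ks j where ks: "ks \<in> lists {1..<m}" and j: "j \<in> {1..Suc m}"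
      and eq: "cox_eq (Suc m) js (ks @ rev [j..<Suc m])"
    using append_in_lists_conv[of js "[i]"] by blast
  have i: "i \<in> {1..<Suc m}" using snoc by auto
  have ks': "ks \<in> lists {1..<Suc m}" using ks by (auto simp: in_lists_conv_set)
  have eq1: "cox_eq (Suc m) (js @ [i]) (ks @ rev [j..<Suc m] @ [i])"
    using cox_eq_append_right[OF _ eq, of "[i]"] i by simp
  have lists: "rev [p..<q] \<in> lists {1..<Suc m}" if "1 \<le> p" "q \<le> Suc m" for p q
    using that by (auto simp: in_lists_conv_set)
  \<comment> \<open>The run is \<open>m, ..., j\<close>. A letter below \<open>j - 1\<close>
    commutes past it, \<open>j - 1\<close> extends it, and \<open>j\<close> cancels its last letter.
    A letter \<open>i > j\<close> moves left until it meets \<open>i, i - 1\<close>; a braid move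
    turns it into \<open>i - 1\<close>, which commutes to the front of the run and is smaller than
    \<open>m\<close>.\<close>
  consider "Suc i < j" | "Suc i = j" | "i = j" | "j < i" by linarith
  then show ?case
  proof cases
    case 1
    have "cox_eq (Suc m) (ks @ (rev [j..<Suc m] @ [i])) (ks @ (i # rev [j..<Suc m]))"
      by (intro cox_eq_append_left[OF ks'] cox_eq_move_left i lists) (use 1 j in auto)
    with eq1 have "cox_eq (Suc m) (js @ [i]) ((ks @ [i]) @ rev [j..<Suc m])"
      by (simp add: cox_trans del: upt_Suc)
    moreover have "ks @ [i] \<in> lists {1..<m}" using ks 1 i j by auto
    ultimately show ?thesis using j by blast
  next
    case 2
    have "rev [j..<Suc m] @ [i] = rev [i..<Suc m]" using i 2 by (simp add: rev_upt_Suc del: upt_Suc)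
    with eq1 have "cox_eq (Suc m) (js @ [i]) (ks @ rev [i..<Suc m])" by simp
    then show ?thesis using ks i by (intro bexI[of _ ks] bexI[of _ i]) auto
  next
    case 3
    have "rev [j..<Suc m] @ [i] = rev [Suc i..<Suc m] @ [i, i]"
      using i 3 by (simp add: rev_upt_Suc del: upt_Suc)
    moreover have "cox_eq (Suc m) ((ks @ rev [Suc i..<Suc m]) @ [i, i] @ [])
        ((ks @ rev [Suc i..<Suc m]) @ [])"
      by (rule cox_square) (use ks' i lists[of "Suc i" "Suc m"] in auto)
    ultimately have "cox_eq (Suc m) (js @ [i]) (ks @ rev [Suc i..<Suc m])"
      using eq1 by (simp add: cox_trans del: upt_Suc)
    then show ?thesis using ks i by (intro bexI[of _ ks] bexI[of _ "Suc i"]) auto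
  next
    case 4
    then obtain l where l: "i = Suc l" "j \<le> l" by (cases i) auto
    have split: "[j..<Suc m] = [j..<l] @ [l, Suc l] @ [Suc (Suc l)..<Suc m]"
    proof -
      have "[j..<Suc m] = [j..<l] @ [l..<Suc m]"
        using i l upt_add_eq_append[of j l "Suc m - l"] by simp
      then show ?thesis using i l by (simp add: upt_conv_Cons del: upt_Suc)
    qed
    let ?A = "rev [Suc (Suc l)..<Suc m]" and ?B = "rev [j..<l]"
    have A: "?A \<in> lists {1..<Suc m}" and B: "?B \<in> lists {1..<Suc m}"
      using j i l by (intro lists; simp)+
    have l1: "l \<in> {1..<Suc m}" using i j l by auto
    have "ks @ rev [j..<Suc m] @ [i] = (ks @ ?A @ [Suc l, l]) @ (?B @ [Suc l])"
      unfolding split l by simp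
    also have "cox_eq (Suc m) \<dots> ((ks @ ?A @ [Suc l, l]) @ (Suc l # ?B))"
      by (intro cox_eq_append_left cox_eq_move_left B)
        (use ks' A l1 i l in \<open>auto simp del: upt_Suc\<close>)
    also have "\<dots> = (ks @ ?A) @ [Suc l, l, Suc l] @ ?B" by simp
    also have "cox_eq (Suc m) \<dots> ((ks @ ?A) @ [l, Suc l, l] @ ?B)"
      by (rule cox_braid) (use ks' A B l1 i l in \<open>auto simp del: upt_Suc\<close>)
    also have "\<dots> = ks @ (?A @ [l]) @ ([Suc l, l] @ ?B)" by simp
    also have "cox_eq (Suc m) \<dots> (ks @ (l # ?A) @ ([Suc l, l] @ ?B))"
      by (intro cox_eq_append_left cox_eq_append_right cox_eq_move_left A ks')
        (use A B l1 i l in \<open>auto simp del: upt_Suc\<close>)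
    also have "\<dots> = (ks @ [l]) @ rev [j..<Suc m]" unfolding split by simp
    finally have "cox_eq (Suc m) (js @ [i]) ((ks @ [l]) @ rev [j..<Suc m])"
      using eq1 by (rule cox_trans[rotated])
    moreover have "ks @ [l] \<in> lists {1..<m}" using ks l i l1 by auto
    ultimately show ?thesis using j by blast
  qed
qed

lemma word_perm_rev_upt: "j \<le> k \<Longrightarrow> word_perm (rev [j..<k]) j = k"
  by (induction k) (auto simp: le_Suc_eq)

text \<open>The run of the normal form sends \<open>j\<close> to the top point \<open>Suc m\<close>,
  which the other letters fix. A word for the identity therefore has an empty run, and one letter
  fewer remains for the induction on \<open>n\<close>.\<close>

lemma cox_eq_Nil:
  "\<lbrakk>js \<in> lists {1..<n}; word_perm js = id\<rbrakk> \<Longrightarrow> cox_eq n js []"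
proof (induction n arbitrary: js)
  case 0
  then show ?case by (cases js) (auto intro: cox_refl)
next
  case (Suc m)
  obtain ks j where ks: "ks \<in> lists {1..<m}" and j: "j \<in> {1..Suc m}"
      and eq: "cox_eq (Suc m) js (ks @ rev [j..<Suc m])"
    using cox_normal_form[OF Suc.prems(1)] by blast
  have perm: "word_perm ks \<circ> word_perm (rev [j..<Suc m]) = id"
    using cox_eq_word_perm[OF eq] Suc.prems(2) by (simp only: word_perm_append)
  have "word_perm ks (Suc m) = Suc m"
    using word_perm_permutes[OF ks] by (rule permutes_not_in) simp
  then have "j = Suc m"
    using fun_cong[OF perm, of j] word_perm_rev_upt[of j "Suc m"] j by (simp del: upt_Suc)
  then have "cox_eq (Suc m) js ks" "word_perm ks = id" using eq perm by auto
  then show ?case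
    using Suc.IH[OF ks] by (blast intro: cox_trans cox_eq_mono[of m "Suc m"] le_SucI)
qed

lemma cox_eq_rev_append: "js \<in> lists {1..<n} \<Longrightarrow> cox_eq n (rev js @ js) []"
proof (induction js)
  case (Cons i js)
  have "cox_eq n (rev js @ [i, i] @ js) (rev js @ js)"
    using Cons.prems by (intro cox_square) (auto simp: in_lists_conv_set)
  with Cons show ?case by (auto intro: cox_trans)
qed (auto intro: cox_refl)

text \<open>Two words for one permutation are compared through \<open>js @ rev ks @ ks\<close>,
  where either half of the right-hand part can be cancelled.\<close>

lemma cox_eq_iff:
  assumes js: "js \<in> lists {1..<n}" and ks: "ks \<in> lists {1..<n}"
  shows "cox_eq n js ks \<longleftrightarrow> word_perm js = word_perm ks"
proof
  assume eq: "word_perm js = word_perm ks"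
  have rks: "rev ks \<in> lists {1..<n}" using ks by (simp add: in_lists_conv_set)
  have "word_perm (js @ rev ks) = id"
    using eq cox_eq_word_perm[OF cox_eq_rev_append[OF rks]] by simp
  then have 1: "cox_eq n ((js @ rev ks) @ ks) ([] @ ks)"
    using js rks by (intro cox_eq_append_right[OF ks] cox_eq_Nil) auto
  have "cox_eq n (js @ (rev ks @ ks)) (js @ [])"
    by (rule cox_eq_append_left[OF js cox_eq_rev_append[OF ks]])
  from cox_trans[OF cox_sym[OF this], of ks] 1 show "cox_eq n js ks" by simp
qed (rule cox_eq_word_perm)


section \<open>The homomorphism from the group algebra\<close>

definition TL_refl :: "nat \<Rightarrow> nat \<Rightarrow> (nat list \<Rightarrow> complex) set" where
  "TL_refl n i = TL_gen n i \<ominus>\<^bsub>TL n\<^esub> \<one>\<^bsub>TL n\<^esub>"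

definition refl_word :: "nat \<Rightarrow> nat list \<Rightarrow> (nat list \<Rightarrow> complex) set" where
  "refl_word n js = foldr (\<lambda>x y. x \<otimes>\<^bsub>TL n\<^esub> y) (map (TL_refl n) js) \<one>\<^bsub>TL n\<^esub>"

lemma refl_word_simps [simp]:
  "refl_word n [] = \<one>\<^bsub>TL n\<^esub>" "refl_word n (i # js) = TL_refl n i \<otimes>\<^bsub>TL n\<^esub> refl_word n js"
  by (simp_all add: refl_word_def)

lemma TL_refl_closed: "i \<in> {1..<n} \<Longrightarrow> TL_refl n i \<in> carrier (TL n)"
proof -
  interpret ring "TL n" by (rule ring_TL)
  show "i \<in> {1..<n} \<Longrightarrow> TL_refl n i \<in> carrier (TL n)"
    unfolding TL_refl_def by (intro minus_closed TL_gen_closed) auto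
qed

lemma refl_word_closed: "js \<in> lists {1..<n} \<Longrightarrow> refl_word n js \<in> carrier (TL n)"
proof (induction js)
  interpret ring "TL n" by (rule ring_TL)
  case Nil show ?case by simp
next
  interpret ring "TL n" by (rule ring_TL)
  case (Cons i js)
  then show ?case using TL_refl_closed[of i n] by simp
qed

lemma refl_word_append:
  "\<lbrakk>js \<in> lists {1..<n}; ks \<in> lists {1..<n}\<rbrakk>
    \<Longrightarrow> refl_word n (js @ ks) = refl_word n js \<otimes>\<^bsub>TL n\<^esub> refl_word n ks"
proof (induction js)
  interpret ring "TL n" by (rule ring_TL)
  case Nil then show ?case by (simp add: refl_word_closed)
next
  interpret ring "TL n" by (rule ring_TL)
  case (Cons i js)
  then show ?case using TL_refl_closed[of i n] by (simp add: refl_word_closed m_assoc)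
qed

lemma (in ring) shifted_square:
  assumes [simp]: "x \<in> carrier R" and "x \<otimes> x = x \<oplus> x"
  shows "(x \<ominus> \<one>) \<otimes> (x \<ominus> \<one>) = \<one>"
proof -
  have "(x \<ominus> \<one>) \<otimes> (x \<ominus> \<one>) = (x \<otimes> x \<ominus> (x \<oplus> x)) \<oplus> \<one>"
    using assms(1) by (algebra; simp add: r_one)
  also have "\<dots> = \<one>" using assms(1) unfolding assms(2) by (algebra; simp add: r_one)
  finally show ?thesis .
qed

text \<open>The right-hand side is symmetric in \<open>x\<close> and \<open>y\<close>; this symmetry
  is the braid relation for the shifted generators.\<close>

lemma (in ring) shifted_braid:
  assumes [simp]: "x \<in> carrier R" "y \<in> carrier R"
    and "x \<otimes> x = x \<oplus> x" "x \<otimes> y \<otimes> x = x"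
  shows "(x \<ominus> \<one>) \<otimes> (y \<ominus> \<one>) \<otimes> (x \<ominus> \<one>) = x \<oplus> y \<ominus> x \<otimes> y \<ominus> y \<otimes> x \<ominus> \<one>"
proof -
  \<comment> \<open>The first two brackets vanish by the hypotheses on \<open>x\<close>. Kept in
    this form, the equation is an identity in every ring.\<close>
  have "(x \<ominus> \<one>) \<otimes> (y \<ominus> \<one>) \<otimes> (x \<ominus> \<one>) =
      (x \<otimes> y \<otimes> x \<ominus> x) \<ominus> (x \<otimes> x \<ominus> (x \<oplus> x)) \<oplus> (x \<oplus> y \<ominus> x \<otimes> y \<ominus> y \<otimes> x \<ominus> \<one>)"
    using assms(1,2) by (algebra; simp add: r_one)
  also have "\<dots> = x \<oplus> y \<ominus> x \<otimes> y \<ominus> y \<otimes> x \<ominus> \<one>" using assms(1,2) unfolding assms(3,4) by (algebra; simp add: r_one)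
  finally show ?thesis .
qed

lemma TL_gen_square: "i \<in> {1..<n} \<Longrightarrow> TL_gen n i \<otimes>\<^bsub>TL n\<^esub> TL_gen n i = TL_gen n i \<oplus>\<^bsub>TL n\<^esub> TL_gen n i"
proof -
  interpret ring "TL n" by (rule ring_TL)
  assume i: "i \<in> {1..<n}"
  have "(1 + 1) \<odot>\<^bsub>TL n\<^esub> TL_gen n i = TL_gen n i \<oplus>\<^bsub>TL n\<^esub> TL_gen n i"
    using TL_gen_closed[OF i] by (simp only: TL_smult_simps)
  then show ?thesis using TL_word_square[OF i] TL_gen_closed[OF i] by simp
qed

lemma TL_gen_braid:
  assumes "i \<in> {1..<n}" "j \<in> {1..<n}" "\<bar>int i - int j\<bar> = 1"
  shows "TL_gen n i \<otimes>\<^bsub>TL n\<^esub> TL_gen n j \<otimes>\<^bsub>TL n\<^esub> TL_gen n i = TL_gen n i"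
proof -
  interpret ring "TL n" by (rule ring_TL)
  show ?thesis using TL_word_braid[OF assms] assms(1,2)[THEN TL_gen_closed] by (simp add: m_assoc)
qed

lemma refl_word_braid_expansion:
  assumes i: "i \<in> {1..<n}" and j: "j \<in> {1..<n}" and ij: "\<bar>int i - int j\<bar> = 1"
  shows "refl_word n [i, j, i] = TL_gen n i \<oplus>\<^bsub>TL n\<^esub> TL_gen n j
      \<ominus>\<^bsub>TL n\<^esub> TL_gen n i \<otimes>\<^bsub>TL n\<^esub> TL_gen n j \<ominus>\<^bsub>TL n\<^esub> TL_gen n j \<otimes>\<^bsub>TL n\<^esub> TL_gen n i
      \<ominus>\<^bsub>TL n\<^esub> \<one>\<^bsub>TL n\<^esub>"
proof -
  interpret ring "TL n" by (rule ring_TL)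
  note [simp] = TL_gen_closed[OF i] TL_gen_closed[OF j] TL_refl_closed[OF i] TL_refl_closed[OF j]
  have "refl_word n [i, j, i] = TL_refl n i \<otimes>\<^bsub>TL n\<^esub> TL_refl n j \<otimes>\<^bsub>TL n\<^esub> TL_refl n i"
    by (simp add: m_assoc)
  then show ?thesis
    unfolding TL_refl_def
    by (simp add: shifted_braid TL_gen_square[OF i] TL_gen_braid[OF i j ij])
qed

lemma cox_eq_refl_word: "cox_eq n js ks \<Longrightarrow> refl_word n js = refl_word n ks"
proof (induction rule: cox_eq.induct)
  interpret ring "TL n" by (rule ring_TL)
  case (cox_square xs ys i)
  have "refl_word n [i, i] = \<one>\<^bsub>TL n\<^esub>"
    using TL_gen_closed[OF cox_square(3)] TL_refl_closed[OF cox_square(3)]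
    by (simp add: TL_refl_def shifted_square TL_gen_square[OF cox_square(3)])
  moreover have "refl_word n (xs @ [i, i] @ ys)
      = refl_word n xs \<otimes>\<^bsub>TL n\<^esub> (refl_word n [i, i] \<otimes>\<^bsub>TL n\<^esub> refl_word n ys)"
    by (subst refl_word_append, use cox_square in simp, use cox_square in simp,
        subst refl_word_append) (use cox_square in auto)
  ultimately show ?case using cox_square
    by (simp add: refl_word_append refl_word_closed del: refl_word_simps)
next
  interpret ring "TL n" by (rule ring_TL)
  case (cox_commute xs ys i j)
  note ij = cox_commute(3,4)
  note [simp] = TL_gen_closed[OF ij(1)] TL_gen_closed[OF ij(2)]
  have comm: "TL_gen n i \<otimes>\<^bsub>TL n\<^esub> TL_gen n j = TL_gen n j \<otimes>\<^bsub>TL n\<^esub> TL_gen n i"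
    using TL_word_commute[OF ij cox_commute(5)] by simp
  have "refl_word n [i, j] = TL_gen n i \<otimes>\<^bsub>TL n\<^esub> TL_gen n j
      \<ominus>\<^bsub>TL n\<^esub> TL_gen n i \<ominus>\<^bsub>TL n\<^esub> TL_gen n j \<oplus>\<^bsub>TL n\<^esub> \<one>\<^bsub>TL n\<^esub>"
    using ij[THEN TL_gen_closed] unfolding refl_word_simps TL_refl_def by (algebra; simp add: r_one)
  also have "\<dots> = TL_gen n j \<otimes>\<^bsub>TL n\<^esub> TL_gen n i
      \<ominus>\<^bsub>TL n\<^esub> TL_gen n j \<ominus>\<^bsub>TL n\<^esub> TL_gen n i \<oplus>\<^bsub>TL n\<^esub> \<one>\<^bsub>TL n\<^esub>"
    using ij[THEN TL_gen_closed] unfolding comm by (algebra; simp add: r_one)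
  also have "\<dots> = refl_word n [j, i]"
    using ij[THEN TL_gen_closed] unfolding refl_word_simps TL_refl_def by (algebra; simp add: r_one)
  finally have "refl_word n [i, j] = refl_word n [j, i]" .
  moreover have "refl_word n (xs @ [k, l] @ ys)
      = refl_word n xs \<otimes>\<^bsub>TL n\<^esub> (refl_word n [k, l] \<otimes>\<^bsub>TL n\<^esub> refl_word n ys)"
    if "k \<in> {1..<n}" "l \<in> {1..<n}" for k l
    by (subst refl_word_append, use cox_commute that in simp, use cox_commute that in simp,
        subst refl_word_append) (use cox_commute that in auto)
  ultimately show ?case using ij by (simp del: refl_word_simps)
next
  interpret ring "TL n" by (rule ring_TL)
  case (cox_braid xs ys i j)
  note ij = cox_braid(3,4)
  note [simp] = TL_gen_closed[OF ij(1)] TL_gen_closed[OF ij(2)]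
  have ji: "\<bar>int j - int i\<bar> = 1" using cox_braid by auto
  have "refl_word n [i, j, i] = refl_word n [j, i, j]"
    using ij[THEN TL_gen_closed] unfolding refl_word_braid_expansion[OF ij cox_braid(5)]
      refl_word_braid_expansion[OF ij(2,1) ji] by (algebra; simp add: r_one)
  moreover have "refl_word n (xs @ [k, l, k] @ ys)
      = refl_word n xs \<otimes>\<^bsub>TL n\<^esub> (refl_word n [k, l, k] \<otimes>\<^bsub>TL n\<^esub> refl_word n ys)"
    if "k \<in> {1..<n}" "l \<in> {1..<n}" for k l
    by (subst refl_word_append, use cox_braid that in simp, use cox_braid that in simp,
        subst refl_word_append) (use cox_braid that in auto)
  ultimately show ?case using ij by (simp del: refl_word_simps)
qed simp_all

text \<open>The value of \<theta> at \<open>u\<close>, built from some word for \<open>u\<close>; by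
  the Coxeter presentation every word gives the same element.\<close>

definition refl_perm :: "nat \<Rightarrow> (nat \<Rightarrow> nat) \<Rightarrow> (nat list \<Rightarrow> complex) set" where
  "refl_perm n u = refl_word n (SOME js. js \<in> lists {1..<n} \<and> word_perm js = u)"

lemma refl_perm_word_perm:
  assumes "js \<in> lists {1..<n}"
  shows "refl_perm n (word_perm js) = refl_word n js"
proof -
  define ks where "ks = (SOME ks. ks \<in> lists {1..<n} \<and> word_perm ks = word_perm js)"
  have ks: "ks \<in> lists {1..<n} \<and> word_perm ks = word_perm js"
    unfolding ks_def by (rule someI[of _ js]) (use assms in simp)
  have "refl_word n ks = refl_word n js"
    using cox_eq_iff[of ks n js] ks assms by (intro cox_eq_refl_word) simp
  then show ?thesis
    unfolding refl_perm_def ks_def .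
qed

lemma refl_perm_id: "refl_perm n id = \<one>\<^bsub>TL n\<^esub>"
  using refl_perm_word_perm[of "[]" n] by simp

lemma refl_perm_closed: "u permutes {1..n} \<Longrightarrow> refl_perm n u \<in> carrier (TL n)"
  using reduced_word_exists[of u n] refl_perm_word_perm refl_word_closed by metis

lemma refl_perm_comp:
  assumes "u permutes {1..n}" "v permutes {1..n}"
  shows "refl_perm n (u \<circ> v) = refl_perm n u \<otimes>\<^bsub>TL n\<^esub> refl_perm n v"
proof -
  obtain js ks where w: "js \<in> lists {1..<n}" "u = word_perm js"
      "ks \<in> lists {1..<n}" "v = word_perm ks"
    using reduced_word_exists assms by metis
  have "refl_perm n (word_perm (js @ ks)) = refl_word n (js @ ks)"
    by (rule refl_perm_word_perm) (use w in simp)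
  then show ?thesis
    using w refl_perm_word_perm[of js n] refl_perm_word_perm[of ks n]
    by (simp only: word_perm_append refl_word_append)
qed

section \<open>Existence of the homomorphism and its values at permutations\<close>

lemma monoid_algebra_induct [consumes 1, case_names zero add]:
  assumes "f \<in> carrier (monoid_algebra M)"
    and zero: "P \<zero>\<^bsub>monoid_algebra M\<^esub>"
    and add: "\<And>f c x. \<lbrakk>f \<in> carrier (monoid_algebra M); x \<in> carrier M; P f\<rbrakk>
        \<Longrightarrow> P (c \<odot>\<^bsub>monoid_algebra M\<^esub> of_elem x \<oplus>\<^bsub>monoid_algebra M\<^esub> f)"
  shows "P f"
  using assms(1)
proof (induction "card (supp f)" arbitrary: f)
  case 0
  then have "f = (\<lambda>x. 0)" by (auto simp: monoid_algebra_simps)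
  then show ?case using zero by (simp add: monoid_algebra_simps)
next
  case (Suc k)
  then obtain x where x: "f x \<noteq> 0"
    by (metis (mono_tags, lifting) card.empty empty_Collect_eq nat.distinct(1))
  define g where "g = (\<lambda>y. if y = x then 0 else f y)"
  have supp: "supp g = supp f - {x}" by (auto simp: g_def)
  have "finite (supp f)" "x \<in> carrier M" using Suc.prems x by (auto simp: monoid_algebra_simps)
  then have "card (supp g) = k" "g \<in> carrier (monoid_algebra M)"
    using Suc x by (auto simp: supp monoid_algebra_simps)
  then have "P g" "g \<in> carrier (monoid_algebra M)" using Suc by auto
  moreover have "f = f x \<odot>\<^bsub>monoid_algebra M\<^esub> of_elem x \<oplus>\<^bsub>monoid_algebra M\<^esub> g"
    by (auto simp: monoid_algebra_simps of_elem_def g_def)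
  ultimately show ?case using add[of g x "f x"] \<open>x \<in> carrier M\<close> by simp
qed

lemma TL_finsum_smult:
  assumes "finite S" "h \<in> S \<rightarrow> carrier (TL n)"
  shows "finsum (TL n) (\<lambda>v. c \<odot>\<^bsub>TL n\<^esub> h v) S = c \<odot>\<^bsub>TL n\<^esub> finsum (TL n) h S"
proof -
  interpret ring "TL n" by (rule ring_TL)
  have zero: "c \<odot>\<^bsub>TL n\<^esub> \<zero>\<^bsub>TL n\<^esub> = \<zero>\<^bsub>TL n\<^esub>"
    using TL_smult_assoc[OF zero_closed, of c 0] TL_smult_zero[OF zero_closed] by simp
  show ?thesis using assms
    by (induction S) (auto simp: zero Pi_def TL_smult_simps TL_smult_closed)
qed

definition group_alg_hom ::
  "nat \<Rightarrow> ((nat \<Rightarrow> nat) \<Rightarrow> complex) \<Rightarrow> (nat list \<Rightarrow> complex) set" where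
  "group_alg_hom n f = finsum (TL n) (\<lambda>u. f u \<odot>\<^bsub>TL n\<^esub> refl_perm n u) (sym_set n)"

lemma finite_sym_set [simp]: "finite (sym_set n)"
  by (simp add: sym_group_def finite_permutations)

lemma sym_set_iff [simp]: "u \<in> sym_set n \<longleftrightarrow> u permutes {1..n}"
  by (rule sym_group_carrier)

text \<open>The witness for the choice in \<open>TL_theta\<close>. Multiplicativity is known for two
  permutations from \<open>refl_perm_comp\<close> and is extended linearly, in the right factor
  first and then in the left.\<close>

lemma group_alg_hom_in_algebra_hom:
  "group_alg_hom n \<in> algebra_hom (monoid_algebra (sym_group n)) (TL n)" (is "?h \<in> algebra_hom ?A _")
  and group_alg_hom_of_elem: "u permutes {1..n} \<Longrightarrow> group_alg_hom n (of_elem u) = refl_perm n u"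
proof -
  interpret ring "TL n" by (rule ring_TL)
  interpret S: group "sym_group n" by (rule sym_group_is_group)
  interpret A: ring ?A by (rule S.ring_monoid_algebra)
  have closed: "refl_perm n u \<in> carrier (TL n)" if "u \<in> sym_set n" for u
    using that by (simp add: refl_perm_closed)
  then have Pi: "(\<lambda>u. f u \<odot>\<^bsub>TL n\<^esub> refl_perm n u) \<in> sym_set n \<rightarrow> carrier (TL n)" for f
    by (auto intro: TL_smult_closed)
  have h_closed: "?h f \<in> carrier (TL n)" for f
    unfolding group_alg_hom_def by (rule finsum_closed[OF Pi])
  have h_add: "?h (f \<oplus>\<^bsub>?A\<^esub> g) = ?h f \<oplus>\<^bsub>TL n\<^esub> ?h g" for f g
  proof -
    have "?h (f \<oplus>\<^bsub>?A\<^esub> g) = finsum (TL n)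
        (\<lambda>u. f u \<odot>\<^bsub>TL n\<^esub> refl_perm n u \<oplus>\<^bsub>TL n\<^esub> g u \<odot>\<^bsub>TL n\<^esub> refl_perm n u) (sym_set n)"
      unfolding group_alg_hom_def
      by (rule finsum_cong')
        (use closed in \<open>simp_all add: monoid_algebra_simps TL_smult_simps TL_smult_closed\<close>)
    then show ?thesis unfolding group_alg_hom_def by (simp add: finsum_addf[OF Pi Pi])
  qed
  have h_smult: "?h (c \<odot>\<^bsub>?A\<^esub> f) = c \<odot>\<^bsub>TL n\<^esub> ?h f" for c f
  proof -
    have "?h (c \<odot>\<^bsub>?A\<^esub> f) = finsum (TL n)
        (\<lambda>u. c \<odot>\<^bsub>TL n\<^esub> (f u \<odot>\<^bsub>TL n\<^esub> refl_perm n u)) (sym_set n)"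
      unfolding group_alg_hom_def
      by (rule finsum_cong')
        (use closed in \<open>simp_all add: monoid_algebra_simps TL_smult_simps TL_smult_closed\<close>)
    then show ?thesis
      unfolding group_alg_hom_def using Pi by (simp add: TL_finsum_smult)
  qed
  have h_elem: "?h (of_elem u) = refl_perm n u" if u: "u \<in> sym_set n" for u
  proof -
    have "?h (of_elem u)
        = finsum (TL n) (\<lambda>v. if u = v then refl_perm n v else \<zero>\<^bsub>TL n\<^esub>) (sym_set n)"
      unfolding group_alg_hom_def
      by (rule finsum_cong') (use closed in \<open>auto simp: of_elem_def TL_smult_simps\<close>)
    also have "\<dots> = refl_perm n u"
      by (rule finsum_singleton) (use u closed in auto)
    finally show ?thesis .
  qed
  then show "u permutes {1..n} \<Longrightarrow> group_alg_hom n (of_elem u) = refl_perm n u" by simp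
  have h_zero: "?h \<zero>\<^bsub>?A\<^esub> = \<zero>\<^bsub>TL n\<^esub>"
    using h_smult[of 0 "\<zero>\<^bsub>?A\<^esub>"] TL_smult_zero[OF h_closed]
    by (simp add: monoid_algebra_simps)
  have h_mult_elem: "?h (of_elem u \<otimes>\<^bsub>?A\<^esub> g) = ?h (of_elem u) \<otimes>\<^bsub>TL n\<^esub> ?h g"
    if u: "u \<in> sym_set n" and g: "g \<in> carrier ?A" for u g
    using g
  proof (induction g rule: monoid_algebra_induct)
    case zero
    then show ?case using u h_closed by (simp add: h_zero of_elem_carrier)
  next
    case (add g c v)
    have "?h (of_elem u \<otimes>\<^bsub>?A\<^esub> of_elem v) = ?h (of_elem u) \<otimes>\<^bsub>TL n\<^esub> ?h (of_elem v)"
      using u add S.m_closed[OF u add(2)]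
      by (simp add: of_elem_mult h_elem refl_perm_comp sym_group_mult)
    then show ?case
      using u add h_closed of_elem_carrier[OF u] of_elem_carrier[OF add(2)]
      by (simp add: A.r_distr r_distr h_add h_smult TL_smult_mult monoid_algebra_smult_mult
          monoid_algebra_smult_closed TL_smult_closed)
  qed
  have h_mult: "?h (f \<otimes>\<^bsub>?A\<^esub> g) = ?h f \<otimes>\<^bsub>TL n\<^esub> ?h g"
    if f: "f \<in> carrier ?A" and g: "g \<in> carrier ?A" for f g
    using f
  proof (induction f rule: monoid_algebra_induct)
    case zero
    then show ?case using g h_closed by (simp add: h_zero)
  next
    case (add f c u)
    then show ?case
      using g h_closed of_elem_carrier[OF add(2)]
      by (simp add: A.l_distr l_distr h_add h_smult h_mult_elem TL_smult_mult
          monoid_algebra_smult_mult monoid_algebra_smult_closed TL_smult_closed)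
  qed
  have "?h \<one>\<^bsub>?A\<^esub> = \<one>\<^bsub>TL n\<^esub>"
    using h_elem[OF S.one_closed] unfolding monoid_algebra_simps
    by (simp add: sym_group_one refl_perm_id)
  then have "?h \<in> ring_hom ?A (TL n)"
    by (intro ring_hom_memI) (simp_all add: h_closed h_mult h_add)
  then show "?h \<in> algebra_hom ?A (TL n)"
    unfolding algebra_hom_def using h_smult by simp
qed

lemma refl_perm_adj_swap: "i \<in> {1..<n} \<Longrightarrow> refl_perm n (adj_swap i) = TL_refl n i"
proof -
  interpret ring "TL n" by (rule ring_TL)
  assume i: "i \<in> {1..<n}"
  then have "refl_perm n (word_perm [i]) = refl_word n [i]"
    by (intro refl_perm_word_perm) simp
  then show ?thesis using TL_refl_closed[OF i] by simp
qed

text \<open>Whichever homomorphism is chosen, its values at the adjacent transpositions are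
  prescribed, and every permutation is a product of these.\<close>

lemma TL_theta_of_elem:
  assumes "u permutes {1..n}"
  shows "TL_theta n (of_elem u) = refl_perm n u"
proof -
  interpret ring "TL n" by (rule ring_TL)
  let ?A = "monoid_algebra (sym_group n)"
  define h where "h = TL_theta n"
  have "h \<in> algebra_hom ?A (TL n) \<and>
     (\<forall>i\<in>{1..<n}. h (of_elem (adj_swap i)) = TL_gen n i \<ominus>\<^bsub>TL n\<^esub> \<one>\<^bsub>TL n\<^esub>)"
    unfolding h_def TL_theta_def
  proof (rule someI[of _ "group_alg_hom n"], intro conjI ballI)
    fix i assume "i \<in> {1..<n}"
    then show "group_alg_hom n (of_elem (adj_swap i)) = TL_gen n i \<ominus>\<^bsub>TL n\<^esub> \<one>\<^bsub>TL n\<^esub>"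
      using group_alg_hom_of_elem[OF adj_swap_permutes] refl_perm_adj_swap by (simp add: TL_refl_def)
  qed (rule group_alg_hom_in_algebra_hom)
  then have hom: "h \<in> ring_hom ?A (TL n)"
    and gen: "\<And>i. i \<in> {1..<n} \<Longrightarrow> h (of_elem (adj_swap i)) = TL_refl n i"
    by (auto simp: algebra_hom_def TL_refl_def)
  have word: "h (of_elem (word_perm js)) = refl_word n js" if "js \<in> lists {1..<n}" for js
    using that
  proof (induction js)
    case Nil
    have "\<one>\<^bsub>?A\<^esub> = of_elem id" by (simp add: monoid_algebra_simps sym_group_one)
    then show ?case using ring_hom_one[OF hom] by (simp only: word_perm_simps refl_word_simps)
  next
    case (Cons i js)
    then have i: "i \<in> {1..<n}" and js: "js \<in> lists {1..<n}" by simp_all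
    have "of_elem (word_perm (i # js)) = of_elem (adj_swap i) \<otimes>\<^bsub>?A\<^esub> of_elem (word_perm js)"
      by (simp only: of_elem_mult sym_group_mult word_perm_simps)
    moreover have "of_elem (adj_swap i) \<in> carrier ?A" "of_elem (word_perm js) \<in> carrier ?A"
      using adj_swap_permutes[OF i] word_perm_permutes[OF js]
      by (auto intro!: of_elem_carrier)
    ultimately show ?case
      using ring_hom_mult[OF hom] gen[OF i] Cons.IH by (simp only: refl_word_simps)
  qed
  obtain js where "js \<in> lists {1..<n}" "word_perm js = u"
    using reduced_word_exists[OF assms] by blast
  then show ?thesis using word[of js] refl_perm_word_perm[of js n] by (simp add: h_def)
qed


section \<open>Spanning by the 321-avoiding permutations\<close>

text \<open>An inductive span lets closure properties be proved by rule induction;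
  \<open>TL_span_finsum\<close> recovers explicit coefficients where they are wanted.\<close>

inductive_set TL_span :: "nat \<Rightarrow> (nat list \<Rightarrow> complex) set set \<Rightarrow> (nat list \<Rightarrow> complex) set set"
  for n S where
  zero: "\<zero>\<^bsub>TL n\<^esub> \<in> TL_span n S"
| base: "X \<in> S \<Longrightarrow> X \<in> TL_span n S"
| add: "X \<in> TL_span n S \<Longrightarrow> Y \<in> TL_span n S \<Longrightarrow> X \<oplus>\<^bsub>TL n\<^esub> Y \<in> TL_span n S"
| smult: "X \<in> TL_span n S \<Longrightarrow> c \<odot>\<^bsub>TL n\<^esub> X \<in> TL_span n S"

lemma TL_span_closed: "S \<subseteq> carrier (TL n) \<Longrightarrow> X \<in> TL_span n S \<Longrightarrow> X \<in> carrier (TL n)"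
proof -
  interpret ring "TL n" by (rule ring_TL)
  show "S \<subseteq> carrier (TL n) \<Longrightarrow> X \<in> TL_span n S \<Longrightarrow> X \<in> carrier (TL n)"
    by (rotate_tac, induction rule: TL_span.induct) (auto intro: TL_smult_closed)
qed

lemma TL_span_trans:
  "\<lbrakk>X \<in> TL_span n S; \<And>Y. Y \<in> S \<Longrightarrow> Y \<in> TL_span n S'\<rbrakk> \<Longrightarrow> X \<in> TL_span n S'"
  by (induction rule: TL_span.induct) (auto intro: TL_span.intros)

lemma TL_minus_eq_smult:
  assumes X: "X \<in> carrier (TL n)"
  shows "\<ominus>\<^bsub>TL n\<^esub> X = (- 1) \<odot>\<^bsub>TL n\<^esub> X"
proof -
  interpret ring "TL n" by (rule ring_TL)
  have "(- 1 + 1) \<odot>\<^bsub>TL n\<^esub> X = (- 1) \<odot>\<^bsub>TL n\<^esub> X \<oplus>\<^bsub>TL n\<^esub> 1 \<odot>\<^bsub>TL n\<^esub> X"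
    using X by (rule TL_smult_l_distr)
  then show ?thesis
    using X by (intro minus_equality) (simp_all add: TL_smult_simps X TL_smult_closed)
qed

lemma TL_span_minus:
  assumes "S \<subseteq> carrier (TL n)" "X \<in> TL_span n S" "Y \<in> TL_span n S"
  shows "X \<ominus>\<^bsub>TL n\<^esub> Y \<in> TL_span n S" "\<ominus>\<^bsub>TL n\<^esub> Y \<in> TL_span n S"
  unfolding a_minus_def
  using assms by (auto simp: TL_minus_eq_smult TL_span_closed intro: TL_span.intros)

lemma TL_span_mult_right:
  assumes "S \<subseteq> carrier (TL n)" "Z \<in> carrier (TL n)" "\<And>Y. Y \<in> S \<Longrightarrow> Y \<otimes>\<^bsub>TL n\<^esub> Z \<in> TL_span n S'"
  shows "X \<in> TL_span n S \<Longrightarrow> X \<otimes>\<^bsub>TL n\<^esub> Z \<in> TL_span n S'"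
proof (induction rule: TL_span.induct)
  interpret ring "TL n" by (rule ring_TL)
  case zero then show ?case using assms by (simp add: TL_span.zero)
next
  interpret ring "TL n" by (rule ring_TL)
  case (add X Y)
  then show ?case using assms by (simp add: l_distr TL_span_closed TL_span.add)
next
  case (smult X c)
  then show ?case using assms by (simp add: TL_smult_mult TL_span_closed TL_span.smult)
qed (use assms in auto)

lemma TL_span_mult_left:
  assumes "S \<subseteq> carrier (TL n)" "Z \<in> carrier (TL n)" "\<And>Y. Y \<in> S \<Longrightarrow> Z \<otimes>\<^bsub>TL n\<^esub> Y \<in> TL_span n S'"
  shows "X \<in> TL_span n S \<Longrightarrow> Z \<otimes>\<^bsub>TL n\<^esub> X \<in> TL_span n S'"
proof (induction rule: TL_span.induct)
  interpret ring "TL n" by (rule ring_TL)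
  case zero then show ?case using assms by (simp add: TL_span.zero)
next
  interpret ring "TL n" by (rule ring_TL)
  case (add X Y)
  then show ?case using assms by (simp add: r_distr TL_span_closed TL_span.add)
next
  case (smult X c)
  then show ?case using assms by (simp add: TL_smult_mult TL_span_closed TL_span.smult)
qed (use assms in auto)

text \<open>Supplies the existence of an expansion, and so gives meaning to the choice in
  \<open>TL_coords\<close>. Coefficients are indexed by \<open>A\<close> and not by the image, which
  avoids any question of injectivity of \<open>g\<close>.\<close>

lemma TL_span_finsum:
  assumes "finite A" "\<And>v. v \<in> A \<Longrightarrow> g v \<in> carrier (TL n)"
  shows "X \<in> TL_span n (g ` A) \<Longrightarrow> \<exists>f. X = (\<Oplus>\<^bsub>TL n\<^esub>v\<in>A. f v \<odot>\<^bsub>TL n\<^esub> g v)"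
proof (induction rule: TL_span.induct)
  interpret ring "TL n" by (rule ring_TL)
  case zero
  have "(\<Oplus>\<^bsub>TL n\<^esub>v\<in>A. 0 \<odot>\<^bsub>TL n\<^esub> g v) = \<zero>\<^bsub>TL n\<^esub>"
    by (rule add.finprod_one_eqI) (use assms in \<open>auto simp: TL_smult_simps\<close>)
  then show ?case by (intro exI[of _ "\<lambda>_. 0"]) simp
next
  interpret ring "TL n" by (rule ring_TL)
  case (base X)
  then obtain w where w: "w \<in> A" "X = g w" by auto
  have "(\<Oplus>\<^bsub>TL n\<^esub>v\<in>A. (if w = v then 1 else 0) \<odot>\<^bsub>TL n\<^esub> g v)
      = (\<Oplus>\<^bsub>TL n\<^esub>v\<in>A. if w = v then g v else \<zero>\<^bsub>TL n\<^esub>)"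
    by (rule finsum_cong') (use assms in \<open>auto simp: TL_smult_simps\<close>)
  also have "\<dots> = g w" by (rule finsum_singleton) (use w assms in auto)
  finally show ?case using w by (intro exI[of _ "\<lambda>v. if w = v then 1 else 0"]) simp
next
  interpret ring "TL n" by (rule ring_TL)
  case (add X Y)
  then obtain f h where fh: "X = (\<Oplus>\<^bsub>TL n\<^esub>v\<in>A. f v \<odot>\<^bsub>TL n\<^esub> g v)" "Y = (\<Oplus>\<^bsub>TL n\<^esub>v\<in>A. h v \<odot>\<^bsub>TL n\<^esub> g v)"
    by blast
  have "(\<Oplus>\<^bsub>TL n\<^esub>v\<in>A. (f v + h v) \<odot>\<^bsub>TL n\<^esub> g v)
      = (\<Oplus>\<^bsub>TL n\<^esub>v\<in>A. f v \<odot>\<^bsub>TL n\<^esub> g v \<oplus>\<^bsub>TL n\<^esub> h v \<odot>\<^bsub>TL n\<^esub> g v)"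
    by (rule finsum_cong') (use assms in \<open>simp_all add: TL_smult_simps TL_smult_closed\<close>)
  also have "\<dots> = X \<oplus>\<^bsub>TL n\<^esub> Y"
    unfolding fh by (rule finsum_addf) (use assms TL_smult_closed in auto)
  finally show ?case by (intro exI[of _ "\<lambda>v. f v + h v"]) simp
next
  interpret ring "TL n" by (rule ring_TL)
  case (smult X c)
  then obtain f where f: "X = (\<Oplus>\<^bsub>TL n\<^esub>v\<in>A. f v \<odot>\<^bsub>TL n\<^esub> g v)" by blast
  have "(\<Oplus>\<^bsub>TL n\<^esub>v\<in>A. (c * f v) \<odot>\<^bsub>TL n\<^esub> g v) = (\<Oplus>\<^bsub>TL n\<^esub>v\<in>A. c \<odot>\<^bsub>TL n\<^esub> (f v \<odot>\<^bsub>TL n\<^esub> g v))"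
    by (rule finsum_cong') (use assms in \<open>simp_all add: TL_smult_simps TL_smult_closed\<close>)
  also have "\<dots> = c \<odot>\<^bsub>TL n\<^esub> X"
    unfolding f by (rule TL_finsum_smult) (use assms TL_smult_closed in auto)
  finally show ?case by (intro exI[of _ "\<lambda>v. c * f v"]) simp
qed

text \<open>Spans of these sets filter the algebra by word length; leading-term arguments work
  modulo this filtration.\<close>

definition short_refl :: "nat \<Rightarrow> nat \<Rightarrow> (nat list \<Rightarrow> complex) set set" where
  "short_refl n k = refl_word n ` {js \<in> lists {1..<n}. length js < k}"

lemma short_refl_closed: "short_refl n k \<subseteq> carrier (TL n)"
  unfolding short_refl_def using refl_word_closed by blast

lemma short_reflI: "js \<in> lists {1..<n} \<Longrightarrow> length js < k \<Longrightarrow> refl_word n js \<in> TL_span n (short_refl n k)"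
  by (rule TL_span.base) (simp add: short_refl_def)

lemma short_refl_mult_right:
  assumes X: "X \<in> TL_span n (short_refl n k)" and i: "i \<in> {1..<n}"
  shows "X \<otimes>\<^bsub>TL n\<^esub> TL_refl n i \<in> TL_span n (short_refl n (Suc k))"
proof (rule TL_span_mult_right[OF short_refl_closed TL_refl_closed[OF i] _ X])
  interpret ring "TL n" by (rule ring_TL)
  fix Y assume "Y \<in> short_refl n k"
  then obtain js where js: "js \<in> lists {1..<n}" "length js < k" "Y = refl_word n js"
    by (auto simp: short_refl_def)
  then have "Y \<otimes>\<^bsub>TL n\<^esub> TL_refl n i = refl_word n (js @ [i])"
    using TL_refl_closed[OF i] i by (subst refl_word_append) auto
  moreover have "js @ [i] \<in> lists {1..<n}" "length (js @ [i]) < Suc k" using js i by auto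
  ultimately show "Y \<otimes>\<^bsub>TL n\<^esub> TL_refl n i \<in> TL_span n (short_refl n (Suc k))"
    using short_reflI by metis
qed

lemma short_refl_mult_left:
  assumes X: "X \<in> TL_span n (short_refl n k)" and js: "js \<in> lists {1..<n}"
  shows "refl_word n js \<otimes>\<^bsub>TL n\<^esub> X \<in> TL_span n (short_refl n (length js + k))"
proof (rule TL_span_mult_left[OF short_refl_closed refl_word_closed[OF js] _ X])
  fix Y assume "Y \<in> short_refl n k"
  then obtain ks where ks: "ks \<in> lists {1..<n}" "length ks < k" "Y = refl_word n ks"
    by (auto simp: short_refl_def)
  then have "refl_word n js \<otimes>\<^bsub>TL n\<^esub> Y = refl_word n (js @ ks)"
    using js by (simp add: refl_word_append)
  moreover have "js @ ks \<in> lists {1..<n}" "length (js @ ks) < length js + k" using js ks by auto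
  ultimately show "refl_word n js \<otimes>\<^bsub>TL n\<^esub> Y \<in> TL_span n (short_refl n (length js + k))"
    using short_reflI by metis
qed

lemma short_refl_mono:
  "k \<le> l \<Longrightarrow> X \<in> TL_span n (short_refl n k) \<Longrightarrow> X \<in> TL_span n (short_refl n l)"
  by (erule TL_span_trans) (auto simp: short_refl_def intro!: TL_span.base)

text \<open>The signless sum over the copy of \<open>S\<^sub>3\<close> generated by two adjacent letters vanishes in the
  Temperley-Lieb algebra, so its longest element can be traded for shorter ones.\<close>

lemma refl_word_braid_short:
  assumes i: "i \<in> {1..<n}" and j: "j \<in> {1..<n}" and ij: "\<bar>int i - int j\<bar> = 1"
  shows "refl_word n [i, j, i] \<in> TL_span n (short_refl n 3)"
proof -
  interpret ring "TL n" by (rule ring_TL)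
  note car = TL_gen_closed[OF i] TL_gen_closed[OF j]
  let ?s = "refl_word n [] \<oplus>\<^bsub>TL n\<^esub> refl_word n [i] \<oplus>\<^bsub>TL n\<^esub> refl_word n [j]
      \<oplus>\<^bsub>TL n\<^esub> refl_word n [i, j] \<oplus>\<^bsub>TL n\<^esub> refl_word n [j, i]"
  have words: "refl_word n [i] = TL_gen n i \<ominus>\<^bsub>TL n\<^esub> \<one>\<^bsub>TL n\<^esub>"
      "refl_word n [j] = TL_gen n j \<ominus>\<^bsub>TL n\<^esub> \<one>\<^bsub>TL n\<^esub>"
      "refl_word n [i, j] = (TL_gen n i \<ominus>\<^bsub>TL n\<^esub> \<one>\<^bsub>TL n\<^esub>) \<otimes>\<^bsub>TL n\<^esub> (TL_gen n j \<ominus>\<^bsub>TL n\<^esub> \<one>\<^bsub>TL n\<^esub>)"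
      "refl_word n [j, i] = (TL_gen n j \<ominus>\<^bsub>TL n\<^esub> \<one>\<^bsub>TL n\<^esub>) \<otimes>\<^bsub>TL n\<^esub> (TL_gen n i \<ominus>\<^bsub>TL n\<^esub> \<one>\<^bsub>TL n\<^esub>)"
      "refl_word n [] = \<one>\<^bsub>TL n\<^esub>"
    using TL_refl_closed[OF i] TL_refl_closed[OF j] by (simp_all add: TL_refl_def)
  have "refl_word n [i, j, i] = \<ominus>\<^bsub>TL n\<^esub> ?s"
    using car unfolding refl_word_braid_expansion[OF i j ij] words by (algebra; simp add: r_one a_ac)
  moreover have "?s \<in> TL_span n (short_refl n 3)"
    by (intro TL_span.add short_reflI) (use i j in auto)
  ultimately show ?thesis
    using TL_span_minus(2)[OF short_refl_closed] by simp
qed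

text \<open>Induction on the width \<open>k - i\<close> of the pattern. If there is a gap next to
  \<open>i\<close> or \<open>k\<close>, the neighbouring position either gives a narrower pattern in
  \<open>u\<close> itself, or forms a descent with the end of the pattern; removing that descent
  carries the end inwards, and one letter is multiplied back afterwards. For three consecutive
  positions \<open>u\<close> ends in the longest element of a copy of \<open>S_3\<close>, to which
  \<open>refl_word_braid_short\<close> applies.\<close>

lemma pattern_321_short:
  assumes "u permutes {1..n}" "i \<in> {1..n}" "k \<in> {1..n}" "i < j" "j < k" "u i > u j" "u j > u k"
  shows "refl_perm n u \<in> TL_span n (short_refl n (ninv n u))"
  using assms
proof (induction "k - i" arbitrary: u i j k rule: less_induct)
  case less
  note u = less.prems(1)
  have via_descent: "refl_perm n u \<in> TL_span n (short_refl n (ninv n u))"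
    if p: "p \<in> {1..<n}" "u p > u (Suc p)"
      and IH: "refl_perm n (u \<circ> adj_swap p) \<in> TL_span n (short_refl n (ninv n (u \<circ> adj_swap p)))"
    for p
  proof -
    have "refl_perm n u = refl_perm n ((u \<circ> adj_swap p) \<circ> adj_swap p)" by simp
    also have "\<dots> = refl_perm n (u \<circ> adj_swap p) \<otimes>\<^bsub>TL n\<^esub> TL_refl n p"
      using refl_perm_comp[OF permutes_adj_swap[OF u p(1)] adj_swap_permutes[OF p(1)]]
        refl_perm_adj_swap[OF p(1)] by (simp only:)
    finally show ?thesis
      using short_refl_mult_right[OF IH p(1)] ninv_descent[OF u p] by simp
  qed
  consider "Suc i < j" | "Suc j < k" | "j = Suc i" "k = Suc (Suc i)" using less.prems by linarith
  then show ?case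
  proof cases
    case 1
    have i: "i \<in> {1..<n}" using less.prems by auto
    show ?thesis
    proof (cases "u (Suc i) > u j")
      case True
      then show ?thesis
        using less.prems 1 by (intro less.hyps[of k "Suc i" u j]) auto
    next
      case False
      then have gt: "u (Suc i) < u i" using less.prems by auto
      show ?thesis
        using less.prems 1
        by (intro via_descent[OF i gt] less.hyps[of k "Suc i" _ j] permutes_adj_swap[OF u i]) auto
    qed
  next
    case 2
    then obtain k' where k: "k = Suc k'" by (cases k) auto
    have k': "k' \<in> {1..<n}" using less.prems 2 k by auto
    show ?thesis
    proof (cases "u k' < u j")
      case True
      then show ?thesis
        using less.prems 2 k by (intro less.hyps[of k' i u j]) auto
    next
      case False
      then have gt: "u (Suc k') < u k'" using less.prems k by auto
      show ?thesis
        using less.prems 2 k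
        by (intro via_descent[OF k' gt] less.hyps[of k' i _ j] permutes_adj_swap[OF u k']) auto
    qed
  next
    case 3
    have p: "i \<in> {1..<n}" "Suc i \<in> {1..<n}" using less.prems 3 by auto
    define v1 where "v1 = u \<circ> adj_swap i"
    define v2 where "v2 = v1 \<circ> adj_swap (Suc i)"
    define v3 where "v3 = v2 \<circ> adj_swap i"
    have v1: "v1 permutes {1..n}" unfolding v1_def by (rule permutes_adj_swap[OF u p(1)])
    have v2: "v2 permutes {1..n}" unfolding v2_def by (rule permutes_adj_swap[OF v1 p(2)])
    have v3: "v3 permutes {1..n}" unfolding v3_def by (rule permutes_adj_swap[OF v2 p(1)])
    have "ninv n u = Suc (ninv n v1)"
      unfolding v1_def by (rule ninv_descent[OF u p(1)]) (use less.prems 3 in auto)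
    moreover have "ninv n v1 = Suc (ninv n v2)"
      unfolding v2_def by (rule ninv_descent[OF v1 p(2)]) (use less.prems 3 in \<open>auto simp: v1_def\<close>)
    moreover have "ninv n v2 = Suc (ninv n v3)"
      unfolding v3_def
      by (rule ninv_descent[OF v2 p(1)]) (use less.prems 3 in \<open>auto simp: v1_def v2_def\<close>)
    ultimately have ninv: "ninv n u = ninv n v3 + 3" by simp
    obtain js where js: "js \<in> lists {1..<n}" "word_perm js = v3" "length js = ninv n v3"
      using reduced_word_exists[OF v3] by blast
    have "u = word_perm (js @ [i, Suc i, i])"
      by (simp add: js v1_def v2_def v3_def fun_eq_iff)
    then have "refl_perm n u = refl_word n js \<otimes>\<^bsub>TL n\<^esub> refl_word n [i, Suc i, i]"
      using p js refl_perm_word_perm[of "js @ [i, Suc i, i]" n]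
        refl_word_append[of js n "[i, Suc i, i]"] by simp
    also have "\<dots> \<in> TL_span n (short_refl n (length js + 3))"
      by (rule short_refl_mult_left[OF refl_word_braid_short[OF p] js(1)]) simp
    finally show ?thesis using ninv js by simp
  qed
qed

text \<open>Each generator is its reflection plus one, so the product of the reflections is the
  leading term and only proper subwords remain.\<close>

lemma TL_word_minus_refl_word:
  "js \<in> lists {1..<n} \<Longrightarrow> TL_word n js \<ominus>\<^bsub>TL n\<^esub> refl_word n js \<in> TL_span n (short_refl n (length js))"
proof (induction js)
  interpret ring "TL n" by (rule ring_TL)
  case Nil
  have "\<one>\<^bsub>TL n\<^esub> \<ominus>\<^bsub>TL n\<^esub> \<one>\<^bsub>TL n\<^esub> = \<zero>\<^bsub>TL n\<^esub>" by algebra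
  then show ?case by (simp add: TL_span.zero)
next
  interpret ring "TL n" by (rule ring_TL)
  case (Cons i js)
  then have i: "i \<in> {1..<n}" and js: "js \<in> lists {1..<n}" by auto
  let ?T = "TL_word n js" and ?R = "refl_word n js" and ?g = "TL_gen n i"
  note car = TL_word_closed[OF js] refl_word_closed[OF js] TL_gen_closed[OF i]
  have IH: "?T \<ominus>\<^bsub>TL n\<^esub> ?R \<in> TL_span n (short_refl n (length js))" using Cons.IH js by blast
  have "TL_word n (i # js) \<ominus>\<^bsub>TL n\<^esub> refl_word n (i # js) =
      (?g \<ominus>\<^bsub>TL n\<^esub> \<one>\<^bsub>TL n\<^esub>) \<otimes>\<^bsub>TL n\<^esub> (?T \<ominus>\<^bsub>TL n\<^esub> ?R) \<oplus>\<^bsub>TL n\<^esub> ((?T \<ominus>\<^bsub>TL n\<^esub> ?R) \<oplus>\<^bsub>TL n\<^esub> ?R)"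
    using car unfolding TL_word_simps refl_word_simps TL_refl_def by (algebra; simp)
  also have "?g \<ominus>\<^bsub>TL n\<^esub> \<one>\<^bsub>TL n\<^esub> = refl_word n [i]"
    using TL_refl_closed[OF i] by (simp add: TL_refl_def)
  finally have eq: "TL_word n (i # js) \<ominus>\<^bsub>TL n\<^esub> refl_word n (i # js) =
      refl_word n [i] \<otimes>\<^bsub>TL n\<^esub> (?T \<ominus>\<^bsub>TL n\<^esub> ?R) \<oplus>\<^bsub>TL n\<^esub> ((?T \<ominus>\<^bsub>TL n\<^esub> ?R) \<oplus>\<^bsub>TL n\<^esub> ?R)" .
  have "refl_word n [i] \<otimes>\<^bsub>TL n\<^esub> (?T \<ominus>\<^bsub>TL n\<^esub> ?R) \<in> TL_span n (short_refl n (length [i] + length js))"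
    by (rule short_refl_mult_left[OF IH]) (use i in simp)
  moreover have "?T \<ominus>\<^bsub>TL n\<^esub> ?R \<in> TL_span n (short_refl n (length (i # js)))"
    by (rule short_refl_mono[OF _ IH]) simp
  moreover have "?R \<in> TL_span n (short_refl n (length (i # js)))"
    by (rule short_reflI[OF js]) simp
  ultimately show ?case unfolding eq by (simp add: TL_span.add)
qed

section \<open>Basis elements and their reduced words\<close>

lemma TL_beta_eq_word:
  assumes "v permutes {1..n}"
  obtains js where "js \<in> lists {1..<n}" "word_perm js = v" "length js = ninv n v"
    "TL_beta n v = TL_word n js"
proof -
  have "\<exists>js. reduced_word n v js"
    using reduced_word_exists[OF assms] reduced_word_iff[OF assms] by blast
  moreover define js where "js = (SOME js. reduced_word n v js)"
  ultimately have "reduced_word n v js" by (simp only: js_def someI_ex)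
  then show ?thesis
    using that[of js] reduced_word_iff[OF assms, of js] by (simp add: TL_beta_def TL_word_def js_def)
qed

lemma TL_beta_closed: "v permutes {1..n} \<Longrightarrow> TL_beta n v \<in> carrier (TL n)"
  using TL_beta_eq_word TL_word_closed by metis

text \<open>A reduced word of an avoiding permutation gives its basis element up to shorter terms, and a
  \<open>321\<close> pattern can be rewritten by shorter terms, so induction on the number of inversions
  applies.\<close>

lemma refl_perm_in_span:
  "u permutes {1..n} \<Longrightarrow> refl_perm n u \<in> TL_span n (TL_beta n ` avoiders_321 n)"
proof (induction "ninv n u" arbitrary: u rule: less_induct)
  case less
  note u = less.prems
  let ?B = "TL_beta n ` avoiders_321 n"
  have B: "?B \<subseteq> carrier (TL n)" by (auto simp: avoiders_321_def intro: TL_beta_closed)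
  have short: "X \<in> TL_span n ?B" if "X \<in> TL_span n (short_refl n (ninv n u))" for X
  proof (rule TL_span_trans[OF that])
    fix Y assume "Y \<in> short_refl n (ninv n u)"
    then obtain js where js: "js \<in> lists {1..<n}" "length js < ninv n u" "Y = refl_word n js"
      by (auto simp: short_refl_def)
    then have "refl_perm n (word_perm js) \<in> TL_span n ?B"
      using ninv_word_perm_le[OF js(1)] by (intro less.hyps word_perm_permutes) auto
    then show "Y \<in> TL_span n ?B" using js refl_perm_word_perm by simp
  qed
  show ?case
  proof (cases "avoids_321 n u")
    case False
    then obtain i j k where "i \<in> {1..n}" "k \<in> {1..n}" "i < j" "j < k" "u i > u j" "u j > u k"
      unfolding avoids_321_def by blast
    then show ?thesis using pattern_321_short[OF u] by (intro short) blast
  next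
    case True
    interpret ring "TL n" by (rule ring_TL)
    obtain js where js: "js \<in> lists {1..<n}" "word_perm js = u" "length js = ninv n u"
        "TL_beta n u = TL_word n js"
      using TL_beta_eq_word[OF u] by blast
    have 1: "TL_word n js \<ominus>\<^bsub>TL n\<^esub> refl_word n js \<in> TL_span n ?B"
      using TL_word_minus_refl_word[OF js(1)] js(3) by (intro short) simp
    have 2: "TL_word n js \<in> TL_span n ?B"
      using js True u by (intro TL_span.base) (auto simp: avoiders_321_def intro!: image_eqI[of _ _ u])
    have "refl_word n js = TL_word n js \<ominus>\<^bsub>TL n\<^esub> (TL_word n js \<ominus>\<^bsub>TL n\<^esub> refl_word n js)"
      using TL_word_closed[OF js(1)] refl_word_closed[OF js(1)] by algebra
    then show ?thesis
      using TL_span_minus(1)[OF B 2 1] refl_perm_word_perm[OF js(1)] js(2) by simp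
  qed
qed

text \<open>Two last letters of reduced words of the same avoiding permutation are equal or commute,
  because adjacent descents would form a \<open>321\<close> pattern.\<close>

lemma reduced_words_TL_word:
  assumes "v permutes {1..n}" "avoids_321 n v"
    and "js \<in> lists {1..<n}" "word_perm js = v" "length js = ninv n v"
    and "ks \<in> lists {1..<n}" "word_perm ks = v" "length ks = ninv n v"
  shows "TL_word n js = TL_word n ks"
  using assms
proof (induction "ninv n v" arbitrary: v js ks rule: less_induct)
  case less
  note v = less.prems(1) and av = less.prems(2)
  note js = less.prems(3-5) and ks = less.prems(6-8)
  show ?case
  proof (cases js rule: rev_cases)
    case Nil
    then show ?thesis using js ks by simp
  next
    case js': (snoc js' i)
    then obtain ks' j where ks': "ks = ks' @ [j]" using js ks by (cases ks rule: rev_cases) auto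
    \<comment> \<open>The last letter of a shortest word is a descent: at an ascent the rest of the
      word would have to produce more inversions than it has letters.\<close>
    have descent: "p \<in> {1..<n} \<and> v (Suc p) < v p \<and> word_perm ls = v \<circ> adj_swap p
        \<and> length ls = ninv n (v \<circ> adj_swap p) \<and> ninv n (v \<circ> adj_swap p) < ninv n v"
      if "ls @ [p] \<in> lists {1..<n}" "word_perm (ls @ [p]) = v" "length (ls @ [p]) = ninv n v" for ls p
    proof -
      have p: "p \<in> {1..<n}" and ls: "ls \<in> lists {1..<n}" using that by auto
      have "v = word_perm ls \<circ> adj_swap p" using that(2) by simp
      then have eq: "word_perm ls = v \<circ> adj_swap p" by (simp only: comp_adj_swap_twice)
      have le: "ninv n (v \<circ> adj_swap p) \<le> length ls" using ninv_word_perm_le[OF ls] eq by simp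
      have "\<not> v p < v (Suc p)" using ninv_ascent[OF v p] le that(3) by auto
      then have "v (Suc p) < v p" using ascent_or_descent[OF v, of p] by auto
      then show ?thesis using ninv_descent[OF v p] that(3) eq p by auto
    qed
    note di = descent[of js' i, folded js', OF js] and dj = descent[of ks' j, folded ks', OF ks]
    have i: "i \<in> {1..<n}" and j: "j \<in> {1..<n}" using di dj by auto
    have lists: "js' \<in> lists {1..<n}" "ks' \<in> lists {1..<n}" using js ks js' ks' by auto
    have same: "TL_word n js1 = TL_word n ks1"
      if "p \<in> {1..<n}" "v (Suc p) < v p" "js1 \<in> lists {1..<n}" "ks1 \<in> lists {1..<n}"
        "word_perm js1 = v \<circ> adj_swap p" "length js1 = ninv n (v \<circ> adj_swap p)"
        "word_perm ks1 = v \<circ> adj_swap p" "length ks1 = ninv n (v \<circ> adj_swap p)" for p js1 ks1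
      using that ninv_descent[OF v that(1,2)]
      by (intro less.hyps[of "v \<circ> adj_swap p"] permutes_adj_swap[OF v] avoids_321_remove_descent[OF av])
        auto
    consider "i = j" | "\<bar>int i - int j\<bar> = 1" | "\<bar>int i - int j\<bar> \<ge> 2" by linarith
    then show ?thesis
    proof cases
      case 1
      have "TL_word n js' = TL_word n ks'" using di dj lists 1 by (intro same[of i]) auto
      then show ?thesis using js' ks' 1 lists i by (simp add: TL_word_append)
    next
      case 2
      then have "j = Suc i \<or> i = Suc j" by auto
      then have "\<exists>p. p \<in> {1..n} \<and> Suc (Suc p) \<in> {1..n} \<and> v p > v (Suc p) \<and> v (Suc p) > v (Suc (Suc p))"
        using di dj by (intro exI[of _ "min i j"]) auto
      then show ?thesis using av unfolding avoids_321_def by force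
    next
      case 3
      \<comment> \<open>Removing both commuting descents gives \<open>x\<close>. Over a common word
        \<open>ms\<close> for \<open>x\<close>, the words ending in \<open>j, i\<close> and in
        \<open>i, j\<close> are both reduced for \<open>v\<close>; after deleting the last letter,
        the induction hypothesis links each to one of the given words.\<close>
      define x where "x = v \<circ> adj_swap i \<circ> adj_swap j"
      have comm: "v \<circ> adj_swap j \<circ> adj_swap i = x"
        using 3 by (auto simp: x_def fun_eq_iff adj_swap_eq)
      have vi: "v \<circ> adj_swap i permutes {1..n}" by (rule permutes_adj_swap[OF v i])
      have x: "x permutes {1..n}" unfolding x_def by (rule permutes_adj_swap[OF vi j])
      have ninv: "ninv n (v \<circ> adj_swap i) = Suc (ninv n x)"
        unfolding x_def by (rule ninv_descent[OF vi j]) (use dj 3 in \<open>auto simp: adj_swap_eq\<close>)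
      have ninv': "ninv n (v \<circ> adj_swap j) = Suc (ninv n x)"
        using ninv di dj ninv_descent[OF v i] ninv_descent[OF v j] by auto
      obtain ms where ms: "ms \<in> lists {1..<n}" "word_perm ms = x" "length ms = ninv n x"
        using reduced_word_exists[OF x] by blast
      have "TL_word n js' = TL_word n (ms @ [j])"
        using di lists ms j ninv by (intro same[of i]) (auto simp: x_def fun_eq_iff)
      moreover have "TL_word n ks' = TL_word n (ms @ [i])"
        using dj lists ms i ninv' by (intro same[of j]) (auto simp: fun_eq_iff comm[symmetric])
      ultimately have "TL_word n js = TL_word n (ms @ [j, i])" "TL_word n ks = TL_word n (ms @ [i, j])"
        using lists ms i j js' ks' TL_word_append[of "ms @ [j]" n "[i]"]
          TL_word_append[of "ms @ [i]" n "[j]"] by (simp_all add: TL_word_append del: TL_word_simps)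
      then show ?thesis
        using TL_word_commute[OF i j 3] ms i j by (simp add: TL_word_append del: TL_word_simps)
    qed
  qed
qed

lemma TL_beta_eq_any_word:
  assumes "v permutes {1..n}" "avoids_321 n v"
    and "js \<in> lists {1..<n}" "word_perm js = v" "length js = ninv n v"
  shows "TL_beta n v = TL_word n js"
  using TL_beta_eq_word[OF assms(1)] reduced_words_TL_word[OF assms] by metis

text \<open>Whatever expansion \<open>TL_coords\<close> chooses, a functional dual to \<open>TL_beta n w\<close> determines its
  coefficient at \<open>w\<close>; linear independence of the \<open>TL_beta n v\<close> is not needed.\<close>

lemma TL_coeff_eq_functional:
  assumes add: "\<And>X Y. \<lbrakk>X \<in> carrier (TL n); Y \<in> carrier (TL n)\<rbrakk> \<Longrightarrow> \<phi> (X \<oplus>\<^bsub>TL n\<^esub> Y) = \<phi> X + \<phi> Y"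
    and smult: "\<And>c X. X \<in> carrier (TL n) \<Longrightarrow> \<phi> (c \<odot>\<^bsub>TL n\<^esub> X) = c * \<phi> X"
    and dual: "\<And>v. v \<in> avoiders_321 n \<Longrightarrow> \<phi> (TL_beta n v) = (if v = w then \<gamma> else 0)"
    and w: "w \<in> avoiders_321 n" and u: "u permutes {1..n}"
  shows "TL_coeff n w u * \<gamma> = \<phi> (refl_perm n u)"
proof -
  interpret ring "TL n" by (rule ring_TL)
  let ?A = "avoiders_321 n"
  have fin: "finite ?A" by (rule finite_subset[of _ "sym_set n"]) (auto simp: avoiders_321_def)
  have car: "TL_beta n v \<in> carrier (TL n)" if "v \<in> ?A" for v
    using that by (simp add: avoiders_321_def TL_beta_closed)
  define f where "f = TL_coords n (refl_perm n u)"
  have eq: "refl_perm n u = (\<Oplus>\<^bsub>TL n\<^esub>v\<in>?A. f v \<odot>\<^bsub>TL n\<^esub> TL_beta n v)"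
    unfolding f_def TL_coords_def
    by (rule someI_ex[OF TL_span_finsum[OF fin car refl_perm_in_span[OF u]]])
  have zero: "\<phi> \<zero>\<^bsub>TL n\<^esub> = 0"
    using smult[OF zero_closed, of 0] TL_smult_zero[OF zero_closed] by simp
  have "\<phi> (\<Oplus>\<^bsub>TL n\<^esub>v\<in>B. f v \<odot>\<^bsub>TL n\<^esub> TL_beta n v) = (\<Sum>v\<in>B. f v * \<phi> (TL_beta n v))"
    if "finite B" "B \<subseteq> ?A" for B
    using that
  proof (induction B)
    case (insert v B)
    then have "(\<lambda>v. f v \<odot>\<^bsub>TL n\<^esub> TL_beta n v) \<in> B \<rightarrow> carrier (TL n)"
      using car by (auto intro!: TL_smult_closed)
    then show ?case using insert car by (simp add: add smult TL_smult_closed)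
  qed (simp add: zero)
  from this[OF fin] have "\<phi> (refl_perm n u) = (\<Sum>v\<in>?A. f v * \<phi> (TL_beta n v))"
    by (simp flip: eq)
  also have "\<dots> = (\<Sum>v\<in>?A. if v = w then f v * \<gamma> else 0)"
    by (rule sum.cong) (auto simp: dual)
  also have "\<dots> = f w * \<gamma>" using fin w by simp
  finally show ?thesis by (simp add: TL_coeff_def TL_theta_of_elem[OF u] f_def)
qed

section \<open>The dual functional\<close>

definition point_mass :: "nat set \<Rightarrow> nat set \<Rightarrow> complex" where
  "point_mass S T = (if T = S then 1 else 0)"

text \<open>\<open>TL_pair n L N P Q\<close> sums the matrix entries between the colourings \<open>S \<subseteq> L \<union> N\<close> of the sources
  and \<open>T \<subseteq> P \<union> Q\<close> of the targets. It is the constant term in \<open>z\<close> of the pure tensor functional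
  whose sources carry \<open>(1, z)\<close> on \<open>L\<close>, \<open>(1, 1)\<close> on \<open>N\<close>, \<open>(1, 0)\<close> elsewhere, and whose targets carry
  \<open>(1, - 1 / z)\<close> on \<open>P\<close>, \<open>(1, - 1)\<close> on \<open>Q\<close>, \<open>(1, 0)\<close> elsewhere.\<close>

definition TL_pair ::
  "nat \<Rightarrow> nat set \<Rightarrow> nat set \<Rightarrow> nat set \<Rightarrow> nat set \<Rightarrow> (nat list \<Rightarrow> complex) set \<Rightarrow> complex" where
  "TL_pair n L N P Q X = (\<Sum>S\<in>Pow (L \<union> N). \<Sum>T\<in>Pow (P \<union> Q).
     if card (T \<inter> P) = card (S \<inter> L) then (- 1) ^ card T * TL_act n X (point_mass S) T else 0)"

lemma TL_pair_add:
  assumes "X \<in> carrier (TL n)" "Y \<in> carrier (TL n)"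
  shows "TL_pair n L N P Q (X \<oplus>\<^bsub>TL n\<^esub> Y) = TL_pair n L N P Q X + TL_pair n L N P Q Y"
  unfolding TL_pair_def sum.distrib[symmetric]
  by (intro sum.cong refl) (simp add: TL_act_add[OF assms] distrib_left)

lemma TL_pair_smult:
  assumes "X \<in> carrier (TL n)"
  shows "TL_pair n L N P Q (c \<odot>\<^bsub>TL n\<^esub> X) = c * TL_pair n L N P Q X"
  unfolding TL_pair_def sum_distrib_left
  by (intro sum.cong refl) (simp add: TL_act_smult[OF assms])

lemma TL_pair_span_zero:
  assumes "S \<subseteq> carrier (TL n)" "\<And>Y. Y \<in> S \<Longrightarrow> TL_pair n L N P Q Y = 0"
  shows "X \<in> TL_span n S \<Longrightarrow> TL_pair n L N P Q X = 0"
proof (induction rule: TL_span.induct)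
  case zero
  show ?case by (simp add: TL_pair_def TL_act_zero cong: if_cong)
qed (use assms in \<open>auto simp: TL_pair_add TL_pair_smult TL_span_closed\<close>)

lemma TL_pair_word:
  "js \<in> lists {1..<n} \<Longrightarrow> TL_pair n L N P Q (TL_word n js) =
    (\<Sum>S\<in>Pow (L \<union> N). \<Sum>T\<in>Pow (P \<union> Q).
      if card (T \<inter> P) = card (S \<inter> L) then (- 1) ^ card T * word_act js (point_mass S) T else 0)"
  by (simp add: TL_pair_def TL_act_word cong: if_cong)

lemma point_mass_adj_swap: "point_mass S (adj_swap i ` T) = point_mass (adj_swap i ` S) T"
  by (metis adj_swap_image_twice point_mass_def)

lemma word_act_diff:
  "word_act js (\<lambda>T. G T - H T) T = word_act js G T - word_act js H T"
  by (induction js arbitrary: T) auto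

text \<open>Each generator acts by a symmetric matrix, so transposing a product reverses the
  word.\<close>

lemma word_act_transpose: "word_act js (point_mass S) T = word_act (rev js) (point_mass T) S"
proof (induction js arbitrary: T)
  case Nil
  show ?case by (auto simp: point_mass_def)
next
  case (Cons i js)
  have "word_act [i] (point_mass T) = (\<lambda>U. point_mass T U - point_mass (adj_swap i ` T) U)"
    by (simp add: point_mass_adj_swap)
  then show ?case by (simp only: rev.simps word_act_append word_act_diff) (simp add: Cons)
qed

lemma word_act_card:
  "(\<And>T. G T \<noteq> 0 \<Longrightarrow> card T = k) \<Longrightarrow> word_act js G T \<noteq> 0 \<Longrightarrow> card T = k"
proof (induction js arbitrary: T)
  case (Cons i js)
  then have "word_act js G T \<noteq> 0 \<or> word_act js G (adj_swap i ` T) \<noteq> 0" by auto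
  then show ?case
    using Cons.IH[OF Cons.prems(1)] card_image[OF inj_adj_swap, of i T] by auto
qed auto

text \<open>The action preserves the number of coloured positions, so the sign may be computed from
  the sources instead of the targets. This exchanges the roles of sources and targets.\<close>

lemma TL_pair_transpose:
  assumes "js \<in> lists {1..<n}"
  shows "TL_pair n L N P Q (TL_word n js) = TL_pair n P Q L N (TL_word n (rev js))"
proof -
  have rev: "rev js \<in> lists {1..<n}" using assms by (simp add: in_lists_conv_set)
  have eq: "(- 1) ^ card T * word_act js (point_mass S) T
      = (- 1) ^ card S * word_act (rev js) (point_mass T) S" for S T
  proof (cases "word_act js (point_mass S) T = 0")
    case False
    then have "card T = card S"
      by (rule word_act_card[rotated]) (auto simp: point_mass_def split: if_splits)
    then show ?thesis by (simp add: word_act_transpose[of js])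
  qed (simp add: word_act_transpose[of js])
  show ?thesis
    unfolding TL_pair_word[OF assms] TL_pair_word[OF rev] eq
    by (subst sum.swap) (intro sum.cong refl, simp)
qed

text \<open>Applying \<open>adj_swap i\<close> to the target colouring keeps its weight, as both
  target blocks are preserved, but negates the matrix entry of a word that starts with
  \<open>i\<close>. The sum equals its own negative.\<close>

lemma TL_pair_left_zero:
  assumes "i # js \<in> lists {1..<n}" and PQ: "adj_swap i ` P = P" "adj_swap i ` Q = Q"
  shows "TL_pair n L N P Q (TL_word n (i # js)) = 0"
proof -
  have "(\<Sum>T\<in>Pow (P \<union> Q). if card (T \<inter> P) = card (S \<inter> L)
      then (- 1) ^ card T * word_act (i # js) (point_mass S) T else 0) = 0" (is "sum ?f ?A = 0") for S
  proof -
    have inv: "card (adj_swap i ` T \<inter> P) = card (T \<inter> P)" for T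
    proof -
      have "adj_swap i ` T \<inter> P = adj_swap i ` (T \<inter> P)"
        by (subst image_Int) (simp_all add: PQ)
      then show ?thesis by (simp add: card_image)
    qed
    have sub: "adj_swap i ` T \<in> ?A" if "T \<in> ?A" for T
      using image_mono[of T "P \<union> Q" "adj_swap i"] that PQ by (simp add: image_Un)
    have "sum ?f ?A = sum (\<lambda>T. - ?f T) ?A"
      by (rule sum.reindex_bij_witness[of _ "image (adj_swap i)" "image (adj_swap i)"])
        (use sub in \<open>auto simp: inv card_image algebra_simps\<close>)
    then show ?thesis by (simp add: sum_negf)
  qed
  then show ?thesis using assms by (simp add: TL_pair_word del: word_act.simps TL_word_simps)
qed

lemma TL_pair_right_zero:
  assumes js: "js @ [i] \<in> lists {1..<n}" and "adj_swap i ` L = L" "adj_swap i ` N = N"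
  shows "TL_pair n L N P Q (TL_word n (js @ [i])) = 0"
proof -
  have "i # rev js \<in> lists {1..<n}" using js by (auto simp: in_lists_conv_set)
  then show ?thesis
    unfolding TL_pair_transpose[OF js] using assms by (simp add: TL_pair_left_zero del: TL_word_simps)
qed

section \<open>Value of the pairing at a permutation\<close>

lemma TL_act_refl:
  assumes i: "i \<in> {1..<n}"
  shows "TL_act n (TL_refl n i) G T = - G (adj_swap i ` T)"
proof -
  interpret ring "TL n" by (rule ring_TL)
  have "TL_act n (TL_refl n i) G T = TL_act n (TL_gen n i) G T - TL_act n \<one>\<^bsub>TL n\<^esub> G T"
    using TL_gen_closed[OF i]
    by (simp add: TL_refl_def a_minus_def TL_minus_eq_smult TL_act_add TL_act_smult TL_smult_closed)
  then show ?thesis using TL_act_gen[OF i, of G] by (simp add: TL_act_one)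
qed

lemma TL_act_refl_word:
  "js \<in> lists {1..<n} \<Longrightarrow>
    TL_act n (refl_word n js) G T = (- 1) ^ length js * G (word_perm (rev js) ` T)"
proof (induction js arbitrary: T)
  case (Cons i js)
  then have i: "i \<in> {1..<n}" and js: "js \<in> lists {1..<n}" by auto
  show ?case
    unfolding refl_word_simps TL_act_mult[OF TL_refl_closed[OF i] refl_word_closed[OF js]]
      TL_act_refl[OF i] Cons.IH[OF js] by (simp add: image_comp comp_def)
qed (simp add: TL_act_one)

lemma TL_act_refl_perm:
  assumes u: "u permutes {1..n}"
  shows "TL_act n (refl_perm n u) (point_mass S) T = of_int (sign u) * (if T = u ` S then 1 else 0)"
proof -
  obtain js where js: "js \<in> lists {1..<n}" "word_perm js = u"
    using reduced_word_exists[OF u] by blast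
  have "inv' u ` T = S \<longleftrightarrow> T = u ` S"
    using permutes_bij[OF u] by (metis bij_is_surj bij_is_inj image_f_inv_f inv_f_f image_inv_f_f)
  moreover have "word_perm (rev js) = inv' u" using js inv_word_perm by metis
  ultimately show ?thesis
    using TL_act_refl_word[OF js(1)] refl_perm_word_perm[OF js(1)] sign_word_perm[OF js(1)] js(2)
    by (simp add: point_mass_def)
qed

text \<open>A permutation takes each source colouring to exactly one target colouring. These are the
  source colourings for which that target is admissible and the balance condition holds.\<close>

definition colourings ::
  "nat set \<Rightarrow> nat set \<Rightarrow> nat set \<Rightarrow> nat set \<Rightarrow> (nat \<Rightarrow> nat) \<Rightarrow> nat set set" where
  "colourings L N P Q u =
    {S. S \<subseteq> L \<union> N \<and> u ` S \<subseteq> P \<union> Q \<and> card (u ` S \<inter> P) = card (S \<inter> L)}"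

lemma TL_pair_refl_perm:
  assumes u: "u permutes {1..n}" and fin: "finite L" "finite N" "finite P" "finite Q"
  shows "TL_pair n L N P Q (refl_perm n u)
      = of_int (sign u) * (\<Sum>S\<in>colourings L N P Q u. (- 1) ^ card S)"
proof -
  have card: "card (u ` S) = card S" for S
    using permutes_inj[OF u] by (meson card_image inj_on_subset subset_UNIV)
  have "(\<Sum>T\<in>Pow (P \<union> Q). if card (T \<inter> P) = card (S \<inter> L)
        then (- 1) ^ card T * TL_act n (refl_perm n u) (point_mass S) T else 0)
      = (if u ` S \<subseteq> P \<union> Q \<and> card (u ` S \<inter> P) = card (S \<inter> L)
         then of_int (sign u) * (- 1) ^ card S else 0)" (is "?l S = ?r S") for S
  proof -
    have "?l S = (\<Sum>T\<in>Pow (P \<union> Q). if T = u ` S then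
        (if card (u ` S \<inter> P) = card (S \<inter> L) then of_int (sign u) * (- 1) ^ card S else 0) else 0)"
      by (intro sum.cong refl) (auto simp: TL_act_refl_perm[OF u] card)
    also have "\<dots> = ?r S" using fin by (simp add: sum.delta)
    finally show ?thesis .
  qed
  then have "TL_pair n L N P Q (refl_perm n u) = (\<Sum>S\<in>Pow (L \<union> N). ?r S)"
    by (simp add: TL_pair_def)
  also have "\<dots> = (\<Sum>S\<in>colourings L N P Q u. of_int (sign u) * (- 1) ^ card S)"
    by (rule sum.mono_neutral_cong_right) (use fin in \<open>auto simp: colourings_def\<close>)
  finally show ?thesis by (simp add: sum_distrib_left)
qed

lemma alternating_sum_toggle:
  assumes "finite F" "\<And>S. S \<in> F \<Longrightarrow> finite S"
    and toggle: "\<And>S. x \<notin> S \<Longrightarrow> S \<in> F \<longleftrightarrow> insert x S \<in> F"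
  shows "(\<Sum>S\<in>F. (- 1) ^ card S) = (0 :: complex)"
proof -
  let ?t = "\<lambda>S. if x \<in> S then S - {x} else insert x S"
  have "?t S \<in> F" if "S \<in> F" for S
    using toggle[of S] toggle[of "S - {x}"] that by (auto simp: insert_absorb)
  moreover have "?t (?t S) = S" for S by auto
  moreover have "(- 1) ^ card (?t S) = - ((- 1) ^ card S :: complex)" if "S \<in> F" for S
  proof (cases "x \<in> S")
    case True
    then have "card S = Suc (card (S - {x}))" using assms(2)[OF that] by (rule card.remove[rotated])
    then have "(- 1) ^ card S = - ((- 1) ^ card (S - {x}) :: complex)"
      by (metis power_Suc mult_minus1)
    then show ?thesis using True by (simp del: card_Diff_singleton card_Diff_insert)
  qed (use assms(2)[OF that] in simp)
  ultimately have "(\<Sum>S\<in>F. (- 1) ^ card S) = (\<Sum>S\<in>F. - ((- 1) ^ card S :: complex))"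
    by (intro sum.reindex_bij_witness[of _ ?t ?t]) auto
  then show ?thesis by (simp add: sum_negf)
qed

text \<open>A position from \<open>L\<close> to \<open>P\<close> changes both counts of the balance
  condition when its colour is toggled, one from \<open>N\<close> to \<open>Q\<close> changes
  neither; in both cases toggling flips the sign and everything cancels. Otherwise a colouring picks
  equally many positions from \<open>XA\<close> and \<open>XB\<close>, so all signs are
  \<open>+1\<close> and the sum is a cardinality.\<close>

lemma sum_colourings:
  assumes u: "inj u" and fin: "finite L" "finite N" "finite P" "finite Q"
    and LN: "L \<inter> N = {}" and PQ: "P \<inter> Q = {}"
  shows "(\<Sum>S\<in>colourings L N P Q u. (- 1) ^ card S) =
    (if (\<exists>i\<in>L. u i \<in> P) \<or> (\<exists>i\<in>N. u i \<in> Q) then 0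
     else of_nat ((card {i \<in> L. u i \<in> Q} + card {i \<in> N. u i \<in> P}) choose card {i \<in> L. u i \<in> Q})
       :: complex)"
proof -
  have finF: "finite (colourings L N P Q u)"
    by (rule finite_subset[of _ "Pow (L \<union> N)"]) (use fin in \<open>auto simp: colourings_def\<close>)
  have finS: "finite S" if "S \<in> colourings L N P Q u" for S
    using that fin by (auto simp: colourings_def intro: finite_subset[of S "L \<union> N"])
  show ?thesis
  proof (cases "(\<exists>i\<in>L. u i \<in> P) \<or> (\<exists>i\<in>N. u i \<in> Q)")
    case True
    then obtain x where x: "x \<in> L \<and> u x \<in> P \<or> x \<in> N \<and> u x \<in> Q" by blast
    have "S \<in> colourings L N P Q u \<longleftrightarrow> insert x S \<in> colourings L N P Q u" if xS: "x \<notin> S" for S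
    proof (cases "S \<subseteq> L \<union> N")
      case True
      then have finS: "finite S" using fin by (auto intro: finite_subset)
      have "u x \<notin> u ` S" using u xS by (auto dest: injD)
      then have 1: "card (u ` insert x S \<inter> P) = (if u x \<in> P then Suc (card (u ` S \<inter> P)) else card (u ` S \<inter> P))"
        using finS by simp
      have 2: "card (insert x S \<inter> L) = (if x \<in> L then Suc (card (S \<inter> L)) else card (S \<inter> L))"
        using finS xS by simp
      show ?thesis
        unfolding colourings_def mem_Collect_eq 1 2 using x LN PQ by auto
    qed (auto simp: colourings_def)
    then show ?thesis using alternating_sum_toggle[OF finF finS, of x] True by auto
  next
    case False
    define XA where "XA = {i \<in> L. u i \<in> Q}"
    define XB where "XB = {i \<in> N. u i \<in> P}"
    have finX: "finite XA" "finite XB" using fin by (auto simp: XA_def XB_def)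
    have disj: "XA \<inter> XB = {}" using LN by (auto simp: XA_def XB_def)
    have F: "colourings L N P Q u = {S. S \<subseteq> XA \<union> XB \<and> card (S \<inter> XB) = card (S \<inter> XA)}"
    proof -
      have 1: "S \<subseteq> L \<union> N \<and> u ` S \<subseteq> P \<union> Q \<longleftrightarrow> S \<subseteq> XA \<union> XB" for S
        using False unfolding XA_def XB_def image_subset_iff subset_iff by blast
      have 2: "card (u ` S \<inter> P) = card (S \<inter> XB)" "card (S \<inter> L) = card (S \<inter> XA)"
        if "S \<subseteq> XA \<union> XB" for S
      proof -
        have "u ` S \<inter> P = u ` (S \<inter> XB)" "S \<inter> L = S \<inter> XA"
          using that LN PQ by (auto simp: XA_def XB_def)
        then show "card (u ` S \<inter> P) = card (S \<inter> XB)" "card (S \<inter> L) = card (S \<inter> XA)"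
          using u by (simp_all add: card_image inj_on_subset)
      qed
      have "S \<in> colourings L N P Q u \<longleftrightarrow> S \<subseteq> XA \<union> XB \<and> card (S \<inter> XB) = card (S \<inter> XA)" for S
        unfolding colourings_def mem_Collect_eq using 1[of S] 2[of S] by argo
      then show ?thesis by blast
    qed
    have split: "card S = card (S \<inter> XA) + card (S \<inter> XB)" if "S \<subseteq> XA \<union> XB" for S
    proof -
      have "card ((S \<inter> XA) \<union> (S \<inter> XB)) = card (S \<inter> XA) + card (S \<inter> XB)"
        by (rule card_Un_disjoint) (use finX disj in auto)
      moreover have "(S \<inter> XA) \<union> (S \<inter> XB) = S" using that by auto
      ultimately show ?thesis by simp
    qed
    have "(- 1) ^ card S = (1 :: complex)" if "S \<in> colourings L N P Q u" for S
    proof -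
      have S: "S \<subseteq> XA \<union> XB" "card (S \<inter> XB) = card (S \<inter> XA)" using that by (auto simp: F)
      then show ?thesis using split[OF S(1)] by simp
    qed
    then have "(\<Sum>S\<in>colourings L N P Q u. (- 1) ^ card S) = (of_nat (card (colourings L N P Q u)) :: complex)"
      by simp
    also have "card (colourings L N P Q u) = card {S. S \<subseteq> XA \<union> XB \<and> card S = card XB}"
    proof -
      \<comment> \<open>Complementing inside \<open>XB\<close> turns equally many choices from
        \<open>XA\<close> and \<open>XB\<close> into a subset of the union of size
        \<open>card XB\<close>. This is the bijective proof of Vandermonde's identity in the
        required case.\<close>
      let ?g = "\<lambda>S. (S \<inter> XA) \<union> (XB - S)"
      have gg: "?g (?g S) = S" if "S \<subseteq> XA \<union> XB" for S using that disj by auto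
      have card_g: "card (?g S) + card (S \<inter> XB) = card (S \<inter> XA) + card XB" for S
      proof -
        have "card (?g S) = card (S \<inter> XA) + card (XB - S)"
          using finX disj by (intro card_Un_disjoint) auto
        moreover have "card (XB - S) + card (S \<inter> XB) = card XB"
          using finX by (subst card_Un_disjoint[symmetric]) (auto intro: arg_cong[of _ _ card])
        ultimately show ?thesis by simp
      qed
      have sub: "?g S \<inter> XA = S \<inter> XA" "?g S \<inter> XB = XB - S" for S using disj by auto
      have bij: "bij_betw ?g (colourings L N P Q u) {S. S \<subseteq> XA \<union> XB \<and> card S = card XB}"
      proof (rule bij_betw_byWitness[where f' = ?g])
        show "?g ` colourings L N P Q u \<subseteq> {S. S \<subseteq> XA \<union> XB \<and> card S = card XB}"
        proof (rule image_subsetI)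
          fix S assume "S \<in> colourings L N P Q u"
          then show "?g S \<in> {S. S \<subseteq> XA \<union> XB \<and> card S = card XB}"
            using card_g[of S] by (auto simp: F)
        qed
        show "?g ` {S. S \<subseteq> XA \<union> XB \<and> card S = card XB} \<subseteq> colourings L N P Q u"
        proof (clarsimp simp: F sub, intro conjI)
          fix S assume S: "S \<subseteq> XA \<union> XB" "card S = card XB"
          have "card (XB - S) + card (S \<inter> XB) = card XB"
            using finX by (subst card_Un_disjoint[symmetric]) (auto intro: arg_cong[of _ _ card])
          then show "card (XB - S) = card (S \<inter> XA)" using S split[OF S(1)] by simp
        qed auto
      qed (use gg in \<open>auto simp: F\<close>)
      then show ?thesis by (rule bij_betw_same_card)
    qed
    also have "\<dots> = (card XA + card XB) choose card XB"
      using finX disj by (simp add: n_subsets card_Un_disjoint)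
    also have "\<dots> = (card XA + card XB) choose card XA"
      by (subst binomial_symmetric) auto
    finally show ?thesis using False by (simp add: XA_def XB_def)
  qed
qed

text \<open>The expansion into reflection words uses no new letters, so whatever all letters in
  \<open>D\<close> preserve is preserved by every permutation that occurs.\<close>

lemma TL_word_in_span:
  assumes D: "D \<subseteq> {1..<n}"
  shows "js \<in> lists D \<Longrightarrow> TL_word n js \<in> TL_span n (refl_word n ` lists D)"
proof (induction js)
  case Nil
  have "refl_word n [] \<in> TL_span n (refl_word n ` lists D)" 
    by (intro TL_span.base imageI) simp
  then show ?case by simp
next
  interpret ring "TL n" by (rule ring_TL)
  case (Cons i js)
  then have i: "i \<in> {1..<n}" "i \<in> D" and js: "js \<in> lists {1..<n}" "js \<in> lists D"
    using D by (auto simp: in_lists_conv_set)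
  have car: "refl_word n ` lists D \<subseteq> carrier (TL n)"
    using D refl_word_closed[of _ n] by (auto simp: in_lists_conv_set subset_iff)
  have IH: "TL_word n js \<in> TL_span n (refl_word n ` lists D)" using Cons js by blast
  have "TL_word n (i # js) = TL_refl n i \<otimes>\<^bsub>TL n\<^esub> TL_word n js \<oplus>\<^bsub>TL n\<^esub> TL_word n js"
    using TL_gen_closed[OF i(1)] TL_word_closed[OF js(1)]
    unfolding TL_refl_def TL_word_simps by (algebra; simp)
  moreover have "TL_refl n i \<otimes>\<^bsub>TL n\<^esub> TL_word n js \<in> TL_span n (refl_word n ` lists D)"
  proof (rule TL_span_mult_left[OF car TL_refl_closed[OF i(1)] _ IH])
    fix Y assume "Y \<in> refl_word n ` lists D"
    then obtain ks where "ks \<in> lists D" "Y = refl_word n ks" by auto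
    then have "TL_refl n i \<otimes>\<^bsub>TL n\<^esub> Y = refl_word n (i # ks)" "i # ks \<in> lists D" using i by auto
    then show "TL_refl n i \<otimes>\<^bsub>TL n\<^esub> Y \<in> TL_span n (refl_word n ` lists D)"
      by (metis TL_span.base imageI)
  qed
  ultimately show ?case using IH by (simp add: TL_span.add)
qed

section \<open>Vanishing on permutations that move sources to the far targets\<close>

lemma adj_swap_image_prefix:
  assumes "i \<ge> 1" "i \<noteq> k" shows "adj_swap i ` {1..k} = {1..k}"
  by (rule adj_swap_image_fixed) (use assms in auto)

text \<open>If the prefix is preserved, its values lie below all later ones. Hence \<open>k\<close>
  is not a descent, and this persists during sorting.\<close>

lemma reduced_word_preserving_prefix:
  assumes v: "v permutes {1..n}" and pre: "v ` {1..k} = {1..k}"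
  shows "\<exists>js \<in> lists ({1..<n} - {k}). word_perm js = v \<and> length js = ninv n v"
proof -
  have "\<exists>js \<in> lists ({1..<n} \<inter> (- {k})). word_perm js = v \<and> length js = ninv n v"
  proof (rule reduced_word_exists_invariant[OF v, where P = "\<lambda>v. v ` {1..k} = {1..k}"])
    show "v ` {1..k} = {1..k}" by (rule pre)
  next
    fix w i
    assume w: "w permutes {1..n}" "w ` {1..k} = {1..k}" and i: "i \<in> {1..<n}" "w i > w (Suc i)"
    have "i \<noteq> k"
    proof
      assume [simp]: "i = k"
      have "w k \<in> {1..k}" using w(2) i by auto
      moreover have "w (Suc k) \<notin> {1..k}"
        using w(2) permutes_inj[OF w(1)] by (metis Suc_n_not_le_n atLeastAtMost_iff inj_image_mem_iff)
      moreover have "w (Suc k) \<in> {1..n}" using permutes_in_image[OF w(1), of "Suc k"] i by simp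
      ultimately show False using i by auto
    qed
    then show "i \<in> - {k} \<and> (w \<circ> adj_swap i) ` {1..k} = {1..k}"
      using w i adj_swap_image_prefix[of i k] by (simp only: image_comp[symmetric]) auto
  qed
  then show ?thesis by (simp add: Diff_eq)
qed

text \<open>Letters other than \<open>k\<close> never carry a colour across the end of the
  prefix.\<close>

lemma word_act_card_prefix:
  assumes "js \<in> lists ({1..<n} - {k})" "\<And>T. G T \<noteq> 0 \<Longrightarrow> card (T \<inter> {1..k}) = m"
    and "word_act js G T \<noteq> 0"
  shows "card (T \<inter> {1..k}) = m"
  using assms(1,3)
proof (induction js arbitrary: T)
  case (Cons i js)
  have i: "1 \<le> i" "i \<noteq> k" using Cons.hyps by simp_all
  have "adj_swap i ` T \<inter> {1..k} = adj_swap i ` T \<inter> adj_swap i ` {1..k}"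
    by (simp only: adj_swap_image_prefix[OF i])
  also have "\<dots> = adj_swap i ` (T \<inter> {1..k})" by (simp add: image_Int)
  finally have "card (adj_swap i ` T \<inter> {1..k}) = card (T \<inter> {1..k})" by (simp add: card_image)
  moreover have "word_act js G T \<noteq> 0 \<or> word_act js G (adj_swap i ` T) \<noteq> 0"
    using Cons.prems by auto
  ultimately show ?case using Cons.IH Cons.prems by auto
qed (use assms in auto)

text \<open>Composing with this cycle on the right moves the value at \<open>q\<close> past the next
  \<open>\<mu>\<close> positions and shifts their values one place to the left.\<close>

lemma word_perm_upt:
  "word_perm [q..<q + \<mu>] p = (if p < q \<or> q + \<mu> < p then p else if p = q + \<mu> then q else Suc p)"
proof (induction \<mu> arbitrary: p)
  case (Suc \<mu>)
  have "word_perm [q..<q + Suc \<mu>] p = word_perm [q..<q + \<mu>] (adj_swap (q + \<mu>) p)" by simp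
  then show ?case unfolding Suc by (auto simp: adj_swap_eq)
qed simp

lemma ninv_chain:
  assumes v: "v permutes {1..n}" and q: "1 \<le> q" "q + \<mu> \<le> n"
    and gt: "\<And>k. k \<in> {q<..q + \<mu>} \<Longrightarrow> v k < v q"
  shows "ninv n v = ninv n (v \<circ> word_perm [q..<q + \<mu>]) + \<mu>"
  using q(2) gt
proof (induction \<mu>)
  case (Suc \<mu>)
  let ?v = "v \<circ> word_perm [q..<q + \<mu>]"
  have "[q..<q + \<mu>] \<in> lists {1..<n}" using q Suc.prems by (auto simp: in_lists_conv_set)
  then have perm: "?v permutes {1..n}" by (intro permutes_compose[OF word_perm_permutes v])
  have p: "q + \<mu> \<in> {1..<n}" using q Suc.prems by auto
  have "?v (Suc (q + \<mu>)) < ?v (q + \<mu>)"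
    using Suc.prems(2)[of "Suc (q + \<mu>)"] by (simp add: word_perm_upt)
  from ninv_descent[OF perm p this] have "ninv n ?v = Suc (ninv n (?v \<circ> adj_swap (q + \<mu>)))" .
  moreover have "v \<circ> word_perm [q..<q + Suc \<mu>] = ?v \<circ> adj_swap (q + \<mu>)"
    by (simp add: fun_eq_iff)
  moreover have "ninv n v = ninv n ?v + \<mu>" using Suc.prems by (intro Suc.IH) auto
  ultimately show ?case by (simp only:)
qed (simp only: add_0_right upt_conv_Nil order_refl word_perm_simps comp_id)

text \<open>Identity minus swap kills every colouring that agrees at \<open>p\<close> and
  \<open>Suc p\<close>, both before and after the letter acts.\<close>

lemma word_act_single:
  assumes "word_act (p # js) G T \<noteq> 0"
  obtains U where "word_act js G U \<noteq> 0" "p \<in> U \<longleftrightarrow> Suc p \<notin> U" "T = U \<or> T = adj_swap p ` U"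
proof -
  have ne: "\<not> (p \<in> T \<longleftrightarrow> Suc p \<in> T)" 
  proof
    assume "p \<in> T \<longleftrightarrow> Suc p \<in> T"
    from adj_swap_image_fixed[OF this] assms show False by simp
  qed
  consider "word_act js G T \<noteq> 0" | "word_act js G (adj_swap p ` T) \<noteq> 0"
    using assms by (cases "word_act js G T = 0") auto
  then show ?thesis
  proof cases
    case 1
    then show ?thesis using that[of T] ne by blast
  next
    case 2
    then show ?thesis using that[of "adj_swap p ` T"] ne by (auto simp: mem_adj_swap_image)
  qed
qed

lemma adj_swap_image_insert:
  "p \<notin> U \<Longrightarrow> Suc p \<notin> U \<Longrightarrow> adj_swap p ` insert p U = insert (Suc p) U"
  using adj_swap_image_fixed[of p U] by simp

text \<open>Letter \<open>q\<close> acts first, and each letter needs exactly one coloured position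
  among its two. All positions right of \<open>q\<close> start uncoloured, so the colour must come
  from \<open>q\<close> and must have reached \<open>q + k\<close> before letter
  \<open>q + k\<close> acts. Only the last letter may leave it in place, hence the two possible
  final positions.\<close>

lemma word_act_chain:
  assumes "1 \<le> \<mu>" and "\<And>T. G T \<noteq> 0 \<Longrightarrow> T \<inter> {q<..q + \<mu>} = {}"
    and "word_act (rev [q..<q + \<mu>]) G T' \<noteq> 0"
  shows "\<exists>T r. G T \<noteq> 0 \<and> q \<in> T \<and> T' = insert r (T - {q}) \<and> r \<in> {q + \<mu> - 1, q + \<mu>}"
  using assms
proof (induction \<mu> arbitrary: T' rule: nat_induct_at_least)
  case base
  have "word_act [q] G T' \<noteq> 0" using base.prems(2) by simp
  then obtain U where U: "G U \<noteq> 0" "q \<in> U \<longleftrightarrow> Suc q \<notin> U" "T' = U \<or> T' = adj_swap q ` U"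
    by (rule word_act_single) simp
  have q: "Suc q \<notin> U" "q \<in> U" using base.prems(1)[OF U(1)] U(2) by auto
  have "adj_swap q ` U = insert (Suc q) (U - {q})"
    using adj_swap_image_insert[of q "U - {q}"] q by (simp add: insert_absorb)
  then show ?case using U q
    by (intro exI[of _ U] exI[of _ "if T' = U then q else Suc q"]) (auto simp: insert_absorb)
next
  case (Suc \<mu>)
  have "word_act ((q + \<mu>) # rev [q..<q + \<mu>]) G T' \<noteq> 0" using Suc.prems(2) by simp
  then obtain U where U: "word_act (rev [q..<q + \<mu>]) G U \<noteq> 0" "q + \<mu> \<in> U \<longleftrightarrow> Suc (q + \<mu>) \<notin> U"
      "T' = U \<or> T' = adj_swap (q + \<mu>) ` U"
    by (rule word_act_single)
  have "T \<inter> {q<..q + \<mu>} = {}" if "G T \<noteq> 0" for T using Suc.prems(1)[OF that] by auto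
  from Suc.IH[OF this U(1)] obtain T r where T: "G T \<noteq> 0" "q \<in> T" "U = insert r (T - {q})"
      "r \<in> {q + \<mu> - 1, q + \<mu>}" by blast
  have free: "q + \<mu> \<notin> T" "Suc (q + \<mu>) \<notin> T" using Suc.prems(1)[OF T(1)] Suc.hyps by auto
  then have r: "r = q + \<mu>" using U(2) T(3,4) by auto
  have "adj_swap (q + \<mu>) ` U = insert (Suc (q + \<mu>)) (T - {q})"
    unfolding T(3) r by (rule adj_swap_image_insert) (use free in auto)
  then show ?case using U(3) T r
    by (intro exI[of _ T] exI[of _ "if T' = U then q + \<mu> else Suc (q + \<mu>)"]) auto
qed

text \<open>Moving the last \<open>A\<close> sources of the first block past \<open>b + A\<close> uncoloured positions, one
  source at a time, forces all these sources to be coloured, and none of their colours ends up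
  below \<open>x + b\<close>.\<close>

lemma word_act_move_block:
  assumes "v permutes {1..n}" "x + A + b + A \<le> n"
    and "\<forall>i\<in>{x<..x + A}. \<forall>k\<in>{x + A<..x + A + b + A}. v k < v i"
    and "v ` ({1..x} \<union> {x + A<..x + A + b}) = {1..x + b}"
  shows "\<exists>js \<in> lists {1..<n}. word_perm js = v \<and> length js = ninv n v \<and>
    (\<forall>G s m. (\<forall>T. G T \<noteq> 0 \<longrightarrow> T \<inter> {x + A<..x + A + b + A} = {} \<and> card (T \<inter> {1..x + A}) + s = m) \<longrightarrow>
      (\<forall>T. word_act js G T \<noteq> 0 \<longrightarrow> card (T \<inter> {1..x + b}) + A + s = m))"
  using assms
proof (induction A arbitrary: v)
  case 0
  have "{1..x} \<union> {x<..x + b} = {1..x + b}" by auto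
  then have "v ` {1..x + b} = {1..x + b}" using "0.prems"(4) by simp
  then obtain js where js: "js \<in> lists ({1..<n} - {x + b})" "word_perm js = v" "length js = ninv n v"
    using reduced_word_preserving_prefix[OF "0.prems"(1)] by blast
  have "card (T \<inter> {1..x + b}) + s = m"
    if G: "\<And>T. G T \<noteq> 0 \<Longrightarrow> T \<inter> {x<..x + b} = {} \<and> card (T \<inter> {1..x}) + s = m"
      and T: "word_act js G T \<noteq> 0" for G s m T
  proof -
    have "card (T \<inter> {1..x + b}) = m - s"
    proof (rule word_act_card_prefix[OF js(1) _ T])
      fix T assume "G T \<noteq> 0"
      then have *: "T \<inter> {x<..x + b} = {}" "card (T \<inter> {1..x}) + s = m" using G by auto
      then have "T \<inter> {1..x + b} = T \<inter> {1..x}" by auto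
      then show "card (T \<inter> {1..x + b}) = m - s" using * by auto
    qed
    moreover have "s \<le> m"
    proof -
      have "\<exists>T. G T \<noteq> 0"
      proof (rule ccontr)
        assume "\<not> (\<exists>T. G T \<noteq> 0)"
        \<comment> \<open>For vanishing \<open>G\<close> the hypothesis of
          \<open>word_act_card\<close> holds for every number, so the impossible value
          \<open>Suc (card T)\<close> rules out a nonzero entry.\<close>
        then have "word_act js G T = 0"
          using word_act_card[of G "Suc (card T)" js T] by fastforce
        then show False using T by simp
      qed
      then show ?thesis using G by fastforce
    qed
    ultimately show ?thesis by simp
  qed
  moreover have "js \<in> lists {1..<n}" using js by auto
  ultimately show ?case using js by (intro bexI[of _ js]) auto
next
  case (Suc A)
  note v = Suc.prems(1)
  \<comment> \<open>The rightmost remaining source is moved first, past \<open>Suc A\<close>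
    positions more than the \<open>b\<close> in question. Its colour then lands at
    \<open>q + \<mu> - 1\<close> or \<open>q + \<mu>\<close>, and both lie just beyond the window
    \<open>{x + A<..x + A + b + A}\<close> that the induction hypothesis wants uncoloured.\<close>
  define q where "q = x + Suc A"
  define \<mu> where "\<mu> = b + Suc A"
  have q: "1 \<le> q" "q + \<mu> \<le> n" using Suc.prems by (auto simp: q_def \<mu>_def)
  have gt: "v k < v q" if "k \<in> {q<..q + \<mu>}" for k
    by (rule Suc.prems(3)[rule_format]) (use that in \<open>auto simp: q_def \<mu>_def\<close>)
  have up: "[q..<q + \<mu>] \<in> lists {1..<n}" using q by (auto simp: in_lists_conv_set)
  define v' where "v' = v \<circ> word_perm [q..<q + \<mu>]"
  have v': "v' permutes {1..n}"
    unfolding v'_def by (intro permutes_compose[OF word_perm_permutes v] up)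
  have ninv: "ninv n v = ninv n v' + \<mu>" unfolding v'_def by (rule ninv_chain[OF v q gt])
  have v'_less: "v' p = v p" if "p < q" for p using that by (simp add: v'_def word_perm_upt)
  have v'_mid: "v' p = v (Suc p)" if "q \<le> p" "p < q + \<mu>" for p
    using that by (simp add: v'_def word_perm_upt)
  have "v' ` ({1..x} \<union> {x + A<..x + A + b}) = v ` ({1..x} \<union> {x + Suc A<..x + Suc A + b})"
  proof -
    have "v' ` {1..x} = v ` {1..x}" by (rule image_cong) (auto simp: v'_less q_def)
    moreover have "v' ` {x + A<..x + A + b} = (\<lambda>p. v (Suc p)) ` {x + A<..x + A + b}"
      by (rule image_cong) (auto simp: v'_mid q_def \<mu>_def)
    moreover have "(\<lambda>p. v (Suc p)) ` {x + A<..x + A + b} = v ` (Suc ` {x + A<..x + A + b})"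
      by (simp add: image_image)
    moreover have "Suc ` {x + A<..x + A + b} = {x + Suc A<..x + Suc A + b}"
      by (simp flip: atLeastSucAtMost_greaterThanAtMost)
    ultimately show ?thesis by (simp add: image_Un)
  qed
  then have img: "v' ` ({1..x} \<union> {x + A<..x + A + b}) = {1..x + b}" using Suc.prems(4) by simp
  have gt': "\<forall>i\<in>{x<..x + A}. \<forall>k\<in>{x + A<..x + A + b + A}. v' k < v' i"
  proof (intro ballI)
    fix i k assume ik: "i \<in> {x<..x + A}" "k \<in> {x + A<..x + A + b + A}"
    have "v (Suc k) < v i" by (rule Suc.prems(3)[rule_format]) (use ik in auto)
    then show "v' k < v' i"
      using ik v'_less[of i] v'_mid[of k] by (auto simp: q_def \<mu>_def)
  qed
  have "x + A + b + A \<le> n" using Suc.prems(2) by simp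
  from Suc.IH[OF v' this gt' img] obtain js where
    js: "js \<in> lists {1..<n}" "word_perm js = v'" "length js = ninv n v'"
    and act0: "\<forall>G s m. (\<forall>T. G T \<noteq> 0 \<longrightarrow>
          T \<inter> {x + A<..x + A + b + A} = {} \<and> card (T \<inter> {1..x + A}) + s = m) \<longrightarrow>
        (\<forall>T. word_act js G T \<noteq> 0 \<longrightarrow> card (T \<inter> {1..x + b}) + A + s = m)"
    by (elim bexE conjE)
  have act: "card (T \<inter> {1..x + b}) + A + s = m"
    if "\<And>T. G T \<noteq> 0 \<Longrightarrow>
          T \<inter> {x + A<..x + A + b + A} = {} \<and> card (T \<inter> {1..x + A}) + s = m"
      "word_act js G T \<noteq> 0" for G s m T
    by (rule act0[rule_format, OF _ that(2)]) (rule that(1))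
  let ?r = "rev [q..<q + \<mu>]"
  have r: "?r \<in> lists {1..<n}" using up by (simp add: in_lists_conv_set)
  have "word_perm (js @ ?r) = v"
  proof -
    have "word_perm ([q..<q + \<mu>] @ ?r) = id"
      using cox_eq_word_perm[OF cox_eq_rev_append[OF r]] by simp
    then show ?thesis
      unfolding word_perm_append js(2) v'_def comp_assoc by (simp only: comp_id)
  qed
  moreover have "length (js @ ?r) = ninv n v" using ninv js by simp
  moreover have "card (T \<inter> {1..x + b}) + Suc A + s = m"
    if G: "\<And>T. G T \<noteq> 0 \<Longrightarrow>
        T \<inter> {x + Suc A<..x + Suc A + b + Suc A} = {} \<and> card (T \<inter> {1..x + Suc A}) + s = m"
      and T: "word_act (js @ ?r) G T \<noteq> 0" for G s m T
  proof -
    \<comment> \<open>The parameter \<open>s\<close> counts the colours already carried out of the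
      prefix; one more has just left, so the induction hypothesis is used at \<open>Suc s\<close>
      with the same \<open>m\<close>.\<close>
    have "card (T \<inter> {1..x + b}) + A + Suc s = m"
    proof (rule act[of "word_act ?r G"])
      show "word_act js (word_act ?r G) T \<noteq> 0" using T by (simp add: word_act_append)
    next
      fix T' assume T': "word_act ?r G T' \<noteq> 0"
      have "U \<inter> {q<..q + \<mu>} = {}" if "G U \<noteq> 0" for U
        using G[OF that] by (simp add: q_def \<mu>_def add.assoc)
      with T' obtain U k where U: "G U \<noteq> 0" "q \<in> U" "T' = insert k (U - {q})"
          "k \<in> {q + \<mu> - 1, q + \<mu>}"
        using word_act_chain[of \<mu> G q T'] by (auto simp: \<mu>_def)
      have GU: "U \<inter> {q<..q + \<mu>} = {}" "card (U \<inter> {1..q}) + s = m"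
        using G[OF U(1)] by (simp_all add: q_def \<mu>_def add.assoc)
      have "T' \<inter> {x + A<..x + A + b + A} = {}"
        using GU(1) U(3,4) by (auto simp: q_def \<mu>_def)
      moreover have "T' \<inter> {1..x + A} = U \<inter> {1..q} - {q}"
        using U(3,4) by (auto simp: q_def \<mu>_def)
      moreover have "Suc (card (U \<inter> {1..q} - {q})) = card (U \<inter> {1..q})"
        by (rule card_Suc_Diff1) (use U(2) q in auto)
      ultimately show "T' \<inter> {x + A<..x + A + b + A} = {} \<and> card (T' \<inter> {1..x + A}) + Suc s = m"
        using GU(2) by simp
    qed
    then show ?thesis by simp
  qed
  moreover have "js @ ?r \<in> lists {1..<n}" using js r by simp
  ultimately show ?case by (intro bexI[of _ "js @ ?r"]) blast+
qed

section \<open>The permutation with two block swaps\<close>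

definition ascends_off :: "nat \<Rightarrow> nat \<Rightarrow> nat \<Rightarrow> (nat \<Rightarrow> nat) \<Rightarrow> bool" where
  "ascends_off n p q v \<longleftrightarrow> (\<forall>i\<in>{1..<n}. i \<noteq> p \<longrightarrow> i \<noteq> q \<longrightarrow> v i < v (Suc i))"

lemma ascends_off_mono:
  assumes asc: "ascends_off n p q v" and x: "1 \<le> x"
  shows "\<lbrakk>x < y; y \<le> n; \<not> (x \<le> p \<and> p < y); \<not> (x \<le> q \<and> q < y)\<rbrakk> \<Longrightarrow> v x < v y"
proof (induction y)
  case (Suc y)
  have step: "v y < v (Suc y)" using asc Suc.prems x by (auto simp: ascends_off_def)
  show ?case
  proof (cases "x = y")
    case False
    then have "v x < v y" using Suc by auto
    then show ?thesis using step by simp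
  qed (use step in simp)
qed simp

text \<open>A fixed end point stays fixed throughout sorting, so some reduced word has no letter
  that touches \<open>p\<close>. Every permutation in its expansion then fixes \<open>p\<close> as
  well, and by \<open>mem\<close> the pairing vanishes at each of them.\<close>

lemma fixed_end_zero:
  assumes v: "v permutes {1..n}" "avoids_321 n v" and p: "p = 1 \<or> p = n" "v p = p" "1 \<le> n"
    and mem: "p \<in> L \<and> p \<in> P \<or> p \<in> N \<and> p \<in> Q"
    and fin: "finite L" "finite N" "finite P" "finite Q" "L \<inter> N = {}" "P \<inter> Q = {}"
  shows "TL_pair n L N P Q (TL_beta n v) = 0"
proof -
  let ?D = "{1..<n} \<inter> {i. i \<noteq> p \<and> Suc i \<noteq> p}"
  have "\<exists>js \<in> lists ?D. word_perm js = v \<and> length js = ninv n v"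
  proof (rule reduced_word_exists_invariant[OF v(1), where P = "\<lambda>v. v p = p"])
    show "v p = p" by (rule p(2))
  next
    fix w i
    assume w: "w permutes {1..n}" "w p = p" and i: "i \<in> {1..<n}" "w (Suc i) < w i"
    have rng: "w i \<in> {1..n}" "w (Suc i) \<in> {1..n}"
      using permutes_in_image[OF w(1), of i] permutes_in_image[OF w(1), of "Suc i"] i by simp_all
    have "i \<noteq> p" "Suc i \<noteq> p" using p(1) w(2) i rng by auto
    then show "i \<in> {i. i \<noteq> p \<and> Suc i \<noteq> p} \<and> (w \<circ> adj_swap i) p = p"
      using w(2) by auto
  qed
  then obtain js where js: "js \<in> lists ?D" "word_perm js = v" "length js = ninv n v" by blast
  have js': "js \<in> lists {1..<n}" using js by auto
  have fixes_p: "word_perm ks p = p" if "ks \<in> lists ?D" for ks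
    using that by (induction ks) auto
  have "TL_pair n L N P Q (TL_word n js) = 0"
  proof (rule TL_pair_span_zero[OF _ _ TL_word_in_span[OF _ js(1)]])
    show "refl_word n ` lists ?D \<subseteq> carrier (TL n)" using refl_word_closed[of _ n] by auto
  next
    fix Y assume "Y \<in> refl_word n ` lists ?D"
    then obtain ks where ks: "ks \<in> lists ?D" "Y = refl_word n ks" by auto
    then have ks': "ks \<in> lists {1..<n}" by auto
    have perm: "word_perm ks permutes {1..n}" by (rule word_perm_permutes[OF ks'])
    have "(\<exists>i\<in>L. word_perm ks i \<in> P) \<or> (\<exists>i\<in>N. word_perm ks i \<in> Q)"
      using mem fixes_p[OF ks(1)] by metis
    then show "TL_pair n L N P Q Y = 0"
      unfolding ks(2) refl_perm_word_perm[OF ks', symmetric] TL_pair_refl_perm[OF perm fin(1-4)]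
        sum_colourings[OF permutes_inj[OF perm] fin] by simp
  qed auto
  then show ?thesis using TL_beta_eq_any_word[OF v js' js(2,3)] by simp
qed

lemma descent_last_letter:
  assumes v: "v permutes {1..n}" and i: "i \<in> {1..<n}" "v (Suc i) < v i"
  obtains js where "js @ [i] \<in> lists {1..<n}" "word_perm (js @ [i]) = v"
    "length (js @ [i]) = ninv n v"
proof -
  obtain js where js: "js \<in> lists {1..<n}" "word_perm js = v \<circ> adj_swap i"
      "length js = ninv n (v \<circ> adj_swap i)"
    using reduced_word_exists[OF permutes_adj_swap[OF v i(1)]] by blast
  have "word_perm (js @ [i]) = v" by (simp add: js fun_eq_iff)
  then show ?thesis using that[of js] js ninv_descent[OF v i] i by simp
qed

text \<open>Lets each vanishing argument about sources be reused for targets.\<close>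

lemma TL_pair_beta_inv:
  assumes v: "v permutes {1..n}" "avoids_321 n v"
  shows "TL_pair n L N P Q (TL_beta n v) = TL_pair n P Q L N (TL_beta n (inv' v))"
proof -
  obtain js where js: "js \<in> lists {1..<n}" "word_perm js = v" "length js = ninv n v"
      "TL_beta n v = TL_word n js"
    using TL_beta_eq_word[OF v(1)] by blast
  have "TL_beta n (inv' v) = TL_word n (rev js)"
    using js inv_word_perm[of js] ninv_inv[OF v(1)]
    by (intro TL_beta_eq_any_word permutes_inv avoids_321_inv v) (auto simp: in_lists_conv_set)
  then show ?thesis using TL_pair_transpose[OF js(1)] js(4) by simp
qed

text \<open>The sets \<open>L\<close>, \<open>M\<close>, \<open>N\<close> below are the maximal runs
  of positions on which the permutation of the theorem ascends, and \<open>P\<close>,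
  \<open>M'\<close>, \<open>Q\<close> are those of its inverse.\<close>

locale two_swaps =
  fixes a b c d e n :: nat
  assumes pos: "1 \<le> a" "1 \<le> b" "1 \<le> c" "1 \<le> d" and n: "n = a + b + e + c + d"
begin

abbreviation "L \<equiv> {1..a}"
abbreviation "M \<equiv> {a + 1..a + b + e + c}"
abbreviation "N \<equiv> {a + b + e + c + 1..n}"
abbreviation "P \<equiv> {1..b}"
abbreviation "M' \<equiv> {b + 1..a + b + e + d}"
abbreviation "Q \<equiv> {a + b + e + d + 1..n}"

text \<open>Inverting the permutation exchanges sources and targets, that is, \<open>a\<close> with
  \<open>b\<close> and \<open>c\<close> with \<open>d\<close>.\<close>

lemma swap_sets: "two_swaps b a d c e n"
  using pos n by unfold_locales auto

lemma finite_disjoint: "finite L" "finite N" "finite P" "finite Q" "L \<inter> N = {}" "P \<inter> Q = {}"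
  using n by auto

lemma pair_refl_perm:
  assumes u: "u permutes {1..n}"
  shows "TL_pair n L N P Q (refl_perm n u) = of_int (sign u) *
    (if (\<exists>i\<in>L. u i \<in> P) \<or> (\<exists>i\<in>N. u i \<in> Q) then 0
     else of_nat ((card {i \<in> L. u i \<in> Q} + card {i \<in> N. u i \<in> P}) choose card {i \<in> L. u i \<in> Q}))"
  unfolding TL_pair_refl_perm[OF u finite_disjoint(1-4)]
    sum_colourings[OF permutes_inj[OF u] finite_disjoint] ..

text \<open>Every position of \<open>L\<close> is inverted with each of the \<open>b\<close>
  positions taking values in \<open>P\<close>, and every position of \<open>N\<close> with each of
  the \<open>c\<close> positions taking values in \<open>Q\<close>. Pairs in
  \<open>A \<times> B\<close> are counted twice; the further inversions \<open>A \<times> C\<close>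
  make up for this, because \<open>C\<close> is at least as large as \<open>B\<close>.\<close>

lemma ninv_ge:
  assumes u: "u permutes {1..n}" and LP: "\<And>i. i \<in> L \<Longrightarrow> u i \<notin> P" and NQ: "\<And>i. i \<in> N \<Longrightarrow> u i \<notin> Q"
  shows "a * b + c * d \<le> ninv n u"
proof -
  let ?pre = "\<lambda>X. {k \<in> {1..n}. u k \<in> X}"
  have range: "u k \<in> {1..n}" if "k \<in> {1..n}" for k using permutes_in_image[OF u, of k] that by simp
  have card_pre: "card (?pre X) = card X" if X: "X \<subseteq> {1..n}" for X
  proof -
    have "X \<subseteq> u ` {1..n}" using X by (simp only: permutes_image[OF u])
    then have "u ` ?pre X = X" by blast
    then show ?thesis
      using card_image[OF inj_on_subset[OF permutes_inj[OF u]], of "?pre X"] by simp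
  qed
  have cP: "card (?pre P) = b" and cQ: "card (?pre Q) = c"
    using card_pre[of P] card_pre[of Q] n by auto
  define A where "A = {i \<in> L. u i \<in> Q}"
  define B where "B = {i \<in> N. u i \<in> P}"
  define C where "C = {i \<in> M. u i \<in> M'}"
  have fin: "finite A" "finite B" "finite C" by (auto simp: A_def B_def C_def)
  \<comment> \<open>Of the \<open>b + e + c\<close> positions in \<open>M\<close>, at most
    \<open>b - card B\<close> have values in \<open>P\<close> and at most \<open>c\<close> have
    values in \<open>Q\<close>.\<close>
  have C: "card B \<le> card C"
  proof -
    define MP where "MP = {i \<in> M. u i \<in> P}"
    define MQ where "MQ = {i \<in> M. u i \<in> Q}"
    have "M \<subseteq> (MP \<union> MQ) \<union> C"
    proof
      fix i assume i: "i \<in> M"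
      then have "u i \<in> {1..n}" using range[of i] n by auto
      then show "i \<in> (MP \<union> MQ) \<union> C" using i n by (auto simp: MP_def MQ_def C_def)
    qed
    then have "card M \<le> card ((MP \<union> MQ) \<union> C)" by (intro card_mono) (auto simp: MP_def MQ_def C_def)
    also have "\<dots> \<le> card MP + card MQ + card C"
      by (meson add_le_mono card_Un_le le_trans order_refl)
    finally have 1: "b + e + c \<le> card MP + card MQ + card C" by simp
    have "card (MP \<union> B) = card MP + card B"
      by (rule card_Un_disjoint) (auto simp: MP_def B_def)
    moreover have "card (MP \<union> B) \<le> card (?pre P)"
      using n by (intro card_mono) (auto simp: MP_def B_def)
    moreover have "card MQ \<le> card (?pre Q)" using n by (intro card_mono) (auto simp: MQ_def)
    ultimately show ?thesis using 1 cP cQ by linarith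
  qed
  let ?U1 = "L \<times> ?pre P" and ?U2 = "?pre Q \<times> N" and ?U3 = "A \<times> C"
  have U12: "card (?U1 \<union> ?U2) + card A * card B = a * b + c * d"
  proof -
    have "?U1 \<inter> ?U2 = A \<times> B" using n by (auto simp: A_def B_def)
    then show ?thesis
      using card_Un_Int[of ?U1 ?U2] cP cQ n by (simp add: card_cartesian_product)
  qed
  have "card ((?U1 \<union> ?U2) \<union> ?U3) = card (?U1 \<union> ?U2) + card ?U3"
    by (rule card_Un_disjoint) (auto simp: A_def C_def)
  moreover have "card ((?U1 \<union> ?U2) \<union> ?U3) \<le> card (inversions n u)"
  proof (rule card_mono, simp, rule subsetI)
    fix p assume "p \<in> (?U1 \<union> ?U2) \<union> ?U3"
    then consider i k where "p = (i, k)" "i \<in> L" "k \<in> {1..n}" "u k \<in> P"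
      | i k where "p = (k, i)" "k \<in> {1..n}" "u k \<in> Q" "i \<in> N"
      | i k where "p = (i, k)" "i \<in> L" "u i \<in> Q" "k \<in> M" "u k \<in> M'"
      by (auto simp: A_def C_def)
    then show "p \<in> inversions n u"
    proof cases
      case 1
      then have "k \<notin> L" using LP by blast
      moreover have "u i \<notin> P" "u i \<in> {1..n}" using LP range[of i] 1 n by auto
      ultimately show ?thesis using 1 n by (auto simp: inversions_def)
    next
      case 2
      then have "k \<notin> N" using NQ by blast
      moreover have "u i \<notin> Q" "u i \<in> {1..n}" using NQ range[of i] 2 n by auto
      ultimately show ?thesis using 2 n by (auto simp: inversions_def)
    next
      case 3
      then show ?thesis using n by (auto simp: inversions_def)
    qed
  qed
  moreover have "card A * card B \<le> card ?U3" using C by (simp add: card_cartesian_product)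
  ultimately show ?thesis using U12 unfolding ninv_def by linarith
qed

end

text \<open>The hypotheses on \<open>v\<close> single out the basis elements at which \<open>TL_pair\<close> does not vanish merely by
  antisymmetry or because \<open>v\<close> fixes an end point.\<close>

locale block_perm = two_swaps +
  fixes v :: "nat \<Rightarrow> nat"
  assumes v: "v permutes {1..n}" and avoids: "avoids_321 n v"
    and asc: "ascends_off n a (a + b + e + c) v"
    and asc_inv: "ascends_off n b (a + b + e + d) (inv' v)"
    and LP: "\<And>i. i \<in> L \<Longrightarrow> v i \<notin> P" and NQ: "\<And>i. i \<in> N \<Longrightarrow> v i \<notin> Q"
begin

lemma range: "k \<in> {1..n} \<Longrightarrow> v k \<in> {1..n}"
  using permutes_in_image[OF v, of k] by simp

lemma preimage: assumes "y \<in> {1..n}" obtains k where "k \<in> {1..n}" "v k = y"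
proof -
  have "y \<in> v ` {1..n}" using assms by (simp only: permutes_image[OF v])
  then show ?thesis using that by blast
qed

lemma inj: "inj_on v X"
  using permutes_inj[OF v] by (rule inj_on_subset) simp

lemma mono_sources:
  assumes "x < y" "x \<in> L \<and> y \<in> L \<or> x \<in> M \<and> y \<in> M \<or> x \<in> N \<and> y \<in> N"
  shows "v x < v y"
  by (rule ascends_off_mono[OF asc]) (use assms n in auto)

lemma mono_targets:
  assumes xy: "x < y" "x \<in> {1..n}" "y \<in> {1..n}"
    and "v x \<in> P \<and> v y \<in> P \<or> v x \<in> M' \<and> v y \<in> M' \<or> v x \<in> Q \<and> v y \<in> Q"
  shows "v x < v y"
proof (rule ccontr)
  assume "\<not> v x < v y"
  then have "v y < v x" using xy permutes_inj_iff[OF v, of x y] by auto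
  then have "inv' v (v y) < inv' v (v x)"
    by (intro ascends_off_mono[OF asc_inv]) (use assms range[of x] range[of y] n in auto)
  then show False using xy permutes_inverses(2)[OF v] by simp
qed

text \<open>Were both crossings present, a position of \<open>M\<close> with a value in
  \<open>M'\<close> would complete a 321 pattern. All \<open>b + e + c\<close> values on
  \<open>M\<close> would then have to fit into \<open>P\<close> and \<open>Q\<close> with one
  element removed from each.\<close>

lemma LQ_imp_NP_empty:
  assumes i: "i \<in> L" "v i \<in> Q" and k: "k \<in> N"
  shows "v k \<notin> P"
proof
  assume vk: "v k \<in> P"
  have "v ` M \<subseteq> (P - {v k}) \<union> (Q - {v i})"
  proof (rule image_subsetI)
    fix j assume j: "j \<in> M"
    have ne: "v j \<noteq> v k" "v j \<noteq> v i" using permutes_inj_iff[OF v] i j k by auto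
    have "v j \<notin> M'"
    proof
      assume "v j \<in> M'"
      then have "v i > v j" "v j > v k" "i < j" "j < k" using i j k vk by auto
      moreover have "i \<in> {1..n}" "j \<in> {1..n}" "k \<in> {1..n}" using i j k n by auto
      ultimately show False using avoids unfolding avoids_321_def by blast
    qed
    then show "v j \<in> (P - {v k}) \<union> (Q - {v i})" using range[of j] j ne n by auto
  qed
  then have "card (v ` M) \<le> card ((P - {v k}) \<union> (Q - {v i}))" by (intro card_mono) auto
  also have "\<dots> \<le> card (P - {v k}) + card (Q - {v i})" by (rule card_Un_le)
  also have "\<dots> = (b - 1) + (c - 1)" using vk i n by simp
  finally show False using card_image[OF inj, of M] pos by simp
qed

text \<open>All of \<open>P\<close> is attained on \<open>M\<close>, where \<open>v\<close> is
  increasing, so it is attained on the first \<open>b\<close> positions of \<open>M\<close>.\<close>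

lemma first_M_to_P:
  assumes NP: "\<And>k. k \<in> N \<Longrightarrow> v k \<notin> P" and k: "k \<in> {a + 1..a + b}"
  shows "v k \<in> P"
proof (rule ccontr)
  assume vk: "v k \<notin> P"
  have "P \<subseteq> v ` {a + 1..k - 1}"
  proof
    fix y assume y: "y \<in> P"
    then have "y \<in> {1..n}" using n by auto
    then obtain j where j: "j \<in> {1..n}" "v j = y" by (rule preimage)
    have "j \<notin> L" "j \<notin> N" using LP[of j] NP[of j] j y by blast+
    then have "j \<in> M" using j n by auto
    moreover have "\<not> k \<le> j"
    proof
      assume "k \<le> j"
      then have "v k \<le> v j" using mono_sources[of k j] k \<open>j \<in> M\<close> by (cases "k = j") auto
      then show False using vk y j range[of k] k n by auto
    qed
    ultimately show "y \<in> v ` {a + 1..k - 1}" using j by auto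
  qed
  then have "card P \<le> card {a + 1..k - 1}" by (meson card_image_le card_mono finite_atLeastAtMost finite_imageI le_trans)
  then show False using k by auto
qed

lemma image_first_M:
  assumes "\<And>k. k \<in> N \<Longrightarrow> v k \<notin> P"
  shows "v ` {a + 1..a + b} = P"
proof (rule card_subset_eq)
  show "v ` {a + 1..a + b} \<subseteq> P" using first_M_to_P[OF assms] by blast
  show "card (v ` {a + 1..a + b}) = card P" using card_image[OF inj, of "{a + 1..a + b}"] by simp
qed simp

text \<open>By monotonicity the sources sent to \<open>Q\<close> are the last \<open>A\<close>
  positions of \<open>L\<close>, and they pass over \<open>b + A\<close> positions of
  \<open>M\<close>, as \<open>word_act_move_block\<close> requires. A nonzero entry then has at
  least \<open>A\<close> fewer coloured targets in \<open>P\<close> than coloured sources in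
  \<open>L\<close>, and with \<open>A > 0\<close> no colouring is balanced.\<close>

lemma pair_zero_if_LQ:
  assumes i0: "i0 \<in> L" "v i0 \<in> Q"
  shows "TL_pair n L N P Q (TL_beta n v) = 0"
proof -
  have NP: "v k \<notin> P" if "k \<in> N" for k using LQ_imp_NP_empty[OF i0 that] .
  define A where "A = card {i \<in> L. v i \<in> Q}"
  define x where "x = a - A"
  have "A \<le> card L" unfolding A_def by (rule card_mono) auto
  then have ax: "a = x + A" by (simp add: x_def)
  have A0: "A > 0" using i0 unfolding A_def card_gt_0_iff by auto
  have toQ: "v i \<in> Q" if i: "i \<in> {x<..a}" for i
  proof (rule ccontr)
    assume vi: "v i \<notin> Q"
    have "{i \<in> L. v i \<in> Q} \<subseteq> {i + 1..a}"
    proof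
      fix j assume j: "j \<in> {i \<in> L. v i \<in> Q}"
      have "\<not> j \<le> i"
      proof
        assume "j \<le> i"
        then have "v j \<le> v i" using mono_sources[of j i] i j by (cases "i = j") auto
        then show False using vi j range[of i] i n by auto
      qed
      then show "j \<in> {i + 1..a}" using j by auto
    qed
    then have "A \<le> card {i + 1..a}" unfolding A_def by (rule card_mono[rotated]) simp
    then show False using i by (auto simp: ax)
  qed
  have notQ: "v i \<notin> Q" if i: "i \<in> {1..x}" for i
  proof
    assume vi: "v i \<in> Q"
    have "{i..a} \<subseteq> {i \<in> L. v i \<in> Q}"
    proof
      fix j assume j: "j \<in> {i..a}"
      then have "v i \<le> v j" using mono_sources[of i j] i by (cases "i = j") auto
      then show "j \<in> {i \<in> L. v i \<in> Q}" using vi range[of j] i j n by auto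
    qed
    then have "card {i..a} \<le> A" unfolding A_def by (rule card_mono[rotated]) simp
    then show False using i ax by auto
  qed
  have Ac: "A \<le> c"
  proof -
    have "v ` {x<..a} \<subseteq> Q" using toQ by blast
    from card_mono[OF _ this] show ?thesis using card_image[OF inj, of "{x<..a}"] n ax by simp
  qed
  \<comment> \<open>Otherwise all of \<open>M\<close> from \<open>k\<close> on would go to
    \<open>Q\<close> too. Together with the \<open>A\<close> sources from \<open>L\<close> these are
    more than \<open>c\<close> positions.\<close>
  have M_notQ: "v k \<notin> Q" if k: "k \<in> {a<..a + b + A}" for k
  proof
    assume vk: "v k \<in> Q"
    have "v ` ({k..a + b + e + c} \<union> {x<..a}) \<subseteq> Q"
    proof (rule image_subsetI)
      fix j assume "j \<in> {k..a + b + e + c} \<union> {x<..a}"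
      then show "v j \<in> Q"
      proof
        assume j: "j \<in> {k..a + b + e + c}"
        then have "v k \<le> v j" using mono_sources[of k j] k by (cases "k = j") auto
        then show "v j \<in> Q" using vk range[of j] j k n by auto
      qed (rule toQ)
    qed
    from card_mono[OF _ this] have "card ({k..a + b + e + c} \<union> {x<..a}) \<le> c"
      using card_image[OF inj, of "{k..a + b + e + c} \<union> {x<..a}"] n by simp
    moreover have "card ({k..a + b + e + c} \<union> {x<..a}) = card {k..a + b + e + c} + card {x<..a}"
      by (rule card_Un_disjoint) (use k in auto)
    ultimately show False using k ax Ac by auto
  qed
  have img: "v ` ({1..x} \<union> {a<..a + b}) = {1..x + b}"
  proof (rule card_subset_eq)
    \<comment> \<open>The value lies in \<open>M'\<close>, where the inverse is increasing. All
      values from \<open>b + 1\<close> up to \<open>v i - 1\<close> are thus taken before position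
      \<open>i\<close>, whence \<open>v i \<le> b + i\<close>.\<close>
    have "v i \<le> x + b" if i: "i \<in> {1..x}" for i
    proof (rule ccontr)
      assume gt: "\<not> v i \<le> x + b"
      have vi: "v i \<in> M'" using LP[of i] notQ[OF i] range[of i] i ax n by auto
      have "{b + 1..v i - 1} \<subseteq> v ` {1..i - 1}"
      proof
        fix y assume y: "y \<in> {b + 1..v i - 1}"
        then have "y \<in> {1..n}" using vi n by auto
        then obtain j where j: "j \<in> {1..n}" "v j = y" by (rule preimage)
        have "j < i"
        proof (rule ccontr)
          assume "\<not> j < i"
          then have "i < j" using j y by (cases "i = j") auto
          then have "v i < v j" using mono_targets[of i j] j y vi i ax n by auto
          then show False using j y by auto
        qed
        then show "y \<in> v ` {1..i - 1}" using j by auto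
      qed
      then have "card {b + 1..v i - 1} \<le> card {1..i - 1}"
        by (meson card_image_le card_mono finite_atLeastAtMost finite_imageI le_trans)
      then show False using gt i by auto
    qed
    moreover have "v k \<le> b" if "k \<in> {a<..a + b}" for k using first_M_to_P[OF NP, of k] that by auto
    ultimately have "v k \<le> x + b" "1 \<le> v k" if "k \<in> {1..x} \<union> {a<..a + b}" for k
      using that range[of k] ax n by fastforce+
    then show "v ` ({1..x} \<union> {a<..a + b}) \<subseteq> {1..x + b}" by auto
    have "card ({1..x} \<union> {a<..a + b}) = card {1..x} + card {a<..a + b}"
      by (rule card_Un_disjoint) (use ax in auto)
    then show "card (v ` ({1..x} \<union> {a<..a + b})) = card {1..x + b}"
      using card_image[OF inj, of "{1..x} \<union> {a<..a + b}"] by simp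
  qed simp
  have "\<exists>js \<in> lists {1..<n}. word_perm js = v \<and> length js = ninv n v \<and>
    (\<forall>G s m. (\<forall>T. G T \<noteq> 0 \<longrightarrow> T \<inter> {x + A<..x + A + b + A} = {} \<and> card (T \<inter> {1..x + A}) + s = m) \<longrightarrow>
      (\<forall>T. word_act js G T \<noteq> 0 \<longrightarrow> card (T \<inter> {1..x + b}) + A + s = m))"
  proof (rule word_act_move_block[OF v])
    show "x + A + b + A \<le> n" using ax Ac n by simp
    show "v ` ({1..x} \<union> {x + A<..x + A + b}) = {1..x + b}" using img ax by simp
    show "\<forall>i\<in>{x<..x + A}. \<forall>k\<in>{x + A<..x + A + b + A}. v k < v i"
    proof (intro ballI)
      fix i k assume "i \<in> {x<..x + A}" "k \<in> {x + A<..x + A + b + A}"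
      then show "v k < v i"
        using toQ[of i] M_notQ[of k] range[of k] ax Ac n by auto
    qed
  qed
  then obtain js where js: "js \<in> lists {1..<n}" "word_perm js = v" "length js = ninv n v"
    and act: "\<forall>G s m. (\<forall>T. G T \<noteq> 0 \<longrightarrow>
        T \<inter> {x + A<..x + A + b + A} = {} \<and> card (T \<inter> {1..x + A}) + s = m) \<longrightarrow>
      (\<forall>T. word_act js G T \<noteq> 0 \<longrightarrow> card (T \<inter> {1..x + b}) + A + s = m)"
    by (elim bexE conjE)
  have "word_act js (point_mass S) T = 0"
    if S: "S \<subseteq> L \<union> N" and T: "card (T \<inter> P) = card (S \<inter> L)" for S T
  proof (rule ccontr)
    assume ne: "word_act js (point_mass S) T \<noteq> 0"
    have "card (T \<inter> {1..x + b}) + A + 0 = card (S \<inter> L)"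
    proof (rule act[rule_format, OF _ ne])
      fix U assume "point_mass S U \<noteq> 0"
      then have "U = S" by (auto simp: point_mass_def split: if_splits)
      then show "U \<inter> {x + A<..x + A + b + A} = {} \<and> card (U \<inter> {1..x + A}) + 0 = card (S \<inter> L)"
        using S ax Ac by auto
    qed
    moreover have "card (T \<inter> P) \<le> card (T \<inter> {1..x + b})" by (rule card_mono) auto
    ultimately show False using T A0 by simp
  qed
  then have "TL_pair n L N P Q (TL_word n js) = 0"
    unfolding TL_pair_word[OF js(1)] by (intro sum.neutral ballI) auto
  then show ?thesis using TL_beta_eq_any_word[OF v avoids js] by simp
qed

end

section \<open>Inversions of the distinguished permutation\<close>

context two_swaps
begin

abbreviation "M1 \<equiv> {a + 1..a + b}"
abbreviation "M2 \<equiv> {a + b + 1..a + b + e}"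
abbreviation "M3 \<equiv> {a + b + e + 1..a + b + e + c}"

text \<open>For \<open>x < y\<close> these turn out to be exactly the inversions of the permutation
  in the theorem, by \<open>w_order\<close>.\<close>

definition swapped :: "nat \<Rightarrow> nat \<Rightarrow> bool" where
  "swapped x y \<longleftrightarrow> x \<in> L \<and> y \<in> M1 \<or> x \<in> M3 \<and> y \<in> N"

lemma not_swapped_cases:
  assumes "x < y" "x \<in> {1..n}" "y \<in> {1..n}" "\<not> swapped x y"
  obtains (source) "x \<in> L \<and> y \<in> L \<or> x \<in> M \<and> y \<in> M \<or> x \<in> N \<and> y \<in> N"
    | (L2) "x \<in> L" "y \<in> M2" | (L3) "x \<in> L" "y \<in> M3" | (LN) "x \<in> L" "y \<in> N"
    | (1) "x \<in> M1" "y \<in> N" | (2) "x \<in> M2" "y \<in> N"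
proof -
  consider "x \<in> L" | "x \<in> M" | "x \<in> N" using assms n by fastforce
  then show ?thesis
  proof cases
    case 1
    consider "y \<in> L" | "y \<in> M1" | "y \<in> M2" | "y \<in> M3" | "y \<in> N" using assms n by fastforce
    then show ?thesis
      by cases (use 1 assms(4) source L2 L3 LN in \<open>auto simp only: swapped_def\<close>)
  next
    case 2
    then consider "y \<in> M" | "x \<in> M1" "y \<in> N" | "x \<in> M2" "y \<in> N" | "x \<in> M3" "y \<in> N"
      using assms n by fastforce
    then show ?thesis
      by cases (use 2 assms(4) source that(5,6) in \<open>auto simp only: swapped_def\<close>)
  next
    case 3
    then have "y \<in> N" using assms by auto
    then show ?thesis using 3 source by blast
  qed
qed

end

context block_perm
begin

lemma last_M_to_Q:
  assumes LQ: "\<And>i. i \<in> L \<Longrightarrow> v i \<notin> Q" and k: "k \<in> M3"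
  shows "v k \<in> Q"
proof (rule ccontr)
  assume vk: "v k \<notin> Q"
  have "Q \<subseteq> v ` {k + 1..a + b + e + c}"
  proof
    fix y assume y: "y \<in> Q"
    then have "y \<in> {1..n}" using n by auto
    then obtain j where j: "j \<in> {1..n}" "v j = y" by (rule preimage)
    have "j \<notin> L" "j \<notin> N" using LQ[of j] NQ[of j] j y by blast+
    then have "j \<in> M" using j n by auto
    moreover have "\<not> j \<le> k"
    proof
      assume "j \<le> k"
      then have "v j \<le> v k" using mono_sources[of j k] k \<open>j \<in> M\<close> by (cases "k = j") auto
      then show False using vk y j range[of k] k n by auto
    qed
    ultimately show "y \<in> v ` {k + 1..a + b + e + c}" using j by auto
  qed
  then have "card Q \<le> card {k + 1..a + b + e + c}"
    by (meson card_image_le card_mono finite_atLeastAtMost finite_imageI le_trans)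
  then show False using k n by auto
qed

lemma image_last_M:
  assumes "\<And>i. i \<in> L \<Longrightarrow> v i \<notin> Q"
  shows "v ` M3 = Q"
proof (rule card_subset_eq)
  show "v ` M3 \<subseteq> Q" using last_M_to_Q[OF assms] by blast
  show "card (v ` M3) = card Q" using card_image[OF inj, of M3] n by simp
qed simp

text \<open>Without crossings the first \<open>b\<close> positions of \<open>M\<close> fill
  \<open>P\<close> and the last \<open>c\<close> fill \<open>Q\<close>. Everything else goes to
  \<open>M'\<close>, where the order is preserved, so all comparisons are determined.\<close>

lemma order_if_no_crossing:
  assumes NP: "\<And>k. k \<in> N \<Longrightarrow> v k \<notin> P" and LQ: "\<And>i. i \<in> L \<Longrightarrow> v i \<notin> Q"
    and xy: "x < y" "x \<in> {1..n}" "y \<in> {1..n}"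
  shows "v y < v x \<longleftrightarrow> swapped x y"
proof -
  have toM': "v k \<in> M'" if "k \<in> L \<or> k \<in> N \<or> k \<in> M2" for k
  proof -
    have k: "k \<in> {1..n}" using that n by auto
    have "v k \<notin> P"
    proof
      assume "v k \<in> P"
      then have "v k \<in> v ` M1" using image_first_M[OF NP] by simp
      then have "k \<in> M1" using permutes_inj_iff[OF v] by auto
      then show False using that LP[of k] NP[of k] \<open>v k \<in> P\<close> by auto
    qed
    moreover have "v k \<notin> Q"
    proof
      assume "v k \<in> Q"
      then have "v k \<in> v ` M3" using image_last_M[OF LQ] by simp
      then have "k \<in> M3" using permutes_inj_iff[OF v] by auto
      then show False using that LQ[of k] NQ[of k] \<open>v k \<in> Q\<close> by auto
    qed
    ultimately show ?thesis using range[OF k] n by auto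
  qed
  have toP: "v k \<in> P" if "k \<in> M1" for k by (rule first_M_to_P[OF NP that])
  have toQ: "v k \<in> Q" if "k \<in> M3" for k by (rule last_M_to_Q[OF LQ that])
  show ?thesis
  proof (cases "swapped x y")
    case True
    then consider "x \<in> L" "y \<in> M1" | "x \<in> M3" "y \<in> N" by (auto simp: swapped_def)
    then have "v y < v x"
    proof cases
      case 1
      then show ?thesis using toM'[of x] toP[of y] by auto
    next
      case 2
      then show ?thesis using toM'[of y] toQ[of x] by auto
    qed
    then show ?thesis using True by simp
  next
    case False
    from xy False have "v x < v y"
    proof (cases rule: not_swapped_cases)
      case source
      then show ?thesis by (rule mono_sources[OF xy(1)])
    next
      case L2
      then show ?thesis using toM' by (intro mono_targets xy) blast
    next
      case L3
      then show ?thesis using toM'[of x] toQ[of y] by auto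
    next
      case LN
      then show ?thesis using toM' by (intro mono_targets xy) blast
    next
      case 1
      then show ?thesis using toP[of x] toM'[of y] by auto
    next
      case 2
      then show ?thesis using toM' by (intro mono_targets xy) blast
    qed
    then show ?thesis using False by simp
  qed
qed

end

text \<open>If both permutations order all pairs alike, one composed with the inverse of the other
  is increasing.\<close>

lemma permutes_eqI_order:
  fixes n :: nat
  assumes v: "v permutes {1..n}" and w: "w permutes {1..n}"
    and order: "\<And>x y. \<lbrakk>x < y; x \<in> {1..n}; y \<in> {1..n}\<rbrakk> \<Longrightarrow> v y < v x \<longleftrightarrow> w y < w x"
  shows "v = w"
proof -
  have "v \<circ> inv' w = id"
  proof (rule increasing_permutes_id[OF permutes_compose[OF permutes_inv[OF w] v]])
    fix i assume i: "i \<in> {1..<n}"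
    define x where "x = inv' w i"
    define y where "y = inv' w (Suc i)"
    have xy: "x \<in> {1..n}" "y \<in> {1..n}" "w x = i" "w y = Suc i"
      using i permutes_in_image[OF permutes_inv[OF w], of i]
        permutes_in_image[OF permutes_inv[OF w], of "Suc i"] permutes_inverses(1)[OF w]
      by (simp_all add: x_def y_def)
    then have "x \<noteq> y" by auto
    then have ne: "v x \<noteq> v y" using permutes_inj_iff[OF v] by auto
    consider "x < y" | "y < x" using \<open>x \<noteq> y\<close> by linarith
    then have "v x < v y"
    proof cases
      case 1
      then show ?thesis using order[OF 1] xy ne by auto
    next
      case 2
      then show ?thesis using order[OF 2] xy by auto
    qed
    then show "(v \<circ> inv' w) i < (v \<circ> inv' w) (Suc i)" by (simp add: x_def y_def)
  qed
  then have "v \<circ> inv' w \<circ> w = w" by simp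
  then show ?thesis using permutes_inv_o(2)[OF w] by (simp only: comp_assoc comp_id)
qed

locale swap_perm = two_swaps +
  fixes w :: "nat \<Rightarrow> nat"
  assumes w: "w permutes {1..n}"
    and w_values: "\<And>i. i \<in> L \<Longrightarrow> w i = b + i" "\<And>i. i \<in> M1 \<Longrightarrow> w i = i - a"
      "\<And>i. i \<in> M2 \<Longrightarrow> w i = i" "\<And>i. i \<in> M3 \<Longrightarrow> w i = i + d" "\<And>i. i \<in> N \<Longrightarrow> w i = i - c"
begin

lemma w_order:
  assumes xy: "x < y" "x \<in> {1..n}" "y \<in> {1..n}"
  shows "w y < w x \<longleftrightarrow> swapped x y"
proof (cases "swapped x y")
  case True
  then consider "x \<in> L" "y \<in> M1" | "x \<in> M3" "y \<in> N" by (auto simp: swapped_def)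
  then have "w y < w x" by cases (use w_values[of x] w_values[of y] pos n in auto)
  then show ?thesis using True by simp
next
  case False
  have blocks: "z \<in> L \<or> z \<in> M1 \<or> z \<in> M2 \<or> z \<in> M3 \<or> z \<in> N" if "z \<in> {1..n}" for z
    using that n by auto
  from xy False have "w x < w y"
  proof (cases rule: not_swapped_cases)
    case source
    then show ?thesis
      using blocks[OF xy(2)] blocks[OF xy(3)] w_values[of x] w_values[of y] xy(1) n
      by (elim disjE conjE) auto
  qed (use w_values[of x] w_values[of y] xy n in auto)
  then show ?thesis using False by simp
qed

lemma inversions_w: "inversions n w \<subseteq> L \<times> M1 \<union> M3 \<times> N"
proof
  fix p assume p: "p \<in> inversions n w"
  then obtain x y where xy: "p = (x, y)" by (cases p)
  then have "swapped x y" using w_order[of x y] p by (auto simp: inversions_def)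
  then show "p \<in> L \<times> M1 \<union> M3 \<times> N" using xy by (auto simp: swapped_def)
qed

lemma ninv_w_le: "ninv n w \<le> a * b + c * d"
proof -
  have "ninv n w \<le> card (L \<times> M1 \<union> M3 \<times> N)"
    unfolding ninv_def by (intro card_mono inversions_w) auto
  also have "\<dots> \<le> card (L \<times> M1) + card (M3 \<times> N)" by (rule card_Un_le)
  finally show ?thesis using n by (simp add: card_cartesian_product)
qed

lemma w_avoids: "avoids_321 n w"
  unfolding avoids_321_def
proof (rule notI, elim bexE conjE)
  fix i j k
  assume "i \<in> {1..n}" "j \<in> {1..n}" "k \<in> {1..n}" "i < j" "j < k" "w j < w i" "w k < w j"
  then have "swapped i j" "swapped j k" using w_order by blast+
  \<comment> \<open>The second position of a swapped pair lies in \<open>M1\<close> or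
    \<open>N\<close> and so is never the first position of another.\<close>
  then show False by (auto simp: swapped_def)
qed

lemma w_no_LP_NQ_LQ:
  "i \<in> L \<Longrightarrow> w i \<notin> P" "i \<in> N \<Longrightarrow> w i \<notin> Q" "i \<in> L \<Longrightarrow> w i \<notin> Q"
  using w_values(1,5)[of i] n by auto

lemma pair_refl_perm_w: "TL_pair n L N P Q (refl_perm n w) = of_int (sign w)"
proof -
  have "{i \<in> L. w i \<in> Q} = {}" using w_no_LP_NQ_LQ(3) by blast
  then have "card {i \<in> L. w i \<in> Q} = 0" by (simp only: card.empty)
  moreover have "\<not> ((\<exists>i\<in>L. w i \<in> P) \<or> (\<exists>i\<in>N. w i \<in> Q))"
    using w_no_LP_NQ_LQ(1,2) by blast
  ultimately show ?thesis by (simp only: pair_refl_perm[OF w]) simp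
qed

lemma pair_beta_w: "TL_pair n L N P Q (TL_beta n w) = of_int (sign w)"
proof -
  interpret ring "TL n" by (rule ring_TL)
  obtain js where js: "js \<in> lists {1..<n}" "word_perm js = w" "length js = ninv n w"
      "TL_beta n w = TL_word n js"
    using TL_beta_eq_word[OF w] by blast
  have "TL_pair n L N P Q (TL_word n js \<ominus>\<^bsub>TL n\<^esub> refl_word n js) = 0"
  proof (rule TL_pair_span_zero[OF short_refl_closed _ TL_word_minus_refl_word[OF js(1)]])
    fix Y assume "Y \<in> short_refl n (length js)"
    then obtain ks where ks: "ks \<in> lists {1..<n}" "length ks < ninv n w" "Y = refl_word n ks"
      using js(3) by (auto simp: short_refl_def)
    define u where "u = word_perm ks"
    have u: "u permutes {1..n}" unfolding u_def by (rule word_perm_permutes[OF ks(1)])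
    have "ninv n u < a * b + c * d"
      using ninv_word_perm_le[OF ks(1)] ks(2) ninv_w_le by (simp add: u_def)
    then have "(\<exists>i\<in>L. u i \<in> P) \<or> (\<exists>i\<in>N. u i \<in> Q)" using ninv_ge[OF u] by fastforce
    moreover have "Y = refl_perm n u" using refl_perm_word_perm[OF ks(1)] ks(3) by (simp add: u_def)
    ultimately show "TL_pair n L N P Q Y = 0" using pair_refl_perm[OF u] by simp
  qed
  moreover have "TL_word n js = (TL_word n js \<ominus>\<^bsub>TL n\<^esub> refl_word n js) \<oplus>\<^bsub>TL n\<^esub> refl_word n js"
    using TL_word_closed[OF js(1)] refl_word_closed[OF js(1)] by algebra
  ultimately have "TL_pair n L N P Q (TL_word n js) = TL_pair n L N P Q (refl_word n js)"
    using TL_pair_add[of "TL_word n js \<ominus>\<^bsub>TL n\<^esub> refl_word n js" n "refl_word n js" L N P Q]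
      TL_word_closed[OF js(1)] refl_word_closed[OF js(1)] by simp
  then show ?thesis using pair_refl_perm_w refl_perm_word_perm[OF js(1)] js by simp
qed

lemma pair_beta_zero:
  assumes v: "v permutes {1..n}" "avoids_321 n v" and "v \<noteq> w"
  shows "TL_pair n L N P Q (TL_beta n v) = 0"
proof -
  \<comment> \<open>Kept general in the blocks, so that it serves both \<open>v\<close> and, after
    transposition, its inverse.\<close>
  have right: "TL_pair n X Y X' Y' (TL_beta n u) = 0"
    if u: "u permutes {1..n}" "avoids_321 n u" and "\<not> ascends_off n p q u"
      and XY: "X = {1..p}" "Y = {q + 1..n}" for u p q X Y X' Y'
  proof -
    obtain i where i: "i \<in> {1..<n}" "i \<noteq> p" "i \<noteq> q" "\<not> u i < u (Suc i)"
      using \<open>\<not> ascends_off n p q u\<close> by (auto simp: ascends_off_def)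
    then have "u (Suc i) < u i" using ascent_or_descent[OF u(1), of i] by auto
    then obtain js where js: "js @ [i] \<in> lists {1..<n}" "word_perm (js @ [i]) = u"
        "length (js @ [i]) = ninv n u"
      using descent_last_letter[OF u(1) i(1)] by blast
    have "adj_swap i ` X = X" "adj_swap i ` Y = Y"
      using i unfolding XY by (intro adj_swap_image_fixed; auto)+
    then have "TL_pair n X Y X' Y' (TL_word n (js @ [i])) = 0" by (rule TL_pair_right_zero[OF js(1)])
    then show ?thesis using TL_beta_eq_any_word[OF u js] by simp
  qed
  have inv: "inv' v permutes {1..n}" "avoids_321 n (inv' v)"
    using permutes_inv[OF v(1)] avoids_321_inv[OF v] by auto
  have inv_v: "inv' v (v x) = x" "v (inv' v x) = x" for x
    using permutes_inverses[OF v(1)] by auto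
  have range: "v x \<in> {1..n} \<longleftrightarrow> x \<in> {1..n}" "inv' v x \<in> {1..n} \<longleftrightarrow> x \<in> {1..n}" for x
    using permutes_in_image[OF v(1), of x] permutes_in_image[OF inv(1), of x] by auto
  show ?thesis
  proof (cases "ascends_off n a (a + b + e + c) v \<and> ascends_off n b (a + b + e + d) (inv' v)")
    case False
    then show ?thesis
      using right[OF v, of a "a + b + e + c"] right[OF inv, of b "a + b + e + d"]
        TL_pair_beta_inv[OF v] by metis
  next
    case True
    then have asc: "ascends_off n a (a + b + e + c) v" "ascends_off n b (a + b + e + d) (inv' v)"
      by auto
    show ?thesis
    proof (cases "(\<exists>i\<in>L. v i \<in> P) \<or> (\<exists>i\<in>N. v i \<in> Q)")
      case True
      then consider i where "i \<in> L" "v i \<in> P" | i where "i \<in> N" "v i \<in> Q" by blast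
      then show ?thesis
      proof cases
        case 1
        \<comment> \<open>One hit from \<open>L\<close> to \<open>P\<close> can be pulled down to
          the corner: ascent on \<open>L\<close> puts \<open>v 1\<close> into \<open>P\<close>, and
          ascent of the inverse on \<open>P\<close> then gives \<open>inv' v 1 \<le> 1\<close>. The
          other case is the mirror image at \<open>n\<close>.\<close>
        have r1: "v 1 \<in> {1..n}" using range(1)[of 1] n pos by auto
        have "v 1 \<le> v i"
          using ascends_off_mono[OF asc(1), of 1 i] 1 n pos by (cases "i = 1") auto
        then have v1: "v 1 \<in> P" using 1 r1 by auto
        have r2: "inv' v 1 \<in> {1..n}" using range(2)[of 1] n pos by auto
        have "inv' v 1 \<le> inv' v (v 1)"
          using ascends_off_mono[OF asc(2), of 1 "v 1"] v1 n pos by (cases "v 1 = 1") auto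
        then have "inv' v 1 = 1" using r2 by (simp add: inv_v)
        then have "v 1 = 1" using inv_v(2)[of 1] by simp
        then show ?thesis
          using v1 pos n by (intro fixed_end_zero[OF v, of 1] finite_disjoint) auto
      next
        case 2
        have r1: "v n \<in> {1..n}" using range(1)[of n] n pos by auto
        have "v i \<le> v n"
          using ascends_off_mono[OF asc(1), of i n] 2 n pos by (cases "i = n") auto
        then have vn: "v n \<in> Q" using 2 r1 by auto
        have r2: "inv' v n \<in> {1..n}" using range(2)[of n] n pos by auto
        have "inv' v (v n) \<le> inv' v n"
          using ascends_off_mono[OF asc(2), of "v n" n] vn n pos by (cases "v n = n") auto
        then have "inv' v n = n" using r2 by (simp add: inv_v)
        then have "v n = n" using inv_v(2)[of n] by simp
        then show ?thesis
          using vn pos n by (intro fixed_end_zero[OF v, of n] finite_disjoint) auto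
      qed
    next
      case False
      then interpret V: block_perm a b c d e n v
        using v asc by unfold_locales auto
      have inv_block: "block_perm b a d c e n (inv' v)"
      proof (intro block_perm.intro swap_sets block_perm_axioms.intro inv)
        show "ascends_off n b (b + a + e + d) (inv' v)" using asc(2) by (simp add: add.commute)
        show "ascends_off n a (b + a + e + c) (inv' (inv' v))"
          using asc(1) by (simp add: add.commute permutes_inv_inv[OF v(1)])
        show "inv' v i \<notin> {1..a}" if "i \<in> {1..b}" for i
          using V.LP[of "inv' v i"] that by (auto simp: inv_v)
        show "inv' v i \<notin> {b + a + e + c + 1..n}" if "i \<in> {b + a + e + d + 1..n}" for i
          using V.NQ[of "inv' v i"] that by (auto simp: inv_v add.commute)
      qed
      show ?thesis
      proof (cases "\<exists>i\<in>L. v i \<in> Q")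
        case True
        then show ?thesis using V.pair_zero_if_LQ by blast
      next
        case LQ: False
        show ?thesis
        proof (cases "\<exists>k\<in>N. v k \<in> P")
          case True
          then obtain k where k: "k \<in> N" "v k \<in> P" by blast
          \<comment> \<open>For the inverse, the crossing from \<open>N\<close> to \<open>P\<close>
            becomes one from the first source block to the last target block.\<close>
          have "TL_pair n P Q L N (TL_beta n (inv' v)) = 0"
            using block_perm.pair_zero_if_LQ[OF inv_block, of "v k"] k
            by (simp add: inv_v add.commute)
          then show ?thesis using TL_pair_beta_inv[OF v] by simp
        next
          case NP: False
          have "v = w"
            using V.order_if_no_crossing w_order LQ NP
            by (intro permutes_eqI_order[OF v(1) w]) blast
          then show ?thesis using \<open>v \<noteq> w\<close> by contradiction
        qed
      qed
    qed
  qed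
qed

lemma TL_coeff_swap_perm:
  assumes u: "u permutes {1..n}"
  shows "TL_coeff n w u = of_int (sign w) * of_int (sign u) *
    (if (\<exists>i\<in>L. u i \<in> P) \<or> (\<exists>i\<in>N. u i \<in> Q) then 0
     else of_nat ((card {i \<in> L. u i \<in> Q} + card {i \<in> N. u i \<in> P}) choose card {i \<in> L. u i \<in> Q}))"
    (is "_ = _ * _ * ?H")
proof -
  have "TL_coeff n w u * of_int (sign w) = TL_pair n L N P Q (refl_perm n u)"
  proof (rule TL_coeff_eq_functional[OF TL_pair_add TL_pair_smult _ _ u])
    show "TL_pair n L N P Q (TL_beta n v) = (if v = w then of_int (sign w) else 0)"
      if "v \<in> avoiders_321 n" for v
      using that pair_beta_w pair_beta_zero[of v] by (auto simp: avoiders_321_def)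
    show "w \<in> avoiders_321 n" using w w_avoids by (simp add: avoiders_321_def)
  qed
  then have "TL_coeff n w u * of_int (sign w) = of_int (sign u) * ?H"
    unfolding pair_refl_perm[OF u] .
  then have "TL_coeff n w u * (of_int (sign w) * of_int (sign w))
      = of_int (sign w) * of_int (sign u) * ?H"
    by (simp only: mult_ac)
  moreover have "of_int (sign w) * of_int (sign w) = (1 :: complex)"
    by (metis of_int_1 of_int_mult sign_idempotent)
  ultimately show ?thesis by simp
qed

end

section \<open>From the immanant to its coefficients\<close>

lemma lookup_perm_monom:
  "Poly_Mapping.lookup (perm_monom n u) (i, j) = (if i \<in> {1..n} \<and> u i = j then 1 else 0)"
proof -
  have "Poly_Mapping.lookup (perm_monom n u) (i, j)
      = (\<Sum>k\<in>{1..n}. if k = i then (if u i = j then 1 else 0) else 0)"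
    unfolding perm_monom_def lookup_sum
    by (intro sum.cong refl) (auto simp: lookup_single when_def)
  then show ?thesis by simp
qed

text \<open>Distinct permutations have distinct monomials, so nothing else contributes to the
  coefficient of \<open>perm_monom n u\<close> in the immanant.\<close>

lemma perm_monom_inj:
  assumes u: "u permutes {1..n}" and v: "v permutes {1..n}" and eq: "perm_monom n u = perm_monom n v"
  shows "u = v"
proof
  fix i
  show "u i = v i"
  proof (cases "i \<in> {1..n}")
    case True
    show ?thesis
    proof (rule ccontr)
      assume "u i \<noteq> v i"
      then have "Poly_Mapping.lookup (perm_monom n v) (i, u i) = 0"
        by (subst lookup_perm_monom) auto
      moreover have "Poly_Mapping.lookup (perm_monom n u) (i, u i) = 1"
        using True by (subst lookup_perm_monom) simp
      ultimately show False unfolding eq by simp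
    qed
  next
    case False
    then show ?thesis using permutes_not_in[OF u] permutes_not_in[OF v] by simp
  qed
qed

lemma lookup_TL_imm:
  assumes "u permutes {1..n}"
  shows "Poly_Mapping.lookup (TL_imm n w) (perm_monom n u) = TL_coeff n w u"
proof -
  have "Poly_Mapping.lookup (TL_imm n w) (perm_monom n u)
      = (\<Sum>v\<in>sym_set n. if v = u then TL_coeff n w v else 0)"
    unfolding TL_imm_def lookup_sum
    using perm_monom_inj[OF _ assms] by (intro sum.cong refl) (auto simp: lookup_single when_def)
  also have "\<dots> = TL_coeff n w u" using assms finite_sym_set[of n] by simp
  finally show ?thesis .
qed

theorem theorem5p11:
  fixes a b c d e n :: nat and w u :: "nat \<Rightarrow> nat"
  assumes "a \<ge> 1" "b \<ge> 1" "c \<ge> 1" "d \<ge> 1"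
    and "a + b + c + d + e = n"
    and "w \<in> carrier (sym_group n)"
    and "map w [1..<n+1] =
           [b+1..<b+a+1] @ [1..<b+1] @ [b+a+1..<b+a+e+1] @ [n-c+1..<n+1] @ [n-c-d+1..<n-c+1]"
    and "u \<in> carrier (sym_group n)"
  shows "Poly_Mapping.lookup (TL_imm n w) (perm_monom n u) = TL_coeff n w u \<and>
    (if (\<exists>i\<in>{1..a}. u i \<in> {1..b}) \<or> (\<exists>i\<in>{n+1-d..n}. u i \<in> {n+1-c..n})
     then TL_coeff n w u = 0
     else TL_coeff n w u =
       (let A = card ({1..a} \<inter> u -` {n+1-c..n});
            B = card ({1..b} \<inter> u ` {n+1-d..n})
        in of_int (sign w) * of_int (sign u) * of_nat ((A + B) choose A)))"
proof -
  have w: "w permutes {1..n}" and u: "u permutes {1..n}"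
    using assms(6,8) by (simp_all add: sym_group_carrier)
  have n: "n = a + b + e + c + d" using assms(5) by simp
  have nc: "n - c = a + b + e + d" "a + b + e + d - d = a + b + e" using n by simp_all
  define l1 where "l1 = [b+1..<b+a+1]"
  define l2 where "l2 = [1..<b+1]"
  define l3 where "l3 = [b+a+1..<b+a+e+1]"
  define l4 where "l4 = [a+b+e+d+1..<n+1]"
  define l5 where "l5 = [a+b+e+1..<a+b+e+d+1]"
  note l_defs = l1_def l2_def l3_def l4_def l5_def
  have len: "length l1 = a" "length l2 = b" "length l3 = e" "length l4 = c" "length l5 = d"
    using n by (simp_all add: l_defs del: upt_Suc)
  \<comment> \<open>List indices start at 0 and positions at 1, hence the shift.\<close>
  have w_nth: "w (Suc k) = (l1 @ l2 @ l3 @ l4 @ l5) ! k" if "k < n" for k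
  proof -
    have "map w [1..<n+1] ! k = w (Suc k)" using that by (simp del: upt_Suc)
    then show ?thesis unfolding assms(7) l_defs nc by simp
  qed
  have w_blocks: "k < a \<Longrightarrow> w (Suc k) = b + Suc k"
    "k < b \<Longrightarrow> w (Suc (a + k)) = Suc k"
    "k < e \<Longrightarrow> w (Suc (a + (b + k))) = Suc (a + (b + k))"
    "k < c \<Longrightarrow> w (Suc (a + (b + (e + k)))) = Suc (a + (b + (e + (d + k))))"
    "k < d \<Longrightarrow> w (Suc (a + (b + (e + (c + k))))) = Suc (a + (b + (e + k)))" for k
    using n len
    by (simp_all add: w_nth nth_append) (simp_all add: l_defs add_ac del: upt_Suc)
  interpret swap_perm a b c d e n w
  proof (unfold_locales)
    show "n = a + b + e + c + d" by (rule n)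
    show "w i = b + i" if "i \<in> {1..a}" for i
    proof -
      define k where "k = i - Suc 0"
      have "i = Suc (0 + k)" "k < a" using that n unfolding k_def by (simp; linarith)+
      then show ?thesis using w_blocks(1)[of k] by (simp add: add.assoc)
    qed
    show "w i = i - a" if "i \<in> {a + 1..a + b}" for i
    proof -
      define k where "k = i - Suc a"
      have "i = Suc (a + k)" "k < b" using that n unfolding k_def by (simp; linarith)+
      then show ?thesis using w_blocks(2)[of k] by (simp add: add.assoc)
    qed
    show "w i = i" if "i \<in> {a + b + 1..a + b + e}" for i
    proof -
      define k where "k = i - Suc (a + b)"
      have "i = Suc ((a + b) + k)" "k < e" using that n unfolding k_def by (simp; linarith)+
      then show ?thesis using w_blocks(3)[of k] by (simp add: add.assoc)
    qed
    show "w i = i + d" if "i \<in> {a + b + e + 1..a + b + e + c}" for i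
    proof -
      define k where "k = i - Suc (a + b + e)"
      have "i = Suc ((a + b + e) + k)" "k < c" using that n unfolding k_def by (simp; linarith)+
      then show ?thesis using w_blocks(4)[of k] by (simp add: add.assoc)
    qed
    show "w i = i - c" if "i \<in> {a + b + e + c + 1..n}" for i
    proof -
      define k where "k = i - Suc (a + b + e + c)"
      have "i = Suc ((a + b + e + c) + k)" "k < d" using that n unfolding k_def by (simp; linarith)+
      then show ?thesis using w_blocks(5)[of k] by (simp add: add.assoc)
    qed
  qed (use assms w in auto)
  have sets: "{n+1-d..n} = N" "{n+1-c..n} = Q" using n by simp_all
  have cA: "card ({1..a} \<inter> u -` Q) = card {i \<in> L. u i \<in> Q}"
    by (rule arg_cong[of _ _ card]) auto
  \<comment> \<open>The theorem counts \<open>B\<close> by values, the functional by positions;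
    injectivity of \<open>u\<close> matches the two.\<close>
  have "{1..b} \<inter> u ` N = u ` {i \<in> N. u i \<in> P}" by auto
  then have cB: "card ({1..b} \<inter> u ` N) = card {i \<in> N. u i \<in> P}"
    using card_image[OF inj_on_subset[OF permutes_inj[OF u]], of "{i \<in> N. u i \<in> P}"] by simp
  show ?thesis
    unfolding sets Let_def cA cB
    using lookup_TL_imm[OF u, of w] TL_coeff_swap_perm[OF u] by auto
qed

end
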